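(* Let $X$ be a $0$-definable (in a structure $M$) approximate subring of a ring and let $R:=\langle X\rangle$. If $R$ is of positive characteristic, then $X$ is additively commensurable with a definable (in $M$) subring of $R$ contained in $4X+X\cdot 4X$.
   Context: Rings need not be commutative or unital. A ring has positive characteristic if there is an integer $n>0$ with $nr=0$ for all its elements $r$. For subsets $B,C$ of a ring, $B+C=\{b+c\}$, $B\cdot C=BC=\{bc\}$ (the set of products), and $4B:=B+B+B+B$. A subset $X$ of a ring is additively symmetric if $0\in X$ and $-X=X$. $\langle X\rangle$ is the subring generated by $X$. An approximate subring is an additively symmetric subset $X$ of a ring such that $XX\cup(X+X)\subseteq F+X$ for some finite $F\subseteq\langle X\rangle$. Put $X_0:=X$ and $X_{n+1}:=X_nX_n+(X_n+X_n)$. $X$ is $0$-definable in a first-order structure $M$ if all $X_n$, and the restrictions of $+$ and $\cdot$ to each $X_n\times X_n$, are definable in $M$ without parameters. "Definable" means definable in $M$ with parameters from $M$. Two subsets of a ring are additively commensurable if each of them is covered by finitely many additive translates of the other one. *)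

theory Defs
  imports Main "HOL-Library.Set_Algebras"
begin

section \<open>First-order structures and definable sets\<close>

datatype 'f fo_term = Var nat | Fun 'f "'f fo_term list"

datatype ('f, 'p) fo_formula =
    Eq "'f fo_term" "'f fo_term"
  | Rel 'p "'f fo_term list"
  | Neg "('f, 'p) fo_formula"
  | Conj "('f, 'p) fo_formula" "('f, 'p) fo_formula"
  | Exists nat "('f, 'p) fo_formula"

text \<open>The fields \<open>funs\<close> and \<open>rels\<close> are the language: a pair \<open>(s, n)\<close> stands for a symbol \<open>s\<close>
  of arity \<open>n\<close>. Either set may be empty, and constants are function symbols of arity 0.\<close>

record ('f, 'p, 'm) fo_structure =
  univ :: "'m set"
  funs :: "('f \<times> nat) set"
  rels :: "('p \<times> nat) set"
  fun_interp :: "'f \<Rightarrow> 'm list \<Rightarrow> 'm"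
  rel_interp :: "'p \<Rightarrow> 'm list \<Rightarrow> bool"

definition tuples :: "'m set \<Rightarrow> nat \<Rightarrow> 'm list set" where
  "tuples A n = {xs. length xs = n \<and> set xs \<subseteq> A}"

definition is_fo_structure :: "('f, 'p, 'm) fo_structure \<Rightarrow> bool" where
  "is_fo_structure M \<longleftrightarrow> univ M \<noteq> {} \<and>
     (\<forall>(f, n) \<in> funs M. \<forall>xs \<in> tuples (univ M) n. fun_interp M f xs \<in> univ M)"

fun wf_term :: "('f, 'p, 'm) fo_structure \<Rightarrow> 'f fo_term \<Rightarrow> bool" where
  "wf_term M (Var i) \<longleftrightarrow> True"
| "wf_term M (Fun f ts) \<longleftrightarrow> (f, length ts) \<in> funs M \<and> (\<forall>t \<in> set ts. wf_term M t)"

fun wf_formula :: "('f, 'p, 'm) fo_structure \<Rightarrow> ('f, 'p) fo_formula \<Rightarrow> bool" where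
  "wf_formula M (Eq s t) \<longleftrightarrow> wf_term M s \<and> wf_term M t"
| "wf_formula M (Rel p ts) \<longleftrightarrow> (p, length ts) \<in> rels M \<and> (\<forall>t \<in> set ts. wf_term M t)"
| "wf_formula M (Neg \<phi>) \<longleftrightarrow> wf_formula M \<phi>"
| "wf_formula M (Conj \<phi> \<psi>) \<longleftrightarrow> wf_formula M \<phi> \<and> wf_formula M \<psi>"
| "wf_formula M (Exists i \<phi>) \<longleftrightarrow> wf_formula M \<phi>"

fun vars_term :: "'f fo_term \<Rightarrow> nat set" where
  "vars_term (Var i) = {i}"
| "vars_term (Fun f ts) = (\<Union>t \<in> set ts. vars_term t)"

fun free_vars :: "('f, 'p) fo_formula \<Rightarrow> nat set" where
  "free_vars (Eq s t) = vars_term s \<union> vars_term t"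
| "free_vars (Rel p ts) = (\<Union>t \<in> set ts. vars_term t)"
| "free_vars (Neg \<phi>) = free_vars \<phi>"
| "free_vars (Conj \<phi> \<psi>) = free_vars \<phi> \<union> free_vars \<psi>"
| "free_vars (Exists i \<phi>) = free_vars \<phi> - {i}"

fun eval_term :: "('f, 'p, 'm) fo_structure \<Rightarrow> (nat \<Rightarrow> 'm) \<Rightarrow> 'f fo_term \<Rightarrow> 'm" where
  "eval_term M e (Var i) = e i"
| "eval_term M e (Fun f ts) = fun_interp M f (map (eval_term M e) ts)"

fun sat :: "('f, 'p, 'm) fo_structure \<Rightarrow> (nat \<Rightarrow> 'm) \<Rightarrow> ('f, 'p) fo_formula \<Rightarrow> bool" where
  "sat M e (Eq s t) \<longleftrightarrow> eval_term M e s = eval_term M e t"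
| "sat M e (Rel p ts) \<longleftrightarrow> rel_interp M p (map (eval_term M e) ts)"
| "sat M e (Neg \<phi>) \<longleftrightarrow> \<not> sat M e \<phi>"
| "sat M e (Conj \<phi> \<psi>) \<longleftrightarrow> sat M e \<phi> \<and> sat M e \<psi>"
| "sat M e (Exists i \<phi>) \<longleftrightarrow> (\<exists>a \<in> univ M. sat M (e(i := a)) \<phi>)"

text \<open>\<open>D\<close> is a subset of the \<open>n\<close>-th Cartesian power of the universe that is definable with
  parameters from \<open>A\<close>. Variables \<open>0, \<dots>, n - 1\<close> stand for the coordinates, the next ones for the
  parameters \<open>ps\<close>; the bound on the free variables means that no value of \<open>(!)\<close> beyond the end
  of \<open>xs @ ps\<close> matters.\<close>

definition definable_over ::
  "('f, 'p, 'm) fo_structure \<Rightarrow> 'm set \<Rightarrow> nat \<Rightarrow> 'm list set \<Rightarrow> bool" where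
  "definable_over M A n D \<longleftrightarrow>
     (\<exists>\<phi> ps. wf_formula M \<phi> \<and> set ps \<subseteq> A \<and> free_vars \<phi> \<subseteq> {..<n + length ps} \<and>
        D = {xs \<in> tuples (univ M) n. sat M (\<lambda>i. (xs @ ps) ! i) \<phi>})"

section \<open>Approximate subrings\<close>

text \<open>The type class \<open>ring\<close> requires neither commutativity nor a unit. On sets, \<open>+\<close> and \<open>*\<close> are the
  elementwise sum set and product set of \<open>Set_Algebras\<close>, whereas the unary \<open>-\<close> would be the
  complement.\<close>

definition is_subring :: "'a::ring set \<Rightarrow> bool" where
  "is_subring S \<longleftrightarrow> 0 \<in> S \<and> (\<forall>x \<in> S. \<forall>y \<in> S. x - y \<in> S \<and> x * y \<in> S)"

definition generated_subring :: "'a::ring set \<Rightarrow> 'a set" where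
  "generated_subring X = \<Inter>{S. is_subring S \<and> X \<subseteq> S}"

definition positive_characteristic :: "'a::ring set \<Rightarrow> bool" where
  "positive_characteristic R \<longleftrightarrow> (\<exists>n::nat. n > 0 \<and> (\<forall>r \<in> R. (\<Sum>i<n. r) = 0))"

definition additively_symmetric :: "'a::ring set \<Rightarrow> bool" where
  "additively_symmetric X \<longleftrightarrow> 0 \<in> X \<and> uminus ` X = X"

definition approximate_subring :: "'a::ring set \<Rightarrow> bool" where
  "approximate_subring X \<longleftrightarrow> additively_symmetric X \<and>
     (\<exists>F. finite F \<and> F \<subseteq> generated_subring X \<and> X * X \<union> (X + X) \<subseteq> F + X)"

primrec iter_set :: "'a::ring set \<Rightarrow> nat \<Rightarrow> 'a set" where
  "iter_set X 0 = X"
| "iter_set X (Suc n) = iter_set X n * iter_set X n + (iter_set X n + iter_set X n)"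

definition additively_commensurable :: "'a::ring set \<Rightarrow> 'a set \<Rightarrow> bool" where
  "additively_commensurable A B \<longleftrightarrow>
     (\<exists>F. finite F \<and> A \<subseteq> F + B) \<and> (\<exists>F. finite F \<and> B \<subseteq> F + A)"

text \<open>That the elements of the ring generated by \<open>X\<close> are \<open>k\<close>-tuples from \<open>M\<close> is expressed by an
  injective map \<open>c\<close> sending each of them to the corresponding tuple. The restricted operations are
  definable as graphs, i.e. as sets of \<open>3 * k\<close>-tuples.\<close>

definition zero_definable ::
  "('f, 'p, 'm) fo_structure \<Rightarrow> nat \<Rightarrow> ('a::ring \<Rightarrow> 'm list) \<Rightarrow> 'a set \<Rightarrow> bool" where
  "zero_definable M k c X \<longleftrightarrow> inj_on c (generated_subring X) \<and>
     (\<forall>n. definable_over M {} k (c ` iter_set X n) \<and>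
          definable_over M {} (3 * k)
            {c x @ c y @ c (x + y) | x y. x \<in> iter_set X n \<and> y \<in> iter_set X n} \<and>
          definable_over M {} (3 * k)
            {c x @ c y @ c (x * y) | x y. x \<in> iter_set X n \<and> y \<in> iter_set X n})"

end

theory Submission
  imports Defs "HOL-Analysis.Function_Topology" "HOL-Analysis.Complex_Transcendental"
begin

text \<open>Write \<open>R\<close> for the ring generated by \<open>X\<close>, and \<open>4X\<close> for the fourfold sum of \<open>X\<close>. Choose a finite
\<open>F \<subseteq> R\<close> with \<open>X + X \<subseteq> F + X\<close>. As the additive group of \<open>R\<close> has bounded exponent, \<open>F\<close> generates a
finite additive group \<open>E\<close>, and then \<open>Y = X + E\<close> is closed under subtraction. So \<open>X\<close> is a definable
subset of a definable abelian group \<open>Y\<close> of bounded exponent, and finitely many translates of it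
cover \<open>Y\<close>. The proof finds a definable additive subgroup of finite index in \<open>Y\<close> inside \<open>4X\<close>, and
turns it into a subring.

\<^emph>\<open>A subgroup, regardless of definability.\<close> Put \<open>D = X - X\<close>. Averaging over finite subgroups of \<open>Y\<close> and
passing to a limit gives a positive definite function \<open>a\<close> on \<open>Y\<close> that vanishes outside \<open>D\<close> and has a
positive mean. Only finitely many characters carry a noticeable amount of its spectrum; as the
exponent is bounded, their common kernel \<open>H\<close> has finite index. On \<open>H\<close> these characters contribute at
least a fixed positive amount to \<open>a\<close>, while all others together are small in mean square on each
coset of a suitable finite group. Hence \<open>H - D\<close> is null: for every \<open>\<delta> > 0\<close> there is a finite group
\<open>G\<close> in each coset of which \<open>H - D\<close> has relative density at most \<open>\<delta>\<close>
(\<open>difference_set_contains_almost_subgroup\<close>).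

\<^emph>\<open>A definable subgroup.\<close> Let \<open>L\<close> be the least definable subgroup containing \<open>H\<close>. A dense definable
subset \<open>A\<close> of \<open>L\<close> cannot miss \<open>H\<close> up to a null set. Indeed, let \<open>C\<close> be the union of the cosets of \<open>H\<close>
that \<open>A\<close> meets essentially. For all \<open>t\<close> in some set of which finitely many translates cover \<open>Y\<close>,
\<open>A \<inter> (t + A)\<close> is dense again, and it lives on \<open>C \<inter> (t + C)\<close>. Either this makes \<open>C\<close> smaller, and one starts again with
\<open>A \<inter> (t + A)\<close>, or the stabiliser of \<open>C\<close> contains a definable set that covers \<open>Y\<close> by finitely many
translates. Then the stabiliser is definable, so it contains \<open>L\<close>, and \<open>C = L\<close>
(\<open>hull_no_wide_set\<close>). Therefore \<open>L - D\<close> is not dense, so \<open>D\<close> and \<open>t + D\<close> meet for each \<open>t \<in> L\<close>, which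
says \<open>L \<subseteq> D - D = 4X\<close>. Density is not a first-order condition; the argument uses the first-order
condition \<open>wide\<close> in its place.

\<^emph>\<open>A subring.\<close> Start with such a definable group \<open>H\<^sub>0 \<subseteq> 4X\<close>. For a definable subgroup \<open>H\<^sub>1\<close> of finite
index in \<open>H\<^sub>0\<close> the set \<open>X * H\<^sub>1\<close> meets only finitely many cosets of \<open>H\<^sub>0\<close>. If \<open>H\<^sub>1\<close> is small enough
and their number is least possible, then \<open>T = H\<^sub>0 + X * H\<^sub>1\<close> is an additive group (\<open>additive_group_of_products\<close>). The subring is
\<open>{t \<in> T. \<forall>w\<in>T. w * t \<in> T}\<close>: it lies in \<open>T \<subseteq> 4X + X * 4X\<close>, and it contains a definable subgroup of
finite index in \<open>H\<^sub>0\<close>, which makes it definable and commensurable with \<open>X\<close>.\<close>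

section \<open>Finite subgroups of abelian groups of bounded exponent\<close>

definition add_subgroup :: "'a::ab_group_add set \<Rightarrow> bool" where
  "add_subgroup S \<longleftrightarrow> 0 \<in> S \<and> (\<forall>x\<in>S. \<forall>y\<in>S. x - y \<in> S)"

lemma add_subgroup_zero: "add_subgroup S \<Longrightarrow> 0 \<in> S"
  and add_subgroup_diff: "add_subgroup S \<Longrightarrow> x \<in> S \<Longrightarrow> y \<in> S \<Longrightarrow> x - y \<in> S"
  by (auto simp: add_subgroup_def)

lemma add_subgroup_minus: "add_subgroup S \<Longrightarrow> x \<in> S \<Longrightarrow> - x \<in> S"
  using add_subgroup_diff[of S 0 x] add_subgroup_zero[of S] by simp

lemma add_subgroup_add: "add_subgroup S \<Longrightarrow> x \<in> S \<Longrightarrow> y \<in> S \<Longrightarrow> x + y \<in> S"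
  using add_subgroup_diff[of S x "- y"] add_subgroup_minus[of S y] by simp

lemma add_subgroup_add_cancel:
  assumes "add_subgroup S" "x \<in> S"
  shows "x + y \<in> S \<longleftrightarrow> y \<in> S"
  using add_subgroup_diff[OF assms(1), of "x + y" x] add_subgroup_add[OF assms(1), of x y] assms(2)
  by auto

lemma add_subgroup_Int: "add_subgroup S \<Longrightarrow> add_subgroup T \<Longrightarrow> add_subgroup (S \<inter> T)"
  by (auto simp: add_subgroup_def)

text \<open>A sum of \<open>m\<close> copies: a ring without unit has no embedding \<open>of_nat\<close> that could express the multiple.\<close>
abbreviation nat_multiple :: "nat \<Rightarrow> 'a::ab_group_add \<Rightarrow> 'a" (infixr "\<cdot>" 75) where
  "m \<cdot> x \<equiv> (\<Sum>i<m. x)"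

lemma nat_multiple_add: "(m + l) \<cdot> x = m \<cdot> x + l \<cdot> (x::'a::ab_group_add)"
  by (induction l) (simp_all add: algebra_simps)

lemma nat_multiple_mult: "(m * l) \<cdot> x = m \<cdot> (l \<cdot> (x::'a::ab_group_add))"
  by (induction m) (simp_all add: nat_multiple_add add.commute)

lemma nat_multiple_mem: "add_subgroup S \<Longrightarrow> x \<in> S \<Longrightarrow> m \<cdot> x \<in> S"
  by (induction m) (auto simp: add_subgroup_zero intro: add_subgroup_add)

lemma nat_multiple_mod:
  assumes "n \<cdot> x = (0::'a::ab_group_add)"
  shows "m \<cdot> x = (m mod n) \<cdot> x"
proof -
  have "m \<cdot> x = (m div n * n + m mod n) \<cdot> x" by simp
  also have "\<dots> = (m div n) \<cdot> (n \<cdot> x) + (m mod n) \<cdot> x"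
    by (simp only: nat_multiple_add nat_multiple_mult)
  finally show ?thesis using assms by simp
qed

lemma nat_multiple_minus:
  assumes "n \<cdot> x = (0::'a::ab_group_add)" "n > 0"
  shows "- (m \<cdot> x) = (m * (n - 1)) \<cdot> x"
proof -
  have "m + m * (n - 1) = m * n" using assms(2) by (cases n) auto
  then have "m \<cdot> x + (m * (n - 1)) \<cdot> x = m \<cdot> (n \<cdot> x)"
    by (simp only: nat_multiple_add[symmetric] nat_multiple_mult[symmetric])
  also have "\<dots> = 0" using assms(1) by simp
  finally show ?thesis by (simp add: minus_unique)
qed

definition adjoin :: "'a::ab_group_add set \<Rightarrow> 'a \<Rightarrow> 'a set" where
  "adjoin K f = {k + m \<cdot> f | k m. k \<in> K}"

lemma adjoin_superset: "K \<subseteq> adjoin K f"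
proof
  fix k assume "k \<in> K"
  then have "k + 0 \<cdot> f \<in> adjoin K f" unfolding adjoin_def by blast
  then show "k \<in> adjoin K f" by simp
qed

lemma mem_adjoin: "add_subgroup K \<Longrightarrow> f \<in> adjoin K f"
proof -
  assume "add_subgroup K"
  then have "0 + 1 \<cdot> f \<in> adjoin K f" unfolding adjoin_def using add_subgroup_zero by blast
  then show ?thesis by simp
qed

lemma adjoin_subset:
  assumes "add_subgroup Y" "K \<subseteq> Y" "f \<in> Y"
  shows "adjoin K f \<subseteq> Y"
  using assms by (auto simp: adjoin_def subset_iff intro!: add_subgroup_add nat_multiple_mem simp del: sum_constant)

lemma add_subgroup_adjoin:
  assumes K: "add_subgroup K" and n: "n \<cdot> f = 0" "n > 0"
  shows "add_subgroup (adjoin K f)"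
  unfolding add_subgroup_def
proof (intro conjI ballI)
  show "0 \<in> adjoin K f" using adjoin_superset add_subgroup_zero[OF K] by blast
  fix x y assume "x \<in> adjoin K f" "y \<in> adjoin K f"
  then obtain k m k' m' where *: "x = k + m \<cdot> f" "y = k' + m' \<cdot> f" "k \<in> K" "k' \<in> K"
    unfolding adjoin_def by blast
  have "x - y = (k - k') + (m \<cdot> f + - (m' \<cdot> f))" using * by simp
  also have "\<dots> = (k - k') + (m + m' * (n - 1)) \<cdot> f"
    by (simp only: nat_multiple_minus[OF n] nat_multiple_add)
  finally show "x - y \<in> adjoin K f"
    unfolding adjoin_def using add_subgroup_diff[OF K *(3,4)] by blast
qed

lemma finite_adjoin:
  assumes K: "finite K" and n: "n \<cdot> f = 0" "n > 0"
  shows "finite (adjoin K f)"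
proof -
  have "adjoin K f \<subseteq> (\<lambda>(k, m). k + m \<cdot> f) ` (K \<times> {..<n})"
  proof
    fix x assume "x \<in> adjoin K f"
    then obtain k m where "x = k + m \<cdot> f" "k \<in> K" unfolding adjoin_def by blast
    then have "x = k + (m mod n) \<cdot> f" using nat_multiple_mod[OF n(1), of m] by simp
    then show "x \<in> (\<lambda>(k, m). k + m \<cdot> f) ` (K \<times> {..<n})"
      using \<open>k \<in> K\<close> n(2) by (intro image_eqI[of _ _ "(k, m mod n)"]) auto
  qed
  then show ?thesis using K finite_subset by blast
qed

definition finite_subgroup_of :: "'a::ab_group_add set \<Rightarrow> 'a set \<Rightarrow> bool" where
  "finite_subgroup_of Y G \<longleftrightarrow> finite G \<and> add_subgroup G \<and> G \<subseteq> Y"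

text \<open>The group generated by a finite set is finite: adjoin its elements one at a time, each of which
has only finitely many multiples.\<close>
lemma finite_subgroup_extend:
  assumes Y: "add_subgroup Y" and n: "n > 0" "\<And>y. y \<in> Y \<Longrightarrow> n \<cdot> y = 0"
    and G: "finite_subgroup_of Y G" and F: "finite F" "F \<subseteq> Y"
  obtains G' where "finite_subgroup_of Y G'" "G \<subseteq> G'" "F \<subseteq> G'"
proof -
  have "\<exists>G'. finite_subgroup_of Y G' \<and> G \<subseteq> G' \<and> F \<subseteq> G'"
    using F
  proof (induction F rule: finite_induct)
    case empty
    then show ?case using G by blast
  next
    case (insert f F)
    then obtain G' where G': "finite_subgroup_of Y G'" "G \<subseteq> G'" "F \<subseteq> G'" by auto
    have f: "n \<cdot> f = 0" "f \<in> Y" using insert n by auto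
    have "finite_subgroup_of Y (adjoin G' f)"
      using G'(1) adjoin_subset[OF Y _ f(2)] add_subgroup_adjoin[OF _ f(1) n(1)] finite_adjoin[OF _ f(1) n(1)]
      unfolding finite_subgroup_of_def by blast
    moreover have "f \<in> adjoin G' f" "G' \<subseteq> adjoin G' f"
      using G'(1) mem_adjoin adjoin_superset unfolding finite_subgroup_of_def by blast+
    ultimately show ?case using G' by blast
  qed
  then show ?thesis using that by blast
qed

locale bounded_exponent_group =
  fixes Y :: "'a::ab_group_add set" and n :: nat
  assumes subgroup: "add_subgroup Y"
    and exponent_pos: "n > 0"
    and exponent: "y \<in> Y \<Longrightarrow> n \<cdot> y = 0"
begin

abbreviation "fin_subgroup \<equiv> finite_subgroup_of Y"

lemma trivial_fin_subgroup: "fin_subgroup {0}"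
  using subgroup by (auto simp: finite_subgroup_of_def add_subgroup_def)

lemma extend:
  assumes "fin_subgroup G" "finite F" "F \<subseteq> Y"
  obtains G' where "fin_subgroup G'" "G \<subseteq> G'" "F \<subseteq> G'"
  by (rule finite_subgroup_extend[OF subgroup exponent_pos exponent assms]) (use that in blast)+

end

lemma finite_subgroup_ofD:
  "finite_subgroup_of Y G \<Longrightarrow> finite G"
  "finite_subgroup_of Y G \<Longrightarrow> add_subgroup G"
  "finite_subgroup_of Y G \<Longrightarrow> G \<subseteq> Y"
  by (auto simp: finite_subgroup_of_def)

lemma finite_subgroup_card_pos: "finite_subgroup_of Y G \<Longrightarrow> card G > 0"
  by (auto simp: finite_subgroup_of_def card_gt_0_iff add_subgroup_def)

lemma sum_subgroup_translate:
  assumes "add_subgroup G" "g \<in> G"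
  shows "(\<Sum>x\<in>G. f (g + x)) = (\<Sum>x\<in>G. f x)"
  by (rule sum.reindex_bij_witness[of _ "\<lambda>x. x - g" "\<lambda>x. g + x"])
    (use assms in \<open>auto intro: add_subgroup_add add_subgroup_diff\<close>)

section \<open>Characters of finite subgroups\<close>
text \<open>Characters take the value 0 outside \<open>G\<close>, so that a character of \<open>G\<close> is determined by its
values on \<open>G\<close>.\<close>
definition characters :: "'a::ab_group_add set \<Rightarrow> ('a \<Rightarrow> complex) set" where
  "characters G = {\<psi>. \<psi> 0 = 1 \<and> (\<forall>x\<in>G. \<forall>y\<in>G. \<psi> (x + y) = \<psi> x * \<psi> y) \<and> (\<forall>x. x \<notin> G \<longrightarrow> \<psi> x = 0)}"

definition restrict_char :: "'a set \<Rightarrow> ('a \<Rightarrow> complex) \<Rightarrow> 'a \<Rightarrow> complex" where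
  "restrict_char G \<psi> = (\<lambda>x. if x \<in> G then \<psi> x else 0)"

lemma characters_zero: "\<psi> \<in> characters G \<Longrightarrow> \<psi> 0 = 1"
  and characters_add: "\<psi> \<in> characters G \<Longrightarrow> x \<in> G \<Longrightarrow> y \<in> G \<Longrightarrow> \<psi> (x + y) = \<psi> x * \<psi> y"
  and characters_outside: "\<psi> \<in> characters G \<Longrightarrow> x \<notin> G \<Longrightarrow> \<psi> x = 0"
  by (auto simp: characters_def)

lemma restrict_char_mem:
  "add_subgroup G \<Longrightarrow> G \<subseteq> G' \<Longrightarrow> \<psi> \<in> characters G' \<Longrightarrow> restrict_char G \<psi> \<in> characters G"
  by (auto simp: characters_def restrict_char_def add_subgroup_zero add_subgroup_add)

lemma characters_nat_multiple:
  assumes "\<psi> \<in> characters G" "add_subgroup G" "x \<in> G"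
  shows "\<psi> (m \<cdot> x) = \<psi> x ^ m"
proof (induction m)
  case 0
  then show ?case using assms characters_zero by simp
next
  case (Suc m)
  have "\<psi> (m \<cdot> x + x) = \<psi> (m \<cdot> x) * \<psi> x"
    using assms characters_add nat_multiple_mem by blast
  then show ?case using Suc by simp
qed

definition trivial_char :: "'a set \<Rightarrow> 'a \<Rightarrow> complex" where
  "trivial_char G = (\<lambda>x. if x \<in> G then 1 else 0)"

lemma trivial_char_mem: "add_subgroup G \<Longrightarrow> trivial_char G \<in> characters G"
  by (auto simp: characters_def trivial_char_def add_subgroup_zero add_subgroup_add)

context bounded_exponent_group
begin

lemma characters_root:
  assumes "fin_subgroup G" "\<psi> \<in> characters G" "x \<in> G"
  shows "\<psi> x ^ n = 1"
  using characters_nat_multiple[OF assms(2) _ assms(3), of n] exponent[of x] assms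
  by (auto simp: finite_subgroup_of_def characters_zero subset_iff)

lemma norm_character:
  assumes "fin_subgroup G" "\<psi> \<in> characters G" "x \<in> G"
  shows "norm (\<psi> x) = 1"
proof -
  have "norm (\<psi> x) ^ n = 1" using characters_root[OF assms] by (metis norm_one norm_power)
  then show ?thesis using exponent_pos power_eq_iff_eq_base[of n "norm (\<psi> x)" 1] by simp
qed

lemma norm_character_le:
  assumes "fin_subgroup G" "\<psi> \<in> characters G"
  shows "norm (\<psi> x) \<le> 1"
  by (cases "x \<in> G") (use norm_character[OF assms] characters_outside[OF assms(2)] in auto)

lemma cnj_character:
  assumes "fin_subgroup G" "\<psi> \<in> characters G" "x \<in> G"
  shows "cnj (\<psi> x) = \<psi> (- x)"
proof -
  have "\<psi> x * \<psi> (- x) = 1"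
    using characters_add[OF assms(2,3), of "- x"] assms characters_zero[OF assms(2)]
      add_subgroup_minus[of G x] by (auto simp: finite_subgroup_of_def)
  moreover have "\<psi> x * cnj (\<psi> x) = 1"
    using norm_character[OF assms] by (simp add: complex_norm_square[symmetric])
  moreover have "\<psi> x \<noteq> 0" using norm_character[OF assms] by auto
  ultimately show ?thesis by (metis mult_left_cancel)
qed

lemma finite_characters:
  assumes "fin_subgroup G"
  shows "finite (characters G)"
proof (rule finite_subset)
  show "characters G \<subseteq> {f. \<forall>x. (x \<in> G \<longrightarrow> f x \<in> {z. z ^ n = 1}) \<and> (x \<notin> G \<longrightarrow> f x = 0)}"
    using characters_root[OF assms] characters_outside by blast
  show "finite {f. \<forall>x. (x \<in> G \<longrightarrow> f x \<in> {z::complex. z ^ n = 1}) \<and> (x \<notin> G \<longrightarrow> f x = 0)}"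
    using assms exponent_pos
    by (intro finite_set_of_finite_funs finite_roots_unity) (auto simp: finite_subgroup_of_def)
qed

text \<open>If \<open>m\<close> is the order of \<open>f\<close> modulo \<open>K\<close>, the only constraint on the value \<open>w\<close> at \<open>f\<close> is the one that
comes from \<open>m \<cdot> f \<in> K\<close>.\<close>
lemma extend_character_adjoin:
  assumes K: "fin_subgroup K" and f: "f \<in> Y" and \<psi>: "\<psi> \<in> characters K"
    and m: "m > 0" "m \<cdot> f \<in> K" "\<And>i. 0 < i \<Longrightarrow> i < m \<Longrightarrow> i \<cdot> f \<notin> K"
    and w: "w ^ m = \<psi> (m \<cdot> f)"
  obtains \<psi>' where "\<psi>' \<in> characters (adjoin K f)" "\<psi>' f = w" "\<And>k. k \<in> K \<Longrightarrow> \<psi>' k = \<psi> k"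
proof -
  note sg = finite_subgroup_ofD(2)[OF K]
  have ext: "\<psi> k = \<psi> k' * w ^ d" if "k = k' + d \<cdot> f" "k \<in> K" "k' \<in> K" for k k' d
  proof -
    have df: "d \<cdot> f \<in> K"
      using add_subgroup_diff[OF sg that(2,3)] that(1) by simp
    have split: "d \<cdot> f = (d div m) \<cdot> (m \<cdot> f) + (d mod m) \<cdot> f"
      by (simp only: nat_multiple_add[symmetric] nat_multiple_mult[symmetric] div_mult_mod_eq)
    have mK: "(d div m) \<cdot> (m \<cdot> f) \<in> K" using nat_multiple_mem[OF sg m(2)] .
    then have "(d mod m) \<cdot> f \<in> K"
      using df split add_subgroup_add_cancel[OF sg mK] by simp
    then have "d mod m = 0" using m(1,3) by (metis gr0I mod_less_divisor)
    then have d: "d = d div m * m" by (metis add.right_neutral div_mult_mod_eq)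
    then have "d \<cdot> f = (d div m) \<cdot> (m \<cdot> f)"
      by (metis nat_multiple_mult)
    then have "\<psi> (d \<cdot> f) = \<psi> (m \<cdot> f) ^ (d div m)"
      using characters_nat_multiple[OF \<psi> sg m(2)] by simp
    also have "\<dots> = w ^ d" using w d by (metis mult.commute power_mult)
    finally show ?thesis using characters_add[OF \<psi> that(3) df] that(1) by simp
  qed
  \<comment> \<open>So the value \<open>\<psi> k * w ^ i\<close> at \<open>k + i \<cdot> f\<close> does not depend on the representation.\<close>
  have wd: "\<psi> k * w ^ i = \<psi> k' * w ^ j"
    if "k + i \<cdot> f = k' + j \<cdot> f" "k \<in> K" "k' \<in> K" "i \<le> j" for k i k' j
  proof -
    obtain d where d: "j = i + d" using \<open>i \<le> j\<close> by (metis le_add_diff_inverse)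
    then have "k = k' + d \<cdot> f" using that(1) by (simp only: nat_multiple_add) (simp add: algebra_simps)
    from ext[OF this that(2,3)] show ?thesis using d by (simp add: power_add)
  qed
  then have wd: "\<psi> k * w ^ i = \<psi> k' * w ^ j"
    if "k + i \<cdot> f = k' + j \<cdot> f" "k \<in> K" "k' \<in> K" for k i k' j
    using that by (metis nle_le)
  define \<psi>' where "\<psi>' x = (if x \<in> adjoin K f
     then (SOME v. \<exists>k i. k \<in> K \<and> x = k + i \<cdot> f \<and> v = \<psi> k * w ^ i) else 0)" for x
  have val: "\<psi>' (k + i \<cdot> f) = \<psi> k * w ^ i" if "k \<in> K" for k i
  proof -
    have "k + i \<cdot> f \<in> adjoin K f" using that unfolding adjoin_def by blast
    moreover have "(SOME v. \<exists>k' j. k' \<in> K \<and> k + i \<cdot> f = k' + j \<cdot> f \<and> v = \<psi> k' * w ^ j) = \<psi> k * w ^ i"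
      using that wd by (intro some_equality) (blast, metis)
    ultimately show ?thesis unfolding \<psi>'_def by simp
  qed
  have val0: "\<psi>' k = \<psi> k" if "k \<in> K" for k
    using val[OF that, of 0] by simp
  have "\<psi>' \<in> characters (adjoin K f)"
    unfolding characters_def
  proof (safe)
    show "\<psi>' 0 = 1" using val0 add_subgroup_zero[OF sg] characters_zero[OF \<psi>] by simp
    show "\<psi>' x = 0" if "x \<notin> adjoin K f" for x using that by (simp add: \<psi>'_def)
    fix x y assume "x \<in> adjoin K f" "y \<in> adjoin K f"
    then obtain k i k' j where *: "k \<in> K" "k' \<in> K" "x = k + i \<cdot> f" "y = k' + j \<cdot> f"
      unfolding adjoin_def by blast
    have "x + y = (k + k') + (i + j) \<cdot> f" using * by (simp only: nat_multiple_add) (simp add: algebra_simps)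
    then have "\<psi>' (x + y) = \<psi> (k + k') * w ^ (i + j)"
      using val[OF add_subgroup_add[OF sg *(1,2)]] by simp
    then show "\<psi>' (x + y) = \<psi>' x * \<psi>' y"
      using * val characters_add[OF \<psi> *(1,2)] by (simp add: power_add)
  qed
  moreover have "\<psi>' f = w"
    using val[OF add_subgroup_zero[OF sg], of 1] characters_zero[OF \<psi>] by simp
  ultimately show ?thesis using that val0 by blast
qed

lemma adjoin_fin_subgroup:
  assumes "fin_subgroup K" "f \<in> Y"
  shows "fin_subgroup (adjoin K f)"
  using assms adjoin_subset[OF subgroup _ assms(2)] add_subgroup_adjoin[OF _ exponent[OF assms(2)] exponent_pos]
    finite_adjoin[OF _ exponent[OF assms(2)] exponent_pos]
  unfolding finite_subgroup_of_def by blast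

lemma least_multiple:
  assumes "fin_subgroup K" "f \<in> Y"
  obtains m where "m > 0" "m \<cdot> f \<in> K" "\<And>i. 0 < i \<Longrightarrow> i < m \<Longrightarrow> i \<cdot> f \<notin> K"
proof -
  define P where "P m \<longleftrightarrow> m > 0 \<and> m \<cdot> f \<in> K" for m
  have "P n" using exponent_pos exponent[OF assms(2)] assms(1) add_subgroup_zero
    by (auto simp: P_def finite_subgroup_of_def)
  then have "P (LEAST m. P m)" by (rule LeastI)
  moreover have "\<not> P i" if "i < (LEAST m. P m)" for i using that by (rule not_less_Least)
  ultimately show ?thesis using that[of "LEAST m. P m"] unfolding P_def by blast
qed

lemma extend_character:
  assumes K: "fin_subgroup K" and G: "fin_subgroup G" and KG: "K \<subseteq> G" and \<psi>: "\<psi> \<in> characters K"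
  shows "\<exists>\<psi>'\<in>characters G. \<forall>k\<in>K. \<psi>' k = \<psi> k"
  using K KG \<psi>
proof (induction "card G - card K" arbitrary: K \<psi> rule: less_induct)
  case less
  show ?case
  proof (cases "K = G")
    case True
    then show ?thesis using less by blast
  next
    case False
    then obtain f where f: "f \<in> G" "f \<notin> K" using less by blast
    then have fY: "f \<in> Y" using G by (auto simp: finite_subgroup_of_def)
    obtain m where m: "m > 0" "m \<cdot> f \<in> K" "\<And>i. 0 < i \<Longrightarrow> i < m \<Longrightarrow> i \<cdot> f \<notin> K"
      using least_multiple[OF less(2) fY] by blast
    obtain w where w: "\<psi> (m \<cdot> f) = w ^ m" using exists_complex_root[of m] m(1) by auto
    obtain \<psi>1 where \<psi>1: "\<psi>1 \<in> characters (adjoin K f)" "\<And>k. k \<in> K \<Longrightarrow> \<psi>1 k = \<psi> k"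
      using extend_character_adjoin[OF less(2) fY less(4) m w[symmetric]] by blast
    have sub: "adjoin K f \<subseteq> G" using adjoin_subset[of G K f] G less(3) f(1) by (auto simp: finite_subgroup_of_def)
    have "f \<in> adjoin K f" using mem_adjoin less(2) by (auto simp: finite_subgroup_of_def)
    then have lt: "card K < card (adjoin K f)"
      using adjoin_superset[of K f] f(2) sub G
      by (intro psubset_card_mono) (auto simp: finite_subgroup_of_def dest: finite_subset)
    have "card (adjoin K f) \<le> card G" using sub G by (intro card_mono) (auto simp: finite_subgroup_of_def)
    then have "card G - card (adjoin K f) < card G - card K" using lt by linarith
    from less(1)[OF this adjoin_fin_subgroup[OF less(2) fY] sub \<psi>1(1)]
    obtain \<psi>' where "\<psi>' \<in> characters G" "\<forall>k\<in>adjoin K f. \<psi>' k = \<psi>1 k" by blast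
    then show ?thesis using \<psi>1(2) adjoin_superset[of K f] by (metis subsetD)
  qed
qed

text \<open>Send \<open>s\<close>, of order \<open>m \<ge> 2\<close>, to a nontrivial \<open>m\<close>-th root of unity and extend.\<close>
lemma character_separates:
  assumes G: "fin_subgroup G" and s: "s \<in> G" "s \<noteq> 0"
  obtains \<psi> where "\<psi> \<in> characters G" "\<psi> s \<noteq> 1"
proof -
  have Z: "fin_subgroup {0}" using subgroup by (auto simp: finite_subgroup_of_def add_subgroup_def)
  have sY: "s \<in> Y" using G s by (auto simp: finite_subgroup_of_def)
  obtain m where m: "m > 0" "m \<cdot> s \<in> {0}" "\<And>i. 0 < i \<Longrightarrow> i < m \<Longrightarrow> i \<cdot> s \<notin> {0}"
    using least_multiple[OF Z sY] by blast
  have "m \<noteq> 1" using m(2) s(2) by auto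
  then have m2: "m \<ge> 2" using m(1) by simp
  define w where "w = cis (2 * pi / m)"
  have "real m * (2 * pi / real m) = 2 * pi" using m(1) by simp
  then have w1: "w ^ m = 1" unfolding w_def by (simp only: Complex.DeMoivre cis_2pi)
  have "w \<noteq> 1"
  proof
    assume "w = 1"
    then have "Re w = 1" by simp
    then have "cos (2 * pi / m) = 1" by (simp add: w_def)
    moreover have "cos (2 * pi / m) < cos 0"
      using m2 by (intro cos_monotone_0_pi) (auto simp: field_simps)
    ultimately show False by simp
  qed
  have tr: "trivial_char {0::'a} \<in> characters {0}" by (rule trivial_char_mem[OF finite_subgroup_ofD(2)[OF Z]])
  have "w ^ m = trivial_char {0} (m \<cdot> s)" using w1 m(2) by (simp add: trivial_char_def)
  then obtain \<psi>1 where \<psi>1: "\<psi>1 \<in> characters (adjoin {0} s)" "\<psi>1 s = w"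
    using extend_character_adjoin[OF Z sY tr m] by blast
  have "adjoin {0} s \<subseteq> G" using adjoin_subset[of G "{0}" s] G s(1) by (auto simp: finite_subgroup_of_def add_subgroup_zero)
  then obtain \<psi> where "\<psi> \<in> characters G" "\<forall>k\<in>adjoin {0} s. \<psi> k = \<psi>1 k"
    using extend_character[OF adjoin_fin_subgroup[OF Z sY] G _ \<psi>1(1)] by blast
  moreover have "s \<in> adjoin {0} s" using mem_adjoin Z by (auto simp: finite_subgroup_of_def)
  ultimately show ?thesis using that \<psi>1(2) \<open>w \<noteq> 1\<close> by metis
qed

lemma sum_character:
  assumes G: "fin_subgroup G" and \<psi>: "\<psi> \<in> characters G"
  shows "(\<Sum>x\<in>G. \<psi> x) = (if \<psi> = trivial_char G then of_nat (card G) else 0)"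
proof (cases "\<psi> = trivial_char G")
  case True
  then show ?thesis by (simp add: trivial_char_def)
next
  case False
  then obtain g where g: "g \<in> G" "\<psi> g \<noteq> 1"
    using characters_outside[OF \<psi>] by (force simp: trivial_char_def)
  have "(\<Sum>x\<in>G. \<psi> x) = (\<Sum>x\<in>G. \<psi> (g + x))"
    using sum_subgroup_translate[OF finite_subgroup_ofD(2)[OF G] g(1), of \<psi>] by simp
  also have "\<dots> = \<psi> g * (\<Sum>x\<in>G. \<psi> x)"
    using characters_add[OF \<psi> g(1)] by (simp add: sum_distrib_left)
  finally show ?thesis using g(2) False by (simp add: algebra_simps)
qed

lemma characters_mult:
  "\<psi> \<in> characters G \<Longrightarrow> \<phi> \<in> characters G \<Longrightarrow> (\<lambda>x. \<psi> x * \<phi> x) \<in> characters G"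
  by (auto simp: characters_def)

lemma characters_cnj:
  "\<psi> \<in> characters G \<Longrightarrow> (\<lambda>x. cnj (\<psi> x)) \<in> characters G"
  by (auto simp: characters_def)

lemma character_orthogonality:
  assumes G: "fin_subgroup G" and \<psi>: "\<psi> \<in> characters G" and \<phi>: "\<phi> \<in> characters G"
  shows "(\<Sum>x\<in>G. \<psi> x * cnj (\<phi> x)) = (if \<psi> = \<phi> then of_nat (card G) else 0)"
proof -
  have "(\<lambda>x. \<psi> x * cnj (\<phi> x)) = trivial_char G \<longleftrightarrow> \<psi> = \<phi>"
  proof
    assume eq: "(\<lambda>x. \<psi> x * cnj (\<phi> x)) = trivial_char G"
    show "\<psi> = \<phi>"
    proof
      fix x show "\<psi> x = \<phi> x"
      proof (cases "x \<in> G")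
        case True
        have 1: "\<psi> x * cnj (\<phi> x) = 1" using fun_cong[OF eq, of x] True by (simp add: trivial_char_def)
        have 2: "\<phi> x * cnj (\<phi> x) = 1"
          using norm_character[OF G \<phi> True] by (simp add: complex_norm_square[symmetric])
        have "cnj (\<phi> x) \<noteq> 0" using 2 by auto
        then show ?thesis using 1 2 by (metis mult_right_cancel)
      next
        case False
        then show ?thesis using characters_outside \<psi> \<phi> by metis
      qed
    qed
  next
    assume "\<psi> = \<phi>"
    then show "(\<lambda>x. \<psi> x * cnj (\<phi> x)) = trivial_char G"
      using norm_character[OF G \<phi>] characters_outside[OF \<phi>]
      by (auto simp: trivial_char_def complex_norm_square[symmetric])
  qed
  then show ?thesis
    using sum_character[OF G characters_mult[OF \<psi> characters_cnj[OF \<phi>]]] by simp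
qed

text \<open>Multiplication by a character that is not 1 at \<open>s\<close> permutes the characters and multiplies the sum
by a number other than 1.\<close>
lemma sum_over_characters_nonzero:
  assumes G: "fin_subgroup G" and s: "s \<in> G" "s \<noteq> 0"
  shows "(\<Sum>\<psi>\<in>characters G. \<psi> s) = 0"
proof -
  obtain \<phi> where \<phi>: "\<phi> \<in> characters G" "\<phi> s \<noteq> 1" using character_separates[OF G s] .
  have inv: "\<phi> x * (cnj (\<phi> x) * \<psi> x) = \<psi> x" "cnj (\<phi> x) * (\<phi> x * \<psi> x) = \<psi> x"
    if "\<psi> \<in> characters G" for x \<psi>
  proof (atomize (full), cases "x \<in> G")
    case True
    have "\<phi> x * cnj (\<phi> x) = 1"
      using norm_character[OF G \<phi>(1) True] by (simp add: complex_norm_square[symmetric])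
    then show "\<phi> x * (cnj (\<phi> x) * \<psi> x) = \<psi> x \<and> cnj (\<phi> x) * (\<phi> x * \<psi> x) = \<psi> x"
      by (metis mult.assoc mult.commute mult_1)
  next
    case False
    then show "\<phi> x * (cnj (\<phi> x) * \<psi> x) = \<psi> x \<and> cnj (\<phi> x) * (\<phi> x * \<psi> x) = \<psi> x"
      using characters_outside[OF that] by simp
  qed
  have "(\<Sum>\<psi>\<in>characters G. \<psi> s) = (\<Sum>\<psi>\<in>characters G. \<phi> s * \<psi> s)"
    by (rule sum.reindex_bij_witness[of _ "\<lambda>\<psi> x. \<phi> x * \<psi> x" "\<lambda>\<psi> x. cnj (\<phi> x) * \<psi> x"])
      (use inv characters_mult[OF \<phi>(1)] characters_mult[OF characters_cnj[OF \<phi>(1)]] in auto)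
  also have "\<dots> = \<phi> s * (\<Sum>\<psi>\<in>characters G. \<psi> s)" by (simp add: sum_distrib_left)
  finally show ?thesis using \<phi>(2) by (simp add: algebra_simps)
qed

text \<open>Count \<open>\<Sum>s \<Sum>\<psi> \<psi> s\<close> in both orders: only \<open>s = 0\<close>, respectively only the trivial character,
contributes.\<close>
lemma card_characters:
  assumes G: "fin_subgroup G"
  shows "card (characters G) = card G"
proof -
  note fin = finite_subgroup_ofD(1)[OF G] and sg = finite_subgroup_ofD(2)[OF G]
  have "of_nat (card (characters G)) = (\<Sum>s\<in>{0}. \<Sum>\<psi>\<in>characters G. \<psi> s)"
    by (simp add: characters_zero cong: sum.cong)
  also have "\<dots> = (\<Sum>s\<in>G. \<Sum>\<psi>\<in>characters G. \<psi> s)"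
    using sum_over_characters_nonzero[OF G] fin add_subgroup_zero[OF sg]
    by (intro sum.mono_neutral_left) auto
  also have "\<dots> = (\<Sum>\<psi>\<in>characters G. \<Sum>s\<in>G. \<psi> s)" by (rule sum.swap)
  also have "\<dots> = (\<Sum>\<psi>\<in>characters G. if \<psi> = trivial_char G then of_nat (card G) else 0)"
    by (rule sum.cong) (use sum_character[OF G] in auto)
  also have "\<dots> = (of_nat (card G) :: complex)"
    using finite_characters[OF G] trivial_char_mem[OF sg] by (simp add: sum.delta)
  finally show ?thesis by (simp only: of_nat_eq_iff)
qed

text \<open>The real part suffices because the functions of interest are even, so that their Fourier
coefficients are real.\<close>
definition fourier :: "'a set \<Rightarrow> ('a \<Rightarrow> real) \<Rightarrow> ('a \<Rightarrow> complex) \<Rightarrow> real" where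
  "fourier G a \<psi> = (\<Sum>s\<in>G. a s * Re (\<psi> s)) / card G"

lemma fourier_complex:
  assumes G: "fin_subgroup G" and even: "\<And>s. s \<in> G \<Longrightarrow> a (- s) = a s" and \<psi>: "\<psi> \<in> characters G"
  shows "complex_of_real (fourier G a \<psi>) = (\<Sum>s\<in>G. of_real (a s) * cnj (\<psi> s)) / of_nat (card G)"
proof -
  note sg = finite_subgroup_ofD(2)[OF G]
  let ?S = "\<Sum>s\<in>G. of_real (a s) * cnj (\<psi> s)"
  have "?S = (\<Sum>s\<in>G. of_real (a s) * \<psi> s)"
    by (rule sum.reindex_bij_witness[of _ uminus uminus])
      (use even cnj_character[OF G \<psi>] add_subgroup_minus[OF sg] in auto)
  also have "\<dots> = cnj ?S" by simp
  finally have "?S \<in> \<real>" by (simp add: Reals_cnj_iff)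
  then have "?S = of_real (Re ?S)" by (simp only: of_real_Re)
  also have "Re ?S = (\<Sum>s\<in>G. a s * Re (\<psi> s))" by simp
  finally show ?thesis unfolding fourier_def by simp
qed

lemma fourier_inversion:
  assumes G: "fin_subgroup G" and even: "\<And>s. s \<in> G \<Longrightarrow> a (- s) = a s" and s: "s \<in> G"
  shows "complex_of_real (a s) = (\<Sum>\<psi>\<in>characters G. of_real (fourier G a \<psi>) * \<psi> s)"
proof -
  note fin = finite_subgroup_ofD(1)[OF G] and sg = finite_subgroup_ofD(2)[OF G]
  have inner: "(\<Sum>\<psi>\<in>characters G. cnj (\<psi> t) * \<psi> s) = (if t = s then of_nat (card G) else 0)"
    if "t \<in> G" for t
  proof -
    have "(\<Sum>\<psi>\<in>characters G. cnj (\<psi> t) * \<psi> s) = (\<Sum>\<psi>\<in>characters G. \<psi> (s - t))"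
    proof (rule sum.cong)
      fix \<psi> assume \<psi>: "\<psi> \<in> characters G"
      have "\<psi> (- t + s) = \<psi> (- t) * \<psi> s"
        using characters_add[OF \<psi> add_subgroup_minus[OF sg that] s] .
      then show "cnj (\<psi> t) * \<psi> s = \<psi> (s - t)" using cnj_character[OF G \<psi> that] by simp
    qed simp
    then show ?thesis
      using sum_over_characters_nonzero[OF G add_subgroup_diff[OF sg s that]] card_characters[OF G]
        by (auto simp: characters_zero cong: sum.cong)
  qed
  have "(\<Sum>\<psi>\<in>characters G. of_real (fourier G a \<psi>) * \<psi> s)
      = (\<Sum>\<psi>\<in>characters G. \<Sum>t\<in>G. of_real (a t) * (cnj (\<psi> t) * \<psi> s) / of_nat (card G))"
    by (rule sum.cong)
      (auto simp: fourier_complex[of G a, OF G even] sum_divide_distrib sum_distrib_right mult.assoc)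
  also have "\<dots> = (\<Sum>t\<in>G. \<Sum>\<psi>\<in>characters G. of_real (a t) * (cnj (\<psi> t) * \<psi> s) / of_nat (card G))"
    by (rule sum.swap)
  also have "\<dots> = (\<Sum>t\<in>G. of_real (a t) * (\<Sum>\<psi>\<in>characters G. cnj (\<psi> t) * \<psi> s) / of_nat (card G))"
    by (simp add: sum_divide_distrib sum_distrib_left)
  also have "\<dots> = (\<Sum>t\<in>G. if t = s then of_real (a t) else 0)"
    using inner finite_subgroup_card_pos[OF G] by (intro sum.cong) auto
  also have "\<dots> = of_real (a s)" using fin s by simp
  finally show ?thesis by simp
qed

text \<open>Restricting a function to a smaller group pushes its Fourier transform forward along the restriction
of characters. This compatibility replaces the dual group and the spectral measure on it.\<close>
lemma fourier_restrict:
  assumes G: "fin_subgroup G" and G': "fin_subgroup G'" and sub: "G \<subseteq> G'"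
    and even: "\<And>s. s \<in> G' \<Longrightarrow> a (- s) = a s" and \<phi>: "\<phi> \<in> characters G"
  shows "fourier G a \<phi> = (\<Sum>\<psi> | \<psi> \<in> characters G' \<and> restrict_char G \<psi> = \<phi>. fourier G' a \<psi>)"
proof -
  have card0: "card G \<noteq> 0" using finite_subgroup_card_pos[OF G] by simp
  have "complex_of_real (fourier G a \<phi>)
      = (\<Sum>s\<in>G. of_real (a s) * cnj (\<phi> s)) / of_nat (card G)"
    using fourier_complex[OF G _ \<phi>] even sub by (metis subsetD)
  also have "(\<Sum>s\<in>G. of_real (a s) * cnj (\<phi> s))
     = (\<Sum>s\<in>G. \<Sum>\<psi>\<in>characters G'. of_real (fourier G' a \<psi>) * (restrict_char G \<psi> s * cnj (\<phi> s)))"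
  proof (rule sum.cong)
    fix s assume s: "s \<in> G"
    then have "complex_of_real (a s) = (\<Sum>\<psi>\<in>characters G'. of_real (fourier G' a \<psi>) * \<psi> s)"
      using fourier_inversion[of G' a s, OF G' even] sub by blast
    then show "of_real (a s) * cnj (\<phi> s)
      = (\<Sum>\<psi>\<in>characters G'. of_real (fourier G' a \<psi>) * (restrict_char G \<psi> s * cnj (\<phi> s)))"
      using s by (simp add: sum_distrib_right restrict_char_def mult.assoc)
  qed simp
  also have "\<dots> = (\<Sum>\<psi>\<in>characters G'. of_real (fourier G' a \<psi>) * (\<Sum>s\<in>G. restrict_char G \<psi> s * cnj (\<phi> s)))"
    by (subst sum.swap) (simp add: sum_distrib_left)
  also have "\<dots> = (\<Sum>\<psi>\<in>characters G'. if restrict_char G \<psi> = \<phi> then of_real (fourier G' a \<psi>) * of_nat (card G) else 0)"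
    using character_orthogonality[OF G restrict_char_mem[OF finite_subgroup_ofD(2)[OF G] sub] \<phi>]
    by (intro sum.cong) auto
  also have "\<dots> = (\<Sum>\<psi> | \<psi> \<in> characters G' \<and> restrict_char G \<psi> = \<phi>. of_real (fourier G' a \<psi>) * of_nat (card G))"
    using finite_characters[OF G'] by (simp add: sum.inter_filter)
  also have "\<dots> / of_nat (card G) = (\<Sum>\<psi> | \<psi> \<in> characters G' \<and> restrict_char G \<psi> = \<phi>. of_real (fourier G' a \<psi>))"
    using card0 by (simp add: sum_divide_distrib)
  also have "\<dots> = of_real (\<Sum>\<psi> | \<psi> \<in> characters G' \<and> restrict_char G \<psi> = \<phi>. fourier G' a \<psi>)" by simp
  finally show ?thesis by (simp only: of_real_eq_iff)
qed

end

section \<open>Zeros of positive definite functions\<close>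
definition syndetic_in :: "'a::ab_group_add set \<Rightarrow> 'a set \<Rightarrow> bool" where
  "syndetic_in Y V \<longleftrightarrow> (\<exists>T. finite T \<and> T \<subseteq> Y \<and> (\<forall>y\<in>Y. \<exists>t\<in>T. y - t \<in> V))"

text \<open>A maximal list whose later entries are not in \<open>V\<close> relative to its earlier ones serves as the finite
set of translations. The order of the list matters because \<open>V\<close> may lack symmetry.\<close>
lemma syndetic_if_no_separated_list:
  assumes "\<And>ts. length ts = r \<Longrightarrow> set ts \<subseteq> Y \<Longrightarrow> \<exists>i l. i < l \<and> l < r \<and> ts ! l - ts ! i \<in> V"
  shows "syndetic_in Y V"
proof (rule ccontr)
  assume not: "\<not> syndetic_in Y V"
  have "\<exists>ts. length ts = m \<and> set ts \<subseteq> Y \<and> (\<forall>i l. i < l \<longrightarrow> l < m \<longrightarrow> ts ! l - ts ! i \<notin> V)" for m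
  proof (induction m)
    case 0
    then show ?case by simp
  next
    case (Suc m)
    then obtain ts where "length ts = m \<and> set ts \<subseteq> Y \<and>
      (\<forall>i l. i < l \<longrightarrow> l < m \<longrightarrow> ts ! l - ts ! i \<notin> V)" ..
    then have ts: "length ts = m" "set ts \<subseteq> Y"
      "\<forall>i l. i < l \<longrightarrow> l < m \<longrightarrow> ts ! l - ts ! i \<notin> V" by simp_all
    obtain y where y: "y \<in> Y" "\<forall>t\<in>set ts. y - t \<notin> V"
    proof (rule ccontr)
      assume "\<not> thesis"
      then have "\<forall>y\<in>Y. \<exists>t\<in>set ts. y - t \<in> V" using that by auto
      then show False using not ts(2) unfolding syndetic_in_def by (metis finite_set)
    qed
    have "\<forall>i l. i < l \<longrightarrow> l < Suc m \<longrightarrow> (ts @ [y]) ! l - (ts @ [y]) ! i \<notin> V"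
      using ts y(2) by (auto simp: nth_append less_Suc_eq)
    then show ?case using ts y(1) by (intro exI[of _ "ts @ [y]"]) auto
  qed
  from this[of r] show False using assms by blast
qed

context bounded_exponent_group
begin

lemma parseval:
  assumes G: "fin_subgroup G"
  shows "(\<Sum>g\<in>G. (norm (\<Sum>\<phi>\<in>characters G. b \<phi> * \<phi> g))\<^sup>2) = card G * (\<Sum>\<phi>\<in>characters G. (norm (b \<phi>))\<^sup>2)"
proof -
  have "complex_of_real (\<Sum>g\<in>G. (norm (\<Sum>\<phi>\<in>characters G. b \<phi> * \<phi> g))\<^sup>2)
     = (\<Sum>g\<in>G. \<Sum>\<phi>\<in>characters G. \<Sum>\<phi>'\<in>characters G. (b \<phi> * cnj (b \<phi>')) * (\<phi> g * cnj (\<phi>' g)))"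
    by (simp only: of_real_sum complex_norm_square cnj_sum sum_product complex_cnj_mult mult_ac)
  also have "\<dots> = (\<Sum>\<phi>\<in>characters G. \<Sum>\<phi>'\<in>characters G. \<Sum>g\<in>G. (b \<phi> * cnj (b \<phi>')) * (\<phi> g * cnj (\<phi>' g)))"
    by (subst sum.swap, rule sum.cong[OF refl], rule sum.swap)
  also have "\<dots> = (\<Sum>\<phi>\<in>characters G. \<Sum>\<phi>'\<in>characters G. if \<phi> = \<phi>' then b \<phi> * cnj (b \<phi>') * of_nat (card G) else 0)"
    by (intro sum.cong refl) (simp add: sum_distrib_left[symmetric] character_orthogonality[OF G])
  also have "\<dots> = (\<Sum>\<phi>\<in>characters G. b \<phi> * cnj (b \<phi>) * of_nat (card G))"
    using finite_characters[OF G] by (simp add: sum.delta)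
  also have "\<dots> = complex_of_real (card G * (\<Sum>\<phi>\<in>characters G. (norm (b \<phi>))\<^sup>2))"
    by (simp only: of_real_mult of_real_sum complex_norm_square of_real_of_nat_eq sum_distrib_left mult_ac)
  finally show ?thesis by (simp only: of_real_eq_iff)
qed

end

text \<open>Nonnegativity of the Fourier coefficients on all finite subgroups is positive definiteness, and
the coefficient of the trivial character is the mean.\<close>
locale positive_definite_function = bounded_exponent_group +
  fixes a :: "'a \<Rightarrow> real" and \<beta> :: real
  assumes even: "finite_subgroup_of Y G \<Longrightarrow> s \<in> G \<Longrightarrow> a (- s) = a s"
    and fourier_nonneg: "finite_subgroup_of Y G \<Longrightarrow> \<psi> \<in> characters G \<Longrightarrow> fourier G a \<psi> \<ge> 0"
    and at_zero: "a 0 \<le> 1"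
    and beta_pos: "\<beta> > 0"
    and mean_ge: "finite_subgroup_of Y G \<Longrightarrow> fourier G a (trivial_char G) \<ge> \<beta>"
begin

text \<open>A character of large coefficient restricts to one of large coefficient (\<open>large_restrict\<close>). Hence
the common kernels of the large characters increase with the finite group, and their union is a
subgroup of \<open>Y\<close>. It plays the part of the common kernel of the large atoms of the spectral measure.\<close>
definition large :: "real \<Rightarrow> 'a set \<Rightarrow> ('a \<Rightarrow> complex) set" where
  "large \<epsilon> G = {\<psi> \<in> characters G. fourier G a \<psi> \<ge> \<epsilon>}"

definition mass :: "real \<Rightarrow> 'a set \<Rightarrow> real" where
  "mass \<epsilon> G = (\<Sum>\<psi>\<in>large \<epsilon> G. fourier G a \<psi>)"

definition kernel_of_large :: "real \<Rightarrow> 'a set \<Rightarrow> 'a set" where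
  "kernel_of_large \<epsilon> G = {s \<in> G. \<forall>\<psi>\<in>large \<epsilon> G. \<psi> s = 1}"

definition spectral_subgroup :: "real \<Rightarrow> 'a set" where
  "spectral_subgroup \<epsilon> = (\<Union>G\<in>Collect fin_subgroup. kernel_of_large \<epsilon> G)"

lemma finite_large: "fin_subgroup G \<Longrightarrow> finite (large \<epsilon> G)"
  using finite_characters by (simp add: large_def)

lemma fourier_total:
  assumes G: "fin_subgroup G"
  shows "(\<Sum>\<psi>\<in>characters G. fourier G a \<psi>) \<le> 1"
proof -
  have "complex_of_real (a 0) = (\<Sum>\<psi>\<in>characters G. of_real (fourier G a \<psi>) * \<psi> 0)"
    using fourier_inversion[of G a 0, OF G even[OF G]] finite_subgroup_ofD(2)[OF G] add_subgroup_zero by blast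
  also have "\<dots> = of_real (\<Sum>\<psi>\<in>characters G. fourier G a \<psi>)"
    by (simp add: characters_zero cong: sum.cong)
  finally show ?thesis using at_zero by (simp only: of_real_eq_iff)
qed

lemma fourier_sum_fibre:
  assumes "fin_subgroup G" "fin_subgroup G'" "G \<subseteq> G'" "\<phi> \<in> characters G"
  shows "fourier G a \<phi> = (\<Sum>\<psi> | \<psi> \<in> characters G' \<and> restrict_char G \<psi> = \<phi>. fourier G' a \<psi>)"
  using fourier_restrict[of G G' a \<phi>, OF assms(1-3) even[OF assms(2)] assms(4)] .

lemma fourier_le_restrict:
  assumes G: "fin_subgroup G" and G': "fin_subgroup G'" and sub: "G \<subseteq> G'" and \<psi>: "\<psi> \<in> characters G'"
  shows "fourier G' a \<psi> \<le> fourier G a (restrict_char G \<psi>)"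
proof -
  have "fourier G' a \<psi> \<le> (\<Sum>\<eta> | \<eta> \<in> characters G' \<and> restrict_char G \<eta> = restrict_char G \<psi>. fourier G' a \<eta>)"
    using \<psi> fourier_nonneg[OF G'] finite_characters[OF G']
    by (intro member_le_sum) auto
  then show ?thesis
    using fourier_sum_fibre[OF G G' sub restrict_char_mem[OF finite_subgroup_ofD(2)[OF G] sub \<psi>]] by simp
qed

lemma large_restrict:
  assumes "fin_subgroup G" "fin_subgroup G'" "G \<subseteq> G'" "\<psi> \<in> large \<epsilon> G'"
  shows "restrict_char G \<psi> \<in> large \<epsilon> G"
  using assms fourier_le_restrict[OF assms(1-3)] restrict_char_mem[OF finite_subgroup_ofD(2)]
  by (fastforce simp: large_def)

lemma mass_lift:
  assumes G: "fin_subgroup G" and G': "fin_subgroup G'" and sub: "G \<subseteq> G'"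
  shows "mass \<epsilon> G = (\<Sum>\<psi> | \<psi> \<in> characters G' \<and> restrict_char G \<psi> \<in> large \<epsilon> G. fourier G' a \<psi>)"
proof -
  have "mass \<epsilon> G = (\<Sum>\<phi>\<in>large \<epsilon> G. \<Sum>\<psi> | \<psi> \<in> {\<psi> \<in> characters G'. restrict_char G \<psi> \<in> large \<epsilon> G} \<and> restrict_char G \<psi> = \<phi>. fourier G' a \<psi>)"
    unfolding mass_def
  proof (rule sum.cong)
    fix \<phi> assume "\<phi> \<in> large \<epsilon> G"
    then show "fourier G a \<phi> = (\<Sum>\<psi> | \<psi> \<in> {\<psi> \<in> characters G'. restrict_char G \<psi> \<in> large \<epsilon> G} \<and> restrict_char G \<psi> = \<phi>. fourier G' a \<psi>)"
      by (subst fourier_sum_fibre[OF G G' sub]) (auto simp: large_def intro: sum.cong)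
  qed simp
  also have "\<dots> = (\<Sum>\<psi> | \<psi> \<in> characters G' \<and> restrict_char G \<psi> \<in> large \<epsilon> G. fourier G' a \<psi>)"
    using finite_characters[OF G'] finite_large[OF G] by (intro sum.group) auto
  finally show ?thesis .
qed

text \<open>The mass of the large part can only drop when the group grows, because large coefficients may split
into small ones. Its limit is the mass of the large atoms of the spectral measure.\<close>
lemma mass_antimono:
  assumes G: "fin_subgroup G" and G': "fin_subgroup G'" and sub: "G \<subseteq> G'"
  shows "mass \<epsilon> G' \<le> mass \<epsilon> G"
  unfolding mass_lift[OF assms] unfolding mass_def
  using large_restrict[OF assms] fourier_nonneg[OF G'] finite_characters[OF G']
  by (intro sum_mono2) (auto simp: large_def)

lemma mass_bounds:
  assumes "fin_subgroup G"
  shows "0 \<le> mass \<epsilon> G" "mass \<epsilon> G \<le> 1"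
proof -
  show "0 \<le> mass \<epsilon> G" unfolding mass_def large_def by (intro sum_nonneg) (use fourier_nonneg[OF assms] in auto)
  have "mass \<epsilon> G \<le> (\<Sum>\<psi>\<in>characters G. fourier G a \<psi>)"
    unfolding mass_def large_def
    by (intro sum_mono2) (use fourier_nonneg[OF assms] finite_characters[OF assms] in auto)
  then show "mass \<epsilon> G \<le> 1" using fourier_total[OF assms] by simp
qed

lemma mass_mono_eps:
  assumes "fin_subgroup G" "\<epsilon>' \<le> \<epsilon>"
  shows "mass \<epsilon> G \<le> mass \<epsilon>' G"
  unfolding mass_def large_def
  by (intro sum_mono2) (use fourier_nonneg[OF assms(1)] finite_characters[OF assms(1)] assms(2) in auto)

lemma card_large:
  assumes "fin_subgroup G" "\<epsilon> > 0"
  shows "card (large \<epsilon> G) \<le> nat \<lfloor>1 / \<epsilon>\<rfloor>"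
proof -
  have "card (large \<epsilon> G) * \<epsilon> = (\<Sum>\<psi>\<in>large \<epsilon> G. \<epsilon>)" by simp
  also have "\<dots> \<le> mass \<epsilon> G" unfolding mass_def by (rule sum_mono) (simp add: large_def)
  finally have "card (large \<epsilon> G) \<le> 1 / \<epsilon>"
    using mass_bounds(2)[OF assms(1), of \<epsilon>] assms(2) by (simp add: field_simps)
  then show ?thesis by (simp add: le_nat_floor)
qed

lemma kernel_of_large_mono:
  assumes G: "fin_subgroup G" and G': "fin_subgroup G'" and sub: "G \<subseteq> G'"
  shows "kernel_of_large \<epsilon> G \<subseteq> kernel_of_large \<epsilon> G'"
proof
  fix s assume s: "s \<in> kernel_of_large \<epsilon> G"
  have "\<psi> s = 1" if "\<psi> \<in> large \<epsilon> G'" for \<psi>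
  proof -
    have "restrict_char G \<psi> s = 1"
      using s large_restrict[OF assms that] by (auto simp: kernel_of_large_def)
    then show ?thesis using s by (auto simp: kernel_of_large_def restrict_char_def)
  qed
  then show "s \<in> kernel_of_large \<epsilon> G'" using s sub by (auto simp: kernel_of_large_def)
qed

lemma kernel_of_large_diff:
  assumes G: "fin_subgroup G" and "s \<in> G" "t \<in> G" and eq: "\<And>\<psi>. \<psi> \<in> large \<epsilon> G \<Longrightarrow> \<psi> s = \<psi> t"
  shows "s - t \<in> kernel_of_large \<epsilon> G"
proof -
  note sg = finite_subgroup_ofD(2)[OF G]
  have "\<psi> (s - t) = 1" if \<psi>: "\<psi> \<in> large \<epsilon> G" for \<psi>
  proof -
    have \<psi>G: "\<psi> \<in> characters G" using \<psi> by (simp add: large_def)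
    have "\<psi> (s + - t) = \<psi> s * cnj (\<psi> t)"
      using characters_add[OF \<psi>G assms(2) add_subgroup_minus[OF sg assms(3)]]
        cnj_character[OF G \<psi>G assms(3)] by simp
    then show ?thesis using eq[OF \<psi>] norm_character[OF G \<psi>G assms(3)]
      by (simp add: complex_norm_square[symmetric])
  qed
  then show ?thesis using add_subgroup_diff[OF sg assms(2,3)] by (auto simp: kernel_of_large_def)
qed

lemma spectral_subgroup_finite_part:
  assumes "finite S" "S \<subseteq> spectral_subgroup \<epsilon>" "fin_subgroup G" "x \<in> Y"
  obtains G' where "fin_subgroup G'" "G \<subseteq> G'" "x \<in> G'" "S \<subseteq> kernel_of_large \<epsilon> G'"
proof -
  have "\<forall>s\<in>S. \<exists>K. fin_subgroup K \<and> s \<in> kernel_of_large \<epsilon> K"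
    using assms(2) by (auto simp: spectral_subgroup_def)
  then obtain K where K: "\<And>s. s \<in> S \<Longrightarrow> fin_subgroup (K s) \<and> s \<in> kernel_of_large \<epsilon> (K s)"
    by metis
  have "finite (insert x (\<Union>s\<in>S. K s))" "insert x (\<Union>s\<in>S. K s) \<subseteq> Y"
    using assms(1,4) K by (auto simp: finite_subgroup_of_def)
  then obtain G' where G': "fin_subgroup G'" "G \<subseteq> G'" "insert x (\<Union>s\<in>S. K s) \<subseteq> G'"
    using extend[OF assms(3)] by blast
  have "S \<subseteq> kernel_of_large \<epsilon> G'"
    using K kernel_of_large_mono[of "K _" G' \<epsilon>] G' by blast
  then show ?thesis using that G' by blast
qed

lemma spectral_subgroup_subset: "spectral_subgroup \<epsilon> \<subseteq> Y"
  by (auto simp: spectral_subgroup_def kernel_of_large_def finite_subgroup_of_def)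

lemma add_subgroup_spectral: "add_subgroup (spectral_subgroup \<epsilon>)"
  unfolding add_subgroup_def
proof (intro conjI ballI)
  have "0 - 0 \<in> kernel_of_large \<epsilon> {0}" using kernel_of_large_diff[OF trivial_fin_subgroup] by blast
  then show "0 \<in> spectral_subgroup \<epsilon>" using trivial_fin_subgroup by (auto simp: spectral_subgroup_def)
  fix x y assume xy: "x \<in> spectral_subgroup \<epsilon>" "y \<in> spectral_subgroup \<epsilon>"
  have "finite {x, y}" "{x, y} \<subseteq> spectral_subgroup \<epsilon>" using xy by auto
  then obtain G where G: "fin_subgroup G" "{x, y} \<subseteq> kernel_of_large \<epsilon> G"
    using spectral_subgroup_finite_part[OF _ _ trivial_fin_subgroup add_subgroup_zero[OF subgroup], of "{x, y}" \<epsilon>]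
    by metis
  then have "x - y \<in> kernel_of_large \<epsilon> G"
    by (intro kernel_of_large_diff) (auto simp: kernel_of_large_def)
  then show "x - y \<in> spectral_subgroup \<epsilon>" using G(1) by (auto simp: spectral_subgroup_def)
qed

text \<open>There are at most \<open>1 / \<epsilon>\<close> large characters, each with at most \<open>n\<close> values, so among \<open>n ^ k + 1\<close> elements
two have the same values under all of them.\<close>
lemma syndetic_spectral:
  assumes "\<epsilon> > 0"
  shows "syndetic_in Y (spectral_subgroup \<epsilon>)"
proof (rule syndetic_if_no_separated_list)
  define k where "k = nat \<lfloor>1 / \<epsilon>\<rfloor>"
  fix ts :: "'a list" assume ts: "length ts = n ^ k + 1" "set ts \<subseteq> Y"
  obtain G where G: "fin_subgroup G" "set ts \<subseteq> G"
    using extend[OF trivial_fin_subgroup _ ts(2)] by auto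
  define R where "R = {z::complex. z ^ n = 1}"
  define f where "f i = (\<lambda>\<psi>\<in>large \<epsilon> G. \<psi> (ts ! i))" for i
  have R: "finite R" "card R \<le> n"
    using finite_roots_unity[of n, where 'a = complex] card_roots_unity[of n, where 'a = complex] exponent_pos
    unfolding R_def by simp_all
  have tsG: "ts ! i \<in> G" if "i < n ^ k + 1" for i using that ts(1) G(2) by (metis nth_mem subsetD)
  have "f ` {..<n ^ k + 1} \<subseteq> Pi\<^sub>E (large \<epsilon> G) (\<lambda>_. R)"
    using characters_root[OF G(1) _ tsG] by (intro image_subsetI) (simp add: f_def R_def large_def restrict_PiE_iff)
  then have "card (f ` {..<n ^ k + 1}) \<le> card (Pi\<^sub>E (large \<epsilon> G) (\<lambda>_. R))"
    using finite_large[OF G(1)] R(1) by (intro card_mono finite_PiE) auto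
  also have "\<dots> = card R ^ card (large \<epsilon> G)"
    using finite_large[OF G(1)] by (simp add: card_PiE)
  also have "\<dots> \<le> n ^ card (large \<epsilon> G)" using R(2) by (rule power_mono) simp
  also have "\<dots> \<le> n ^ k"
    using card_large[OF G(1) assms] exponent_pos unfolding k_def by (intro power_increasing) auto
  finally have "\<not> inj_on f {..<n ^ k + 1}" by (intro pigeonhole) simp
  then obtain i l where il: "i < n ^ k + 1" "l < n ^ k + 1" "i < l" "f i = f l"
    unfolding inj_on_def by (metis lessThan_iff linorder_neqE_nat)
  have "\<psi> (ts ! l) = \<psi> (ts ! i)" if "\<psi> \<in> large \<epsilon> G" for \<psi>
    using fun_cong[OF il(4), of \<psi>] that by (simp add: f_def)
  then have "ts ! l - ts ! i \<in> kernel_of_large \<epsilon> G"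
    using kernel_of_large_diff[OF G(1) tsG tsG] il by blast
  then show "\<exists>i l. i < l \<and> l < n ^ k + 1 \<and> ts ! l - ts ! i \<in> spectral_subgroup \<epsilon>"
    using il G(1) by (auto simp: spectral_subgroup_def)
qed

text \<open>A quantitative Wiener lemma. On a coset of \<open>G\<close> the small part of the spectrum of \<open>G'\<close> is a
combination of characters of \<open>G\<close> whose coefficients have absolute values that add up to at most 1
and are at most \<open>\<epsilon>\<close> each: over a small character of \<open>G\<close> because the total is small there, and over a large one because
\<open>stable\<close> leaves at most \<open>\<epsilon>\<close> for the pieces that have become small. Parseval's identity gives the
claim, uniformly in the coset.\<close>
lemma small_spectrum_mean_square:
  assumes G: "fin_subgroup G" and G': "fin_subgroup G'" and sub: "G \<subseteq> G'" and x: "x \<in> G'"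
    and \<epsilon>: "\<epsilon> > 0" and stable: "mass \<epsilon> G \<le> mass \<epsilon> G' + \<epsilon>"
  defines "rest \<equiv> \<lambda>s. \<Sum>\<psi>\<in>characters G' - large \<epsilon> G'. of_real (fourier G' a \<psi>) * \<psi> s"
  shows "(\<Sum>g\<in>G. (norm (rest (x + g)))\<^sup>2) \<le> \<epsilon> * card G"
proof -
  let ?R = "characters G' - large \<epsilon> G'"
  note fin' = finite_characters[OF G'] and fin = finite_characters[OF G]
  define F where "F \<phi> = {\<psi> \<in> ?R. restrict_char G \<psi> = \<phi>}" for \<phi>
  define r where "r \<phi> = (\<Sum>\<psi>\<in>F \<phi>. fourier G' a \<psi>)" for \<phi>
  define b where "b \<phi> = (\<Sum>\<psi>\<in>F \<phi>. of_real (fourier G' a \<psi>) * \<psi> x)" for \<phi>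
  have nn: "fourier G' a \<psi> \<ge> 0" if "\<psi> \<in> characters G'" for \<psi> using fourier_nonneg[OF G' that] .
  have rest: "rest (x + g) = (\<Sum>\<phi>\<in>characters G. b \<phi> * \<phi> g)" if g: "g \<in> G" for g
  proof -
    have "rest (x + g) = (\<Sum>\<phi>\<in>characters G. \<Sum>\<psi>\<in>F \<phi>. of_real (fourier G' a \<psi>) * \<psi> (x + g))"
      unfolding rest_def F_def
      by (rule sum.group[symmetric])
        (use fin fin' restrict_char_mem[OF finite_subgroup_ofD(2)[OF G] sub] in auto)
    also have "\<dots> = (\<Sum>\<phi>\<in>characters G. b \<phi> * \<phi> g)"
    proof (rule sum.cong)
      fix \<phi> assume "\<phi> \<in> characters G"
      have "of_real (fourier G' a \<psi>) * \<psi> (x + g) = of_real (fourier G' a \<psi>) * \<psi> x * \<phi> g"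
        if "\<psi> \<in> F \<phi>" for \<psi>
      proof -
        have "\<psi> (x + g) = \<psi> x * \<psi> g" using that x g sub characters_add[of \<psi> G'] by (auto simp: F_def)
        moreover have "\<psi> g = \<phi> g" using that g by (auto simp: F_def restrict_char_def)
        ultimately show ?thesis by simp
      qed
      then show "(\<Sum>\<psi>\<in>F \<phi>. of_real (fourier G' a \<psi>) * \<psi> (x + g)) = b \<phi> * \<phi> g"
        unfolding b_def sum_distrib_right by (rule sum.cong[OF refl])
    qed simp
    finally show ?thesis .
  qed
  have b_le: "norm (b \<phi>) \<le> r \<phi>" for \<phi>
    unfolding b_def r_def
  proof (rule order_trans[OF norm_sum], rule sum_mono)
    fix \<psi> assume "\<psi> \<in> F \<phi>"
    then have "\<psi> \<in> characters G'" by (simp add: F_def)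
    then show "norm (of_real (fourier G' a \<psi>) * \<psi> x) \<le> fourier G' a \<psi>"
      using nn norm_character_le[OF G'] by (simp add: norm_mult mult_left_le)
  qed
  have r_nonneg: "r \<phi> \<ge> 0" for \<phi> unfolding r_def by (rule sum_nonneg) (use nn in \<open>auto simp: F_def\<close>)
  have r_le: "r \<phi> \<le> \<epsilon>" if \<phi>: "\<phi> \<in> characters G" for \<phi>
  proof (cases "\<phi> \<in> large \<epsilon> G")
    case False
    have "r \<phi> \<le> (\<Sum>\<psi> | \<psi> \<in> characters G' \<and> restrict_char G \<psi> = \<phi>. fourier G' a \<psi>)"
      unfolding r_def F_def by (intro sum_mono2) (use nn fin' in auto)
    also have "\<dots> = fourier G a \<phi>" using fourier_sum_fibre[OF G G' sub \<phi>] by simp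
    also have "\<dots> < \<epsilon>" using False \<phi> by (simp add: large_def)
    finally show ?thesis by simp
  next
    case True
    let ?L = "{\<psi> \<in> characters G'. restrict_char G \<psi> \<in> large \<epsilon> G}"
    have LL: "large \<epsilon> G' \<subseteq> ?L" using large_restrict[OF G G' sub] by (auto simp: large_def)
    have "r \<phi> \<le> (\<Sum>\<psi>\<in>?L - large \<epsilon> G'. fourier G' a \<psi>)"
      unfolding r_def F_def by (intro sum_mono2) (use nn fin' True in auto)
    also have "\<dots> = mass \<epsilon> G - mass \<epsilon> G'"
      using mass_lift[OF G G' sub, of \<epsilon>] LL fin' finite_subset[OF LL]
      by (subst sum_diff) (auto simp: mass_def)
    finally show ?thesis using stable by simp
  qed
  have r_total: "(\<Sum>\<phi>\<in>characters G. r \<phi>) \<le> 1"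
  proof -
    have "(\<Sum>\<phi>\<in>characters G. r \<phi>) = (\<Sum>\<psi>\<in>?R. fourier G' a \<psi>)"
      unfolding r_def F_def
      by (rule sum.group)
        (use fin fin' restrict_char_mem[OF finite_subgroup_ofD(2)[OF G] sub] in auto)
    also have "\<dots> \<le> (\<Sum>\<psi>\<in>characters G'. fourier G' a \<psi>)"
      by (intro sum_mono2) (use nn fin' in auto)
    finally show ?thesis using fourier_total[OF G'] by simp
  qed
  have "(\<Sum>\<phi>\<in>characters G. (norm (b \<phi>))\<^sup>2) \<le> (\<Sum>\<phi>\<in>characters G. \<epsilon> * r \<phi>)"
  proof (rule sum_mono)
    fix \<phi> assume \<phi>: "\<phi> \<in> characters G"
    have "(norm (b \<phi>))\<^sup>2 \<le> r \<phi> * r \<phi>"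
      unfolding power2_eq_square using b_le r_nonneg by (intro mult_mono) auto
    also have "\<dots> \<le> \<epsilon> * r \<phi>" using r_le[OF \<phi>] r_nonneg by (intro mult_right_mono)
    finally show "(norm (b \<phi>))\<^sup>2 \<le> \<epsilon> * r \<phi>" .
  qed
  also have "\<dots> \<le> \<epsilon>" using r_total \<epsilon> by (simp add: sum_distrib_left[symmetric])
  finally have b_sum: "(\<Sum>\<phi>\<in>characters G. (norm (b \<phi>))\<^sup>2) \<le> \<epsilon>" .
  have "(\<Sum>g\<in>G. (norm (rest (x + g)))\<^sup>2) = (\<Sum>g\<in>G. (norm (\<Sum>\<phi>\<in>characters G. b \<phi> * \<phi> g))\<^sup>2)"
    by (rule sum.cong) (simp_all add: rest)
  also have "\<dots> = card G * (\<Sum>\<phi>\<in>characters G. (norm (b \<phi>))\<^sup>2)" by (rule parseval[OF G])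
  also have "\<dots> \<le> card G * \<epsilon>" using b_sum by (intro mult_left_mono) auto
  finally show ?thesis by (simp only: mult.commute)
qed

text \<open>On the kernel the characters above \<open>\<epsilon>\<close> add up to their full mass, which is at least \<open>\<beta>\<close>; those
between \<open>\<epsilon>'\<close> and \<open>\<epsilon>\<close> take away at most \<open>\<beta> / 2\<close>, by \<open>gap\<close>.\<close>
lemma lower_bound_on_kernel:
  assumes G: "fin_subgroup G" and \<epsilon>: "\<epsilon>' \<le> \<epsilon>" "\<epsilon> \<le> \<beta>" and s: "s \<in> kernel_of_large \<epsilon> G"
    and gap: "mass \<epsilon>' G - mass \<epsilon> G \<le> \<beta> / 2"
  shows "\<beta> / 2 - norm (\<Sum>\<psi>\<in>characters G - large \<epsilon>' G. of_real (fourier G a \<psi>) * \<psi> s) \<le> a s"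
proof -
  note fin = finite_characters[OF G]
  let ?t = "\<lambda>\<psi>. complex_of_real (fourier G a \<psi>) * \<psi> s"
  let ?rest = "\<Sum>\<psi>\<in>characters G - large \<epsilon>' G. ?t \<psi>"
  let ?mid = "\<Sum>\<psi>\<in>large \<epsilon>' G - large \<epsilon> G. ?t \<psi>"
  have sub: "large \<epsilon> G \<subseteq> large \<epsilon>' G" "large \<epsilon>' G \<subseteq> characters G"
    using \<epsilon> by (auto simp: large_def)
  have sG: "s \<in> G" using s by (simp add: kernel_of_large_def)
  have nn: "fourier G a \<psi> \<ge> 0" if "\<psi> \<in> characters G" for \<psi> using fourier_nonneg[OF G that] .
  have "complex_of_real (a s) = (\<Sum>\<psi>\<in>characters G. ?t \<psi>)"
    by (rule fourier_inversion[of G a s, OF G even[OF G] sG])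
  also have "\<dots> = ?rest + (\<Sum>\<psi>\<in>large \<epsilon>' G. ?t \<psi>)"
    by (rule sum.subset_diff) (use sub fin in auto)
  also have "(\<Sum>\<psi>\<in>large \<epsilon>' G. ?t \<psi>) = ?mid + (\<Sum>\<psi>\<in>large \<epsilon> G. ?t \<psi>)"
    by (rule sum.subset_diff) (use sub finite_large[OF G] in auto)
  also have "(\<Sum>\<psi>\<in>large \<epsilon> G. ?t \<psi>) = of_real (mass \<epsilon> G)"
    unfolding mass_def of_real_sum using s by (intro sum.cong) (auto simp: kernel_of_large_def)
  finally have "a s = Re (?rest + (?mid + of_real (mass \<epsilon> G)))" by (metis Re_complex_of_real)
  then have "a s = Re ?rest + Re ?mid + mass \<epsilon> G" by simp
  moreover have "\<bar>Re ?rest\<bar> \<le> norm ?rest" "\<bar>Re ?mid\<bar> \<le> norm ?mid" by (rule abs_Re_le_cmod)+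
  moreover have "norm ?mid \<le> (\<Sum>\<psi>\<in>large \<epsilon>' G - large \<epsilon> G. fourier G a \<psi>)"
  proof (rule order_trans[OF norm_sum], rule sum_mono)
    fix \<psi> assume "\<psi> \<in> large \<epsilon>' G - large \<epsilon> G"
    then have "\<psi> \<in> characters G" using sub by auto
    then show "norm (?t \<psi>) \<le> fourier G a \<psi>"
      using nn norm_character_le[OF G] by (simp add: norm_mult mult_left_le)
  qed
  moreover have "(\<Sum>\<psi>\<in>large \<epsilon>' G - large \<epsilon> G. fourier G a \<psi>) = mass \<epsilon>' G - mass \<epsilon> G"
    unfolding mass_def by (rule sum_diff) (use sub finite_large[OF G] in auto)
  moreover have "mass \<epsilon> G \<ge> \<beta>"
  proof -
    have tr: "trivial_char G \<in> large \<epsilon> G"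
      using trivial_char_mem finite_subgroup_ofD(2)[OF G] mean_ge[OF G] \<epsilon>(2) by (fastforce simp: large_def)
    then have "fourier G a (trivial_char G) \<le> mass \<epsilon> G"
      unfolding mass_def using finite_large[OF G] nn sub by (intro member_le_sum) auto
    then show ?thesis using mean_ge[OF G] by simp
  qed
  ultimately show ?thesis using gap by linarith
qed

text \<open>Choose \<open>\<epsilon>\<close> so small that hardly any atomic mass is left below it. For a given \<open>\<delta>\<close>, a much smaller
threshold \<open>\<epsilon>'\<close> and a finite group on which the mass above \<open>\<epsilon>'\<close> has almost reached its limit make
the two preceding lemmas applicable: at a zero of \<open>a\<close> in the subgroup, the part of the
spectrum below \<open>\<epsilon>'\<close> has absolute value at least \<open>\<beta> / 2\<close>, which is rare in mean square.
The subgroup depends on \<open>\<epsilon>\<close> only, not on \<open>\<delta>\<close>.\<close>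
theorem zeros_null_on_finite_index_subgroup:
  "\<exists>H. add_subgroup H \<and> H \<subseteq> Y \<and> syndetic_in Y H \<and>
    (\<forall>\<delta>::real>0. \<exists>G. fin_subgroup G \<and> (\<forall>x\<in>Y. card {s \<in> (+) x ` G. s \<in> H \<and> a s = 0} \<le> \<delta> * real (card G)))"
proof -
  \<comment> \<open>\<open>A \<epsilon>\<close> is the mass of the atoms of size at least \<open>\<epsilon>\<close>, and \<open>S\<close> the total atomic mass.\<close>
  define A where "A \<epsilon> = (INF G\<in>Collect fin_subgroup. mass \<epsilon> G)" for \<epsilon>
  have ne: "Collect fin_subgroup \<noteq> {}" using trivial_fin_subgroup by blast
  have bdd: "bdd_below (mass \<epsilon> ` Collect fin_subgroup)" for \<epsilon>
    using mass_bounds(1) by (intro bdd_belowI2[of _ 0]) auto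
  have A_le: "A \<epsilon> \<le> mass \<epsilon> G" if "fin_subgroup G" for \<epsilon> G
    unfolding A_def using bdd that by (intro cINF_lower) auto
  have A_le1: "A \<epsilon> \<le> 1" for \<epsilon>
    using A_le[OF trivial_fin_subgroup] mass_bounds(2)[OF trivial_fin_subgroup] by (rule order_trans)
  define S where "S = (SUP \<epsilon>\<in>{0<..}. A \<epsilon>)"
  have bddS: "bdd_above (A ` {0<..})" using A_le1 by (intro bdd_aboveI2[of _ _ 1]) auto
  have A_S: "A \<epsilon> \<le> S" if "\<epsilon> > 0" for \<epsilon> unfolding S_def using bddS that by (intro cSUP_upper) auto
  have "S - \<beta> / 4 < (SUP \<epsilon>\<in>{0<..}. A \<epsilon>)" using beta_pos S_def by simp
  then obtain \<epsilon>0 where \<epsilon>0: "\<epsilon>0 > 0" "S - \<beta> / 4 < A \<epsilon>0"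
    using less_cSUP_iff[OF _ bddS] by auto
  define \<epsilon> where "\<epsilon> = min \<epsilon>0 \<beta>"
  have \<epsilon>: "\<epsilon> > 0" "\<epsilon> \<le> \<beta>" "\<epsilon> \<le> \<epsilon>0" using \<epsilon>0 beta_pos by (auto simp: \<epsilon>_def)
  have A\<epsilon>: "S - \<beta> / 4 < mass \<epsilon> G" if "fin_subgroup G" for G
    using \<epsilon>0(2) A_le[OF that, of \<epsilon>0] mass_mono_eps[OF that \<epsilon>(3)] by linarith
  have "\<exists>G. fin_subgroup G \<and> (\<forall>x\<in>Y. card {s \<in> (+) x ` G. s \<in> spectral_subgroup \<epsilon> \<and> a s = 0} \<le> \<delta> * real (card G))"
    if \<delta>: "\<delta> > 0" for \<delta> :: real
  proof -
    define \<epsilon>' where "\<epsilon>' = min \<epsilon> (min (\<delta> * (\<beta> / 2)\<^sup>2) (\<beta> / 4))"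
    have \<epsilon>': "\<epsilon>' > 0" "\<epsilon>' \<le> \<epsilon>" "\<epsilon>' \<le> \<delta> * (\<beta> / 2)\<^sup>2" "\<epsilon>' \<le> \<beta> / 4"
      using \<epsilon> \<delta> beta_pos by (auto simp: \<epsilon>'_def)
    have "A \<epsilon>' < A \<epsilon>' + \<epsilon>'" using \<epsilon>' by simp
    then obtain G where G: "fin_subgroup G" "mass \<epsilon>' G < A \<epsilon>' + \<epsilon>'"
      using cINF_less_iff[OF ne bdd, of \<epsilon>' "A \<epsilon>' + \<epsilon>'"] unfolding A_def[symmetric] by auto
    have "card {s \<in> (+) x ` G. s \<in> spectral_subgroup \<epsilon> \<and> a s = 0} \<le> \<delta> * real (card G)" if x: "x \<in> Y" for x
    proof -
      let ?B = "{s \<in> (+) x ` G. s \<in> spectral_subgroup \<epsilon> \<and> a s = 0}"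
      have finB: "finite ?B" using finite_subgroup_ofD(1)[OF G(1)] by auto
      \<comment> \<open>\<open>G'\<close> depends on \<open>x\<close>, but the bounds obtained from it do not.\<close>
      obtain G' where G': "fin_subgroup G'" "G \<subseteq> G'" "x \<in> G'" "?B \<subseteq> kernel_of_large \<epsilon> G'"
        using spectral_subgroup_finite_part[of ?B \<epsilon> G x] finB G(1) x by blast
      define rest where "rest s = (\<Sum>\<psi>\<in>characters G' - large \<epsilon>' G'. of_real (fourier G' a \<psi>) * \<psi> s)" for s
      have "mass \<epsilon>' G \<le> mass \<epsilon>' G' + \<epsilon>'" using G(2) A_le[OF G'(1), of \<epsilon>'] by linarith
      then have sq: "(\<Sum>g\<in>G. (norm (rest (x + g)))\<^sup>2) \<le> \<epsilon>' * card G"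
        unfolding rest_def by (intro small_spectrum_mean_square G(1) G' \<epsilon>')
      have gap: "mass \<epsilon>' G' - mass \<epsilon> G' \<le> \<beta> / 2"
        using mass_antimono[OF G(1) G'(1,2), of \<epsilon>'] G(2) A_S[OF \<epsilon>'(1)] A\<epsilon>[OF G'(1)] \<epsilon>'(4) by linarith
      have "(\<beta> / 2)\<^sup>2 \<le> (norm (rest s))\<^sup>2" if "s \<in> ?B" for s
      proof -
        have "\<beta> / 2 - norm (rest s) \<le> a s"
          unfolding rest_def by (rule lower_bound_on_kernel[OF G'(1) \<epsilon>'(2) \<epsilon>(2) _ gap]) (use that G'(4) in blast)
        then show ?thesis using that beta_pos by (intro power_mono) auto
      qed
      then have "card ?B * (\<beta> / 2)\<^sup>2 \<le> (\<Sum>s\<in>?B. (norm (rest s))\<^sup>2)"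
        using sum_bounded_below[of ?B "(\<beta> / 2)\<^sup>2"] by simp
      also have "\<dots> \<le> (\<Sum>s\<in>(+) x ` G. (norm (rest s))\<^sup>2)"
        using finite_subgroup_ofD(1)[OF G(1)] by (intro sum_mono2) auto
      also have "\<dots> = (\<Sum>g\<in>G. (norm (rest (x + g)))\<^sup>2)" by (subst sum.reindex) auto
      also have "\<dots> \<le> \<delta> * (\<beta> / 2)\<^sup>2 * card G"
        using sq mult_right_mono[OF \<epsilon>'(3), of "real (card G)"] by simp
      finally have "card ?B * (\<beta> / 2)\<^sup>2 \<le> (\<delta> * card G) * (\<beta> / 2)\<^sup>2" by (simp add: mult_ac)
      then show ?thesis using beta_pos by (simp only: mult_le_cancel_right) auto
    qed
    then show ?thesis using G(1) by blast
  qed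
  then show ?thesis
    using add_subgroup_spectral spectral_subgroup_subset syndetic_spectral[OF \<epsilon>(1)] by blast
qed

end

section \<open>Autocorrelation and difference sets\<close>
context bounded_exponent_group
begin

definition positive_definite_on :: "real \<Rightarrow> 'a set \<Rightarrow> ('a \<Rightarrow> real) \<Rightarrow> bool" where
  "positive_definite_on \<beta> G a \<longleftrightarrow> (\<forall>s\<in>G. a (- s) = a s) \<and>
     (\<forall>\<psi>\<in>characters G. 0 \<le> fourier G a \<psi>) \<and> \<beta> \<le> fourier G a (trivial_char G)"

lemma positive_definite_on_subset:
  assumes G: "fin_subgroup G" and G': "fin_subgroup G'" and sub: "G \<subseteq> G'"
    and pd: "positive_definite_on \<beta> G' a"
  shows "positive_definite_on \<beta> G a"
proof -
  have even: "a (- s) = a s" if "s \<in> G'" for s using pd that by (simp add: positive_definite_on_def)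
  have nn: "0 \<le> fourier G' a \<psi>" if "\<psi> \<in> characters G'" for \<psi>
    using pd that by (simp add: positive_definite_on_def)
  have fibre: "fourier G a \<phi> = (\<Sum>\<psi> | \<psi> \<in> characters G' \<and> restrict_char G \<psi> = \<phi>. fourier G' a \<psi>)"
    if "\<phi> \<in> characters G" for \<phi>
    using fourier_restrict[of G G' a, OF G G' sub _ that] even by blast
  have "0 \<le> fourier G a \<phi>" if "\<phi> \<in> characters G" for \<phi>
    unfolding fibre[OF that] by (intro sum_nonneg) (use nn in auto)
  moreover have "\<beta> \<le> fourier G a (trivial_char G)"
  proof -
    have tr: "trivial_char G' \<in> characters G'" "trivial_char G \<in> characters G"
      using trivial_char_mem finite_subgroup_ofD(2) G G' by blast+
    have "restrict_char G (trivial_char G') = trivial_char G"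
      unfolding restrict_char_def trivial_char_def using sub by (intro ext) auto
    then have "fourier G' a (trivial_char G') \<le> fourier G a (trivial_char G)"
      unfolding fibre[OF tr(2)]
      by (intro member_le_sum) (use tr nn finite_characters[OF G'] in auto)
    then show ?thesis using pd by (simp add: positive_definite_on_def)
  qed
  ultimately show ?thesis using even sub by (auto simp: positive_definite_on_def)
qed

definition autocorrelation :: "'a set \<Rightarrow> 'a set \<Rightarrow> 'a \<Rightarrow> real" where
  "autocorrelation X G s = (if s \<in> G then card {x \<in> G. x \<in> X \<and> x - s \<in> X} / card G else 0)"

text \<open>Up to normalisation the autocorrelation of a set is the convolution of its indicator with the
reflected indicator.\<close>
lemma fourier_autocorrelation:
  assumes G: "fin_subgroup G" and \<psi>: "\<psi> \<in> characters G"
  shows "fourier G (autocorrelation X G) \<psi> = (norm (\<Sum>x\<in>G \<inter> X. \<psi> x) / card G)\<^sup>2"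
proof -
  note fin = finite_subgroup_ofD(1)[OF G] and sg = finite_subgroup_ofD(2)[OF G]
  define f where "f x = (if x \<in> X then \<psi> x else 0)" for x
  let ?S = "\<Sum>x\<in>G \<inter> X. \<psi> x"
  let ?c = "\<lambda>s. card {x \<in> G. x \<in> X \<and> x - s \<in> X}"
  have S: "?S = (\<Sum>x\<in>G. f x)" unfolding f_def using fin by (simp add: sum.inter_restrict)
  have "complex_of_real ((norm ?S)\<^sup>2) = (\<Sum>x\<in>G. \<Sum>y\<in>G. f x * cnj (f y))"
    by (simp only: complex_norm_square S cnj_sum sum_product)
  also have "\<dots> = (\<Sum>x\<in>G. \<Sum>s\<in>G. f x * cnj (f (x - s)))"
  proof (rule sum.cong[OF refl])
    fix x assume "x \<in> G"
    then show "(\<Sum>y\<in>G. f x * cnj (f y)) = (\<Sum>s\<in>G. f x * cnj (f (x - s)))"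
      by (intro sum.reindex_bij_witness[of _ "\<lambda>s. x - s" "\<lambda>y. x - y"])
        (use add_subgroup_diff[OF sg] in auto)
  qed
  also have "\<dots> = (\<Sum>x\<in>G. \<Sum>s\<in>G. if x \<in> X \<and> x - s \<in> X then \<psi> s else 0)"
  proof (intro sum.cong refl)
    fix x s assume x: "x \<in> G" and s: "s \<in> G"
    have "\<psi> x * cnj (\<psi> (x - s)) = \<psi> s"
      using cnj_character[OF G \<psi> add_subgroup_diff[OF sg x s]]
        characters_add[OF \<psi> x add_subgroup_diff[OF sg s x]] by simp
    then show "f x * cnj (f (x - s)) = (if x \<in> X \<and> x - s \<in> X then \<psi> s else 0)"
      by (simp add: f_def)
  qed
  also have "\<dots> = (\<Sum>s\<in>G. \<Sum>x\<in>G. if x \<in> X \<and> x - s \<in> X then \<psi> s else 0)" by (rule sum.swap)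
  also have "\<dots> = (\<Sum>s\<in>G. of_nat (?c s) * \<psi> s)"
    using fin by (simp add: sum.inter_filter[symmetric])
  finally have "Re (complex_of_real ((norm ?S)\<^sup>2)) = Re (\<Sum>s\<in>G. of_nat (?c s) * \<psi> s)" by simp
  then have "(norm ?S)\<^sup>2 = (\<Sum>s\<in>G. ?c s * Re (\<psi> s))" by simp
  then have "(norm ?S)\<^sup>2 / (card G * card G) = (\<Sum>s\<in>G. ?c s * Re (\<psi> s)) / (card G * card G)" by (simp only:)
  also have "\<dots> = fourier G (autocorrelation X G) \<psi>"
    unfolding fourier_def autocorrelation_def by (simp add: sum_divide_distrib cong: sum.cong)
  finally show ?thesis by (simp add: power_divide power2_eq_square)
qed

lemma autocorrelation_positive_definite:
  assumes G: "fin_subgroup G" and E: "E \<subseteq> G" and cover: "\<And>y. y \<in> Y \<Longrightarrow> \<exists>e\<in>E. y - e \<in> X"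
  shows "positive_definite_on ((1 / card E)\<^sup>2) G (autocorrelation X G)"
proof -
  note fin = finite_subgroup_ofD(1)[OF G] and sg = finite_subgroup_ofD(2)[OF G]
  have finE: "finite E" using E fin finite_subset by blast
  have "autocorrelation X G (- s) = autocorrelation X G s" if s: "s \<in> G" for s
  proof -
    have "bij_betw (\<lambda>x. x - s) {x \<in> G. x \<in> X \<and> x - s \<in> X} {x \<in> G. x \<in> X \<and> x - (- s) \<in> X}"
      by (rule bij_betwI[of _ _ _ "\<lambda>x. x + s"])
        (use s add_subgroup_add[OF sg] add_subgroup_diff[OF sg] in auto)
    then show ?thesis using s add_subgroup_minus[OF sg s]
      by (simp add: autocorrelation_def bij_betw_same_card)
  qed
  moreover have "(1 / card E)\<^sup>2 \<le> fourier G (autocorrelation X G) (trivial_char G)"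
  proof -
    have "G \<subseteq> (\<Union>e\<in>E. (+) e ` (G \<inter> X))"
    proof
      fix g assume g: "g \<in> G"
      then obtain e where e: "e \<in> E" "g - e \<in> X" using cover G by (auto simp: finite_subgroup_of_def)
      then have "g - e \<in> G \<inter> X" using add_subgroup_diff[OF sg g] E by auto
      then have "e + (g - e) \<in> (+) e ` (G \<inter> X)" by blast
      then show "g \<in> (\<Union>e\<in>E. (+) e ` (G \<inter> X))" using e(1) by auto
    qed
    then have "card G \<le> card (\<Union>e\<in>E. (+) e ` (G \<inter> X))" using finE fin by (intro card_mono) auto
    also have "\<dots> \<le> (\<Sum>e\<in>E. card ((+) e ` (G \<inter> X)))" using finE by (rule card_UN_le)
    also have "\<dots> = card E * card (G \<inter> X)" by (simp add: card_image)
    finally have le: "real (card G) \<le> card E * card (G \<inter> X)" by (metis of_nat_le_iff of_nat_mult)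
    have "card E > 0" using finE cover[OF add_subgroup_zero[OF subgroup]] by (auto simp: card_gt_0_iff)
    then have "1 / card E \<le> card (G \<inter> X) / card G"
      using le finite_subgroup_card_pos[OF G] by (simp add: field_simps)
    moreover have "(\<Sum>x\<in>G \<inter> X. trivial_char G x) = of_nat (card (G \<inter> X))"
      by (simp add: trivial_char_def)
    ultimately show ?thesis
      using fourier_autocorrelation[OF G trivial_char_mem[OF sg], of X]
      by (auto intro!: power_mono)
  qed
  ultimately show ?thesis
    using fourier_autocorrelation[OF G] by (auto simp: positive_definite_on_def)
qed

lemma closed_positive_definite_on: "closed {a. positive_definite_on \<beta> G a}"
  unfolding positive_definite_on_def fourier_def Ball_def divide_inverse
  by (intro closed_Collect_conj closed_Collect_all closed_Collect_imp open_Collect_const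
      closed_Collect_eq closed_Collect_le continuous_intros continuous_on_product_coordinates)

text \<open>Tychonoff's theorem: the conditions imposed by the finite subgroups are closed, and those of finitely
many subgroups are met by the autocorrelation along any finite group containing all of them.\<close>
lemma limit_autocorrelation:
  assumes E: "fin_subgroup E" and cover: "\<And>y. y \<in> Y \<Longrightarrow> \<exists>e\<in>E. y - e \<in> X"
  obtains a where "\<And>s. 0 \<le> a s \<and> a s \<le> 1" "\<And>s. s \<notin> {x - y | x y. x \<in> X \<and> y \<in> X} \<Longrightarrow> a s = 0"
    "\<And>G. fin_subgroup G \<Longrightarrow> positive_definite_on ((1 / card E)\<^sup>2) G a"
proof -
  let ?D = "{x - y | x y. x \<in> X \<and> y \<in> X}"
  let ?K = "Pi\<^sub>E UNIV (\<lambda>_. {0..1::real}) :: ('a \<Rightarrow> real) set"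
  define C where "C G = {a. (\<forall>s. s \<notin> ?D \<longrightarrow> a s = 0) \<and> positive_definite_on ((1 / card E)\<^sup>2) G a}" for G
  have "compactin (product_topology (\<lambda>_::'a. euclidean) UNIV) ?K"
    by (subst compactin_PiE) simp
  then have K: "compact ?K" by (simp add: euclidean_product_topology)
  have closed: "closed (C G)" for G
    unfolding C_def
    by (intro closed_Collect_conj closed_positive_definite_on closed_Collect_all closed_Collect_imp
        open_Collect_const closed_Collect_eq continuous_on_const continuous_on_product_coordinates)
  have fip: "?K \<inter> (\<Inter>G\<in>I. C G) \<noteq> {}" if I: "finite I" "I \<subseteq> Collect fin_subgroup" for I
  proof -
    have "fin_subgroup G" if "G \<in> I" for G using I(2) that by auto
    then have "finite (\<Union>I)" "\<Union>I \<subseteq> Y"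
      using I(1) by (auto simp: finite_subgroup_of_def)
    then obtain G' where G': "fin_subgroup G'" "E \<subseteq> G'" "\<Union>I \<subseteq> G'" using extend[OF E] by metis
    let ?a = "autocorrelation X G'"
    have "?a s \<in> {0..1}" for s
      using finite_subgroup_ofD(1)[OF G'(1)] finite_subgroup_card_pos[OF G'(1)]
      by (auto simp: autocorrelation_def intro!: card_mono)
    moreover have "?a s = 0" if "s \<notin> ?D" for s
    proof -
      have "{x \<in> G'. x \<in> X \<and> x - s \<in> X} = {}"
      proof (rule ccontr)
        assume "{x \<in> G'. x \<in> X \<and> x - s \<in> X} \<noteq> {}"
        then obtain x where "x \<in> X" "x - s \<in> X" by blast
        then have "x - (x - s) \<in> ?D" by blast
        then show False using that by simp
      qed
      then show ?thesis unfolding autocorrelation_def by (simp only: card.empty) simp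
    qed
    moreover have "positive_definite_on ((1 / card E)\<^sup>2) G ?a" if "G \<in> I" for G
      using positive_definite_on_subset[OF _ G'(1) _ autocorrelation_positive_definite[OF G'(1,2) cover]]
        that I G'(3) by blast
    ultimately have "?a \<in> ?K \<inter> (\<Inter>G\<in>I. C G)" unfolding C_def by auto
    then show ?thesis by blast
  qed
  have "?K \<inter> (\<Inter>G\<in>Collect fin_subgroup. C G) \<noteq> {}"
    using compact_imp_fip_image[OF K closed fip] by blast
  then obtain a where "a \<in> ?K" "\<And>G. fin_subgroup G \<Longrightarrow> a \<in> C G" by blast
  moreover have "\<And>s. a s \<in> {0..1}" using \<open>a \<in> ?K\<close> by (simp add: PiE_iff)
  ultimately show ?thesis
    using that[of a] E unfolding C_def by auto
qed

text \<open>Folner's theorem for abelian groups of bounded exponent: the difference set of a set of which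
finitely many translates cover the group contains a finite-index subgroup up to a set of Banach density 0.\<close>
theorem difference_set_contains_almost_subgroup:
  assumes E: "fin_subgroup E" and cover: "\<And>y. y \<in> Y \<Longrightarrow> \<exists>e\<in>E. y - e \<in> X"
  obtains H where "add_subgroup H" "H \<subseteq> Y" "syndetic_in Y H"
    "\<And>\<delta>::real. \<delta> > 0 \<Longrightarrow> \<exists>G. fin_subgroup G \<and>
       (\<forall>x\<in>Y. card {s \<in> (+) x ` G. s \<in> H \<and> s \<notin> {x - y | x y. x \<in> X \<and> y \<in> X}} \<le> \<delta> * card G)"
proof -
  obtain a where a: "\<And>s. 0 \<le> a s \<and> a s \<le> 1" "\<And>s. s \<notin> {x - y | x y. x \<in> X \<and> y \<in> X} \<Longrightarrow> a s = 0"
    "\<And>G. fin_subgroup G \<Longrightarrow> positive_definite_on ((1 / card E)\<^sup>2) G a"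
    using limit_autocorrelation[OF assms] by blast
  interpret positive_definite_function Y n a "(1 / card E)\<^sup>2"
  proof
    show "a 0 \<le> 1" using a(1) by blast
    show "0 < (1 / real (card E))\<^sup>2" using finite_subgroup_card_pos[OF E] by simp
  qed (use a(3) in \<open>auto simp: positive_definite_on_def\<close>)
  obtain H where H: "add_subgroup H" "H \<subseteq> Y" "syndetic_in Y H"
    "\<forall>\<delta>::real>0. \<exists>G. fin_subgroup G \<and> (\<forall>x\<in>Y. card {s \<in> (+) x ` G. s \<in> H \<and> a s = 0} \<le> \<delta> * real (card G))"
    using zeros_null_on_finite_index_subgroup by blast
  show ?thesis
  proof (rule that[OF H(1-3)])
    fix \<delta> :: real assume "\<delta> > 0"
    then obtain G where G: "fin_subgroup G" "\<forall>x\<in>Y. card {s \<in> (+) x ` G. s \<in> H \<and> a s = 0} \<le> \<delta> * real (card G)"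
      using H(4) by blast
    have "card {s \<in> (+) x ` G. s \<in> H \<and> s \<notin> {x - y | x y. x \<in> X \<and> y \<in> X}} \<le> card {s \<in> (+) x ` G. s \<in> H \<and> a s = 0}" for x
      by (rule card_mono) (use a(2) finite_subgroup_ofD(1)[OF G(1)] in auto)
    then show "\<exists>G. fin_subgroup G \<and>
       (\<forall>x\<in>Y. card {s \<in> (+) x ` G. s \<in> H \<and> s \<notin> {x - y | x y. x \<in> X \<and> y \<in> X}} \<le> \<delta> * card G)"
      using G by (meson of_nat_mono order_trans)
  qed
qed

end

section \<open>Banach density\<close>
lemma syndetic_mono: "syndetic_in Y V \<Longrightarrow> V \<subseteq> W \<Longrightarrow> syndetic_in Y W"
  unfolding syndetic_in_def by (metis subsetD)

lemma card_translate_indicator: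
  fixes x :: "'a::ab_group_add"
  assumes "finite G"
  shows "real (card (A \<inter> (+) x ` G)) = (\<Sum>g\<in>G. of_bool (x + g \<in> A))"
proof -
  have "A \<inter> (+) x ` G = (+) x ` {g \<in> G. x + g \<in> A}" by auto
  then have "card (A \<inter> (+) x ` G) = card {g \<in> G. x + g \<in> A}" by (simp add: card_image)
  then show ?thesis using assms by (simp add: of_bool_def sum.inter_filter[symmetric])
qed

context bounded_exponent_group
begin

text \<open>The density of a set in a coset of \<open>G'\<close> is the average of its densities in cosets of \<open>G\<close>.\<close>
lemma density_coarsen:
  assumes G: "fin_subgroup G" and G': "fin_subgroup G'" and sub: "G \<subseteq> G'"
    and small: "\<And>x. x \<in> Y \<Longrightarrow> card (A \<inter> (+) x ` G) < c * real (card G)" and x: "x \<in> Y"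
  shows "card (A \<inter> (+) x ` G') < c * real (card G')"
proof -
  note fin = finite_subgroup_ofD(1)[OF G] and fin' = finite_subgroup_ofD(1)[OF G']
  have "card G * real (card (A \<inter> (+) x ` G')) = (\<Sum>g\<in>G. \<Sum>h\<in>G'. of_bool (x + h \<in> A))"
    by (simp add: card_translate_indicator[OF fin'])
  also have "\<dots> = (\<Sum>g\<in>G. \<Sum>h\<in>G'. of_bool (x + (g + h) \<in> A))"
  proof (rule sum.cong[OF refl])
    fix g assume "g \<in> G"
    then have "g \<in> G'" using sub by blast
    then show "(\<Sum>h\<in>G'. of_bool (x + h \<in> A)) = (\<Sum>h\<in>G'. of_bool (x + (g + h) \<in> A) :: real)"
      using sum_subgroup_translate[OF finite_subgroup_ofD(2)[OF G'], of g "\<lambda>h. of_bool (x + h \<in> A) :: real"] by simp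
  qed
  also have "\<dots> = (\<Sum>h\<in>G'. \<Sum>g\<in>G. of_bool ((x + h) + g \<in> A))"
    by (subst sum.swap) (simp add: ac_simps)
  also have "\<dots> = (\<Sum>h\<in>G'. real (card (A \<inter> (+) (x + h) ` G)))"
    by (simp only: card_translate_indicator[OF fin])
  also have "\<dots> < (\<Sum>h\<in>G'. c * real (card G))"
  proof (rule sum_strict_mono)
    show "finite G'" "G' \<noteq> {}" using fin' finite_subgroup_card_pos[OF G'] by auto
    fix h assume "h \<in> G'"
    then show "real (card (A \<inter> (+) (x + h) ` G)) < c * real (card G)"
      using small add_subgroup_add[OF subgroup x] finite_subgroup_ofD(3)[OF G'] by blast
  qed
  also have "\<dots> = card G * (c * real (card G'))" by simp
  finally show ?thesis using finite_subgroup_card_pos[OF G] by (auto simp only: mult_less_cancel_left)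
qed

text \<open>By \<open>density_coarsen\<close> the maximal density in a coset of \<open>G\<close> decreases as \<open>G\<close> grows; the condition says
that its limit, the upper Banach density, is at least \<open>e\<close>.\<close>
definition dense :: "real \<Rightarrow> 'a set \<Rightarrow> bool" where
  "dense e A \<longleftrightarrow> (\<forall>G. fin_subgroup G \<longrightarrow> (\<exists>x\<in>Y. e * real (card G) \<le> card (A \<inter> (+) x ` G)))"

lemma dense_antimono: "dense e A \<Longrightarrow> e' \<le> e \<Longrightarrow> dense e' A"
  unfolding dense_def by (meson mult_right_mono of_nat_0_le_iff order_trans)

text \<open>If all intersections had density below \<open>e\<^sup>2 / 2\<close>, they would have it in all cosets of one finite group
containing \<open>ts\<close>. Let \<open>N g\<close> be the number of translates of \<open>A\<close> that contain a point. In some coset its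
mean is at least \<open>r * e\<close> and its mean square at most \<open>r + r\<^sup>2 * e\<^sup>2 / 2\<close>, against the
Cauchy-Schwarz inequality.\<close>
lemma dense_intersects_translate:
  fixes e :: real and r :: nat
  assumes A: "dense e A" "e > 0" and r: "r * e\<^sup>2 > 2"
    and ts: "length ts = r" "set ts \<subseteq> Y"
  shows "\<exists>i l. i < l \<and> l < r \<and> dense (e\<^sup>2 / 2) (A \<inter> (+) (ts ! l - ts ! i) ` A)"
proof (rule ccontr)
  assume not: "\<not> ?thesis"
  define B where "B i l = A \<inter> (+) (ts ! l - ts ! i) ` A" for i l
  have "\<exists>G. fin_subgroup G \<and> (\<forall>x\<in>Y. card (B i l \<inter> (+) x ` G) < e\<^sup>2 / 2 * real (card G))"
    if "i < l" "l < r" for i l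
    using not that unfolding dense_def B_def by (meson not_le)
  then obtain K where K: "\<And>i l. i < l \<Longrightarrow> l < r \<Longrightarrow> fin_subgroup (K i l) \<and>
      (\<forall>x\<in>Y. card (B i l \<inter> (+) x ` K i l) < e\<^sup>2 / 2 * real (card (K i l)))"
    by metis
  define F where "F = set ts \<union> (\<Union>l<r. \<Union>i<l. K i l)"
  have "finite F" "F \<subseteq> Y" using K ts unfolding F_def finite_subgroup_of_def by auto
  then obtain G where G: "fin_subgroup G" "F \<subseteq> G" using extend[OF trivial_fin_subgroup] by metis
  note fin = finite_subgroup_ofD(1)[OF G(1)] and sg = finite_subgroup_ofD(2)[OF G(1)]
  have tG: "ts ! i \<in> G" if "i < r" for i using that ts G(2) by (auto simp: F_def)
  have KG: "K i l \<subseteq> G" if "i < l" "l < r" for i l using that G(2) by (auto simp: F_def)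
  have small: "card (B i l \<inter> (+) x ` G) < e\<^sup>2 / 2 * real (card G)" if "i < l" "l < r" "x \<in> Y" for i l x
    by (rule density_coarsen[OF _ G(1) KG[OF that(1,2)] _ that(3)]) (use K[OF that(1,2)] in auto)
  obtain x where x: "x \<in> Y" "e * real (card G) \<le> card (A \<inter> (+) x ` G)"
    using A(1) G(1) unfolding dense_def by blast
  define I where "I i g = (of_bool (x + (g - ts ! i) \<in> A) :: real)" for i g
  have I_sum: "(\<Sum>g\<in>G. I i g) = card (A \<inter> (+) x ` G)" if "i < r" for i
  proof -
    have "(\<Sum>g\<in>G. I i g) = (\<Sum>g\<in>G. I i (ts ! i + g))"
      using sum_subgroup_translate[OF sg tG[OF that], of "I i"] by simp
    then show ?thesis unfolding card_translate_indicator[OF fin] I_def by simp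
  qed
  have pair: "(\<Sum>g\<in>G. I i g * I l g) \<le> e\<^sup>2 / 2 * card G" if "i < l" "l < r" for i l
  proof -
    have "(\<Sum>g\<in>G. I i g * I l g) = (\<Sum>g\<in>G. I i (ts ! i + g) * I l (ts ! i + g))"
      using sum_subgroup_translate[OF sg tG[of i], of "\<lambda>g. I i g * I l g"] that by simp
    also have "\<dots> = (\<Sum>g\<in>G. of_bool (x + g \<in> B i l))"
    proof (rule sum.cong[OF refl])
      fix g
      have "x + g \<in> (+) (ts ! l - ts ! i) ` A \<longleftrightarrow> x + (ts ! i + g - ts ! l) \<in> A"
        by (force simp: image_iff algebra_simps)
      then show "I i (ts ! i + g) * I l (ts ! i + g) = of_bool (x + g \<in> B i l)"
        by (auto simp: I_def B_def)
    qed
    also have "\<dots> = card (B i l \<inter> (+) x ` G)" by (simp add: card_translate_indicator[OF fin])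
    finally show ?thesis using small[OF that x(1)] by simp
  qed
  have pair': "(\<Sum>g\<in>G. I i g * I l g) \<le> (if i = l then real (card G) else 0) + e\<^sup>2 / 2 * card G"
    if "i < r" "l < r" for i l
  proof (cases i l rule: linorder_cases)
    case less
    then show ?thesis using pair[OF less that(2)] by simp
  next
    case equal
    have "(\<Sum>g\<in>G. I i g * I l g) \<le> (\<Sum>g\<in>G. 1)" by (rule sum_mono) (simp add: I_def)
    then show ?thesis using equal by (simp add: add_increasing2)
  next
    case greater
    then show ?thesis using pair[OF greater that(1)] by (simp add: mult.commute)
  qed
  let ?N = "\<lambda>g. \<Sum>i<r. I i g"
  let ?c = "real (card G)"
  have c: "?c > 0" using finite_subgroup_card_pos[OF G(1)] by simp
  have "r * (e * ?c) \<le> (\<Sum>i<r. \<Sum>g\<in>G. I i g)"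
    using x(2) I_sum by (simp add: mult_left_mono)
  also have "\<dots> = (\<Sum>g\<in>G. ?N g)" by (rule sum.swap)
  finally have "(r * (e * ?c))\<^sup>2 \<le> (\<Sum>g\<in>G. ?N g)\<^sup>2" using A(2) by (intro power_mono) auto
  also have "\<dots> \<le> (\<Sum>g\<in>G. (?N g)\<^sup>2) * ?c" by (rule sum_squared_le_sum_of_squares)
  also have "(\<Sum>g\<in>G. (?N g)\<^sup>2) = (\<Sum>g\<in>G. \<Sum>i<r. \<Sum>l<r. I i g * I l g)"
    by (simp add: power2_eq_square sum_product)
  also have "\<dots> = (\<Sum>i<r. \<Sum>l<r. \<Sum>g\<in>G. I i g * I l g)"
    by (subst sum.swap, rule sum.cong[OF refl], rule sum.swap)
  also have "\<dots> \<le> (\<Sum>i<r. \<Sum>l<r. (if i = l then ?c else 0) + e\<^sup>2 / 2 * ?c)"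
    by (intro sum_mono pair') auto
  also have "\<dots> = r * ?c + r * (r * (e\<^sup>2 / 2 * ?c))" by (simp add: sum.distrib algebra_simps)
  finally have "(r * (e * ?c))\<^sup>2 \<le> (r * ?c + r * (r * (e\<^sup>2 / 2 * ?c))) * ?c" using c by simp
  then have "(r * ?c\<^sup>2) * (r * e\<^sup>2) \<le> (r * ?c\<^sup>2) * (1 + r * e\<^sup>2 / 2)"
    by (simp add: power2_eq_square algebra_simps)
  moreover have "r > 0" using r by (cases r) auto
  then have "r * ?c\<^sup>2 > 0" using c by simp
  ultimately have "r * e\<^sup>2 \<le> 1 + r * e\<^sup>2 / 2" by (rule mult_left_le_imp_le)
  then show False using r by simp
qed

text \<open>Positive Banach density speaks about all finite subgroups and is not first-order. Being wide is:
\<open>G\<close>, \<open>c\<close> and \<open>r\<close> are fixed, and the condition quantifies over finitely many elements of \<open>Y\<close>. If \<open>A\<close>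
is wide of level \<open>Suc j\<close>, finitely many translates of the set of all \<open>t\<close> for which \<open>A \<inter> (t + A)\<close> is wide
of level \<open>j\<close> cover \<open>Y\<close>.\<close>
primrec wide :: "'a set \<Rightarrow> real \<Rightarrow> nat \<Rightarrow> nat \<Rightarrow> 'a set \<Rightarrow> bool" where
  "wide G c r 0 A \<longleftrightarrow> (\<exists>x\<in>Y. c \<le> card (A \<inter> (+) x ` G))"
| "wide G c r (Suc j) A \<longleftrightarrow> (\<forall>ts. length ts = r \<and> set ts \<subseteq> Y \<longrightarrow>
     (\<exists>i l. i < l \<and> l < r \<and> wide G c r j (A \<inter> (+) (ts ! l - ts ! i) ` A)))"

lemma wide_mono: "wide G c r j A \<Longrightarrow> A \<subseteq> B \<Longrightarrow> finite G \<Longrightarrow> wide G c r j B"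
proof (induction j arbitrary: A B)
  case 0
  then obtain x where "x \<in> Y" "c \<le> card (A \<inter> (+) x ` G)" by auto
  moreover have "card (A \<inter> (+) x ` G) \<le> card (B \<inter> (+) x ` G)" using 0 by (intro card_mono) auto
  ultimately show ?case by (auto intro!: bexI[of _ x])
next
  case (Suc j)
  have "\<exists>i l. i < l \<and> l < r \<and> wide G c r j (B \<inter> (+) (ts ! l - ts ! i) ` B)"
    if "length ts = r" "set ts \<subseteq> Y" for ts
  proof -
    have "\<exists>i l. i < l \<and> l < r \<and> wide G c r j (A \<inter> (+) (ts ! l - ts ! i) ` A)"
      by (rule Suc.prems(1)[unfolded wide.simps, rule_format, OF conjI[OF that]])
    then obtain i l where il: "i < l" "l < r" "wide G c r j (A \<inter> (+) (ts ! l - ts ! i) ` A)"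
      by blast
    have "wide G c r j (B \<inter> (+) (ts ! l - ts ! i) ` B)"
      by (rule Suc.IH[OF il(3) _ Suc.prems(3)]) (use Suc.prems(2) in blast)
    then show ?thesis using il(1,2) by blast
  qed
  then show ?case by simp
qed

lemma wide_imp_wide_0:
  assumes "finite G"
  shows "wide G c r j A \<Longrightarrow> wide G c r 0 A"
proof (induction j arbitrary: A)
  case (Suc j)
  have "length (replicate r 0) = r \<and> set (replicate r (0::'a)) \<subseteq> Y"
    using add_subgroup_zero[OF subgroup] by (auto simp: set_replicate_conv_if)
  then obtain i l where "wide G c r j (A \<inter> (+) (replicate r 0 ! l - replicate r 0 ! i) ` A)"
    using Suc.prems unfolding wide.simps by blast
  then have "wide G c r j A" using wide_mono[OF _ _ assms] by blast
  then show ?case by (rule Suc.IH)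
qed simp

text \<open>Passing from \<open>A\<close> to \<open>A \<inter> (t + A)\<close> costs a step from \<open>e\<close> to \<open>e\<^sup>2 / 2\<close> in density; \<open>e0\<close> is what must remain
after \<open>j\<close> steps.\<close>
lemma dense_imp_wide:
  fixes e e0 :: real and r :: nat
  assumes "dense e A" "0 < e" "e \<le> 1" "e0 \<le> ((\<lambda>e. e\<^sup>2 / 2) ^^ j) e" "0 < e0" "r * e0\<^sup>2 > 2"
    and G: "fin_subgroup G"
  shows "wide G (e0 * card G) r j A"
  using assms(1-4)
proof (induction j arbitrary: A e)
  case 0
  then obtain x where x: "x \<in> Y" "e * real (card G) \<le> card (A \<inter> (+) x ` G)"
    using G unfolding dense_def by blast
  have "e0 * real (card G) \<le> e * real (card G)" using 0 by (intro mult_right_mono) auto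
  then show ?case using x by force
next
  case (Suc j)
  have le: "((\<lambda>e. e\<^sup>2 / 2) ^^ i) u \<le> u" if "0 < u" "u \<le> 1" for u :: real and i
    using that
  proof (induction i arbitrary: u)
    case (Suc i)
    have u2: "u\<^sup>2 \<le> u" "u\<^sup>2 \<le> 1" using Suc.prems by (simp_all add: power2_eq_square mult_le_one)
    then have "u\<^sup>2 / 2 \<le> u" using Suc.prems by simp
    moreover have "((\<lambda>e. e\<^sup>2 / 2) ^^ i) (u\<^sup>2 / 2) \<le> u\<^sup>2 / 2"
      using Suc.prems u2 by (intro Suc.IH) auto
    ultimately show ?case unfolding funpow_Suc_right by simp
  qed simp
  have "e0 \<le> e" using le[OF Suc.prems(2,3), of "Suc j"] Suc.prems(4) by linarith
  then have "r * e0\<^sup>2 \<le> r * e\<^sup>2" using \<open>0 < e0\<close> by (intro mult_left_mono power_mono) auto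
  then have r: "r * e\<^sup>2 > 2" using \<open>r * e0\<^sup>2 > 2\<close> by linarith
  have "e\<^sup>2 \<le> 1" using Suc.prems by (simp add: power_le_one)
  then have e2: "0 < e\<^sup>2 / 2" "e\<^sup>2 / 2 \<le> 1" using Suc.prems by auto
  have "e0 \<le> ((\<lambda>e. e\<^sup>2 / 2) ^^ j) (e\<^sup>2 / 2)" using Suc.prems(4) unfolding funpow_Suc_right by simp
  then have step: "wide G (e0 * card G) r j A'" if "dense (e\<^sup>2 / 2) A'" for A'
    using Suc.IH[OF that e2] by blast
  show ?case unfolding wide.simps
    using dense_intersects_translate[OF Suc.prems(1,2) r] step by blast
qed

end

section \<open>Definable hulls of finite-index subgroups\<close>
definition invariant_under :: "'a::ab_group_add set \<Rightarrow> 'a set \<Rightarrow> bool" where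
  "invariant_under H C \<longleftrightarrow> (\<forall>c\<in>C. \<forall>h\<in>H. c + h \<in> C)"

definition coset_count :: "'a::ab_group_add set \<Rightarrow> 'a set \<Rightarrow> nat" where
  "coset_count H C = card ((\<lambda>c. (+) c ` H) ` C)"

lemma coset_eq:
  assumes "add_subgroup H" "y - t \<in> H"
  shows "(+) y ` H = (+) t ` H"
proof -
  have "y + h = t + ((y - t) + h)" "t + h = y + (h - (y - t))" for h by simp_all
  moreover have "(y - t) + h \<in> H" "h - (y - t) \<in> H" if "h \<in> H" for h
    using assms that add_subgroup_add add_subgroup_diff by blast+
  ultimately show ?thesis by (metis (no_types, opaque_lifting) image_iff subsetI subset_antisym)
qed

lemma finite_cosets:
  assumes H: "add_subgroup H" and "syndetic_in Y H" and "C \<subseteq> Y"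
  shows "finite ((\<lambda>c. (+) c ` H) ` C)"
proof -
  obtain T where T: "finite T" "\<forall>y\<in>Y. \<exists>t\<in>T. y - t \<in> H" using assms(2) by (auto simp: syndetic_in_def)
  have "(\<lambda>c. (+) c ` H) ` C \<subseteq> (\<lambda>c. (+) c ` H) ` T"
  proof (rule image_subsetI)
    fix c assume "c \<in> C"
    then obtain t where "t \<in> T" "c - t \<in> H" using T(2) assms(3) by blast
    then show "(+) c ` H \<in> (\<lambda>c. (+) c ` H) ` T"
      using coset_eq[OF H, of c t] imageI[of t T "\<lambda>c. (+) c ` H"] by simp
  qed
  then show ?thesis by (rule finite_subset) (use T(1) in simp)
qed

lemma coset_count_strict_mono:
  assumes H: "add_subgroup H" "syndetic_in Y H" and C: "C \<subseteq> Y" "C' \<subset> C" "invariant_under H C'"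
  shows "coset_count H C' < coset_count H C"
  unfolding coset_count_def
proof (rule psubset_card_mono[OF finite_cosets[OF H C(1)]])
  obtain c where c: "c \<in> C" "c \<notin> C'" using C(2) by blast
  have "(+) c ` H \<notin> (\<lambda>c. (+) c ` H) ` C'"
  proof
    assume "(+) c ` H \<in> (\<lambda>c. (+) c ` H) ` C'"
    then obtain c' where c': "c' \<in> C'" "(+) c ` H = (+) c' ` H" by blast
    have "c + 0 \<in> (+) c ` H" using add_subgroup_zero[OF H(1)] by blast
    then obtain h where "h \<in> H" "c = c' + h" using c'(2) by auto
    then show False using C(3) c'(1) c(2) by (auto simp: invariant_under_def)
  qed
  then show "(\<lambda>c. (+) c ` H) ` C' \<subset> (\<lambda>c. (+) c ` H) ` C" using C(2) c(1) by blast
qed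

lemma coset_count_translate: "coset_count H ((+) t ` C) = coset_count H C"
proof -
  have "(\<lambda>c. (+) c ` H) ` ((+) t ` C) = (\<lambda>S. (+) t ` S) ` ((\<lambda>c. (+) c ` H) ` C)"
    by (simp add: image_image ac_simps)
  moreover have "inj_on (\<lambda>S. (+) t ` S) ((\<lambda>c. (+) c ` H) ` C)"
    by (intro inj_onI) (metis inj_image_eq_iff inj_on_add)
  ultimately show ?thesis unfolding coset_count_def by (simp add: card_image)
qed

text \<open>The only facts about definability that the construction of a definable subgroup relies on.\<close>
locale definable_group = bounded_exponent_group +
  fixes definable :: "'a set \<Rightarrow> bool"
  assumes definable_subset: "definable A \<Longrightarrow> A \<subseteq> Y"
    and definable_group: "definable Y"
    and definable_Int: "definable A \<Longrightarrow> definable B \<Longrightarrow> definable (A \<inter> B)"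
    and definable_Diff: "definable A \<Longrightarrow> definable B \<Longrightarrow> definable (A - B)"
    and definable_Un: "definable A \<Longrightarrow> definable B \<Longrightarrow> definable (A \<union> B)"
    and definable_translate: "definable A \<Longrightarrow> t \<in> Y \<Longrightarrow> definable ((+) t ` A)"
    and definable_wide: "definable A \<Longrightarrow> finite_subgroup_of Y G \<Longrightarrow> definable {t \<in> Y. wide G c r j (A \<inter> (+) t ` A)}"
begin

text \<open>A subgroup containing a set whose translates by \<open>T\<close> cover \<open>Y\<close> is the union of the translates by
elements of \<open>T \<inter> L\<close>.\<close>
lemma definable_supergroup:
  assumes L: "add_subgroup L" "L \<subseteq> Y" and V: "definable V" "V \<subseteq> L" "syndetic_in Y V"
  shows "definable L"
proof -
  obtain T where T: "finite T" "T \<subseteq> Y" "\<forall>y\<in>Y. \<exists>t\<in>T. y - t \<in> V"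
    using V(3) by (auto simp: syndetic_in_def)
  have "L = (\<Union>t\<in>T \<inter> L. (+) t ` V)"
  proof
    show "L \<subseteq> (\<Union>t\<in>T \<inter> L. (+) t ` V)"
    proof
      fix l assume l: "l \<in> L"
      then obtain t where t: "t \<in> T" "l - t \<in> V" using T(3) L(2) by blast
      have "l - (l - t) \<in> L" using add_subgroup_diff[OF L(1) l] t(2) V(2) by blast
      moreover have "t + (l - t) \<in> (+) t ` V" using t(2) by blast
      ultimately show "l \<in> (\<Union>t\<in>T \<inter> L. (+) t ` V)" using t(1) by auto
    qed
    show "(\<Union>t\<in>T \<inter> L. (+) t ` V) \<subseteq> L" using V(2) add_subgroup_add[OF L(1)] by blast
  qed
  moreover have "definable (\<Union>t\<in>S. (+) t ` V)" if "finite S" "S \<subseteq> Y" for S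
    using that
  proof (induction S rule: finite_induct)
    case empty
    then show ?case using definable_Diff[OF V(1) V(1)] by simp
  next
    case (insert t S)
    then show ?case using definable_Un[OF definable_translate[OF V(1)]] by auto
  qed
  ultimately show ?thesis using T(1,2) L(2) by (metis finite_Int le_infI1)
qed

text \<open>Definable subgroups are closed under intersection, so one that contains \<open>H\<close> and consists of as few
cosets of \<open>H\<close> as possible is contained in all others.\<close>
lemma definable_hull:
  assumes H: "add_subgroup H" "H \<subseteq> Y" "syndetic_in Y H"
  shows "\<exists>L. definable L \<and> add_subgroup L \<and> H \<subseteq> L \<and>
    (\<forall>L'. definable L' \<longrightarrow> add_subgroup L' \<longrightarrow> H \<subseteq> L' \<longrightarrow> L \<subseteq> L')"
proof -
  define P where "P L \<longleftrightarrow> definable L \<and> add_subgroup L \<and> H \<subseteq> L" for L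
  have "P Y" using definable_group subgroup H(2) by (simp add: P_def)
  then obtain L where L: "P L" "\<And>L'. P L' \<Longrightarrow> coset_count H L \<le> coset_count H L'"
    by (metis (mono_tags) exists_least_iff not_le ex_has_least_nat[of P Y "coset_count H"])
  show ?thesis
  proof (intro exI[of _ L] conjI allI impI)
    show "definable L" "add_subgroup L" "H \<subseteq> L" using L(1) by (auto simp: P_def)
    fix L' assume "definable L'" "add_subgroup L'" "H \<subseteq> L'"
    then have PI: "P (L \<inter> L')" using L(1) definable_Int add_subgroup_Int by (auto simp: P_def)
    have inv: "invariant_under H (L \<inter> L')"
      using PI add_subgroup_add[of "L \<inter> L'"] by (auto simp: invariant_under_def P_def)
    have "\<not> L \<inter> L' \<subset> L"
      using coset_count_strict_mono[OF H(1,3) _ _ inv, of L] L(2)[OF PI] definable_subset L(1)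
      by (auto simp: P_def)
    then show "L \<subseteq> L'" by blast
  qed
qed

text \<open>\<open>A\<close> lies in the proper subset \<open>C\<close> of \<open>L\<close> except for a set \<open>N\<close> of small density. Wideness is kept by
\<open>A \<inter> (t + A)\<close> for all \<open>t\<close> in a definable set \<open>V\<close>, finitely many translates of which cover \<open>Y\<close>. If \<open>V\<close> stabilises \<open>C\<close>, the
stabiliser is definable, hence contains the hull \<open>L\<close>; this leaves only \<open>C = {}\<close>, and \<open>N\<close> is too thin
to contain a wide set. Otherwise some
\<open>t \<in> V\<close> replaces \<open>C\<close> by the smaller \<open>C \<inter> (t + C)\<close>, at the price of doubling \<open>N\<close>.\<close>
lemma hull_no_wide_set:
  fixes c \<kappa> :: real and r j :: nat
  assumes H: "add_subgroup H" "H \<subseteq> Y" "syndetic_in Y H"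
    and L: "add_subgroup L" "L \<subseteq> Y"
      "\<And>L'. definable L' \<Longrightarrow> add_subgroup L' \<Longrightarrow> H \<subseteq> L' \<Longrightarrow> L \<subseteq> L'"
    and G: "fin_subgroup G"
    and A: "definable A" "A \<subseteq> N \<union> C" and C: "C \<subset> L" "invariant_under H C" "coset_count H C \<le> j"
    and N: "\<And>x. x \<in> Y \<Longrightarrow> card (N \<inter> (+) x ` G) \<le> \<kappa>" "2 ^ j * \<kappa> < c"
    and wide: "wide G c r j A"
  shows False
  using A C N wide
proof (induction j arbitrary: A N C \<kappa>)
  case (0 A N C \<kappa>)
  have "finite ((\<lambda>c. (+) c ` H) ` C)" using finite_cosets[OF H(1,3)] 0(3) L(2) by blast
  then have "C = {}" using 0(5) by (simp add: coset_count_def)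
  then have AN: "A \<subseteq> N" using 0 by simp
  obtain x where x: "x \<in> Y" "c \<le> card (A \<inter> (+) x ` G)" using 0(8) by auto
  have "card (A \<inter> (+) x ` G) \<le> card (N \<inter> (+) x ` G)"
    using AN finite_subgroup_ofD(1)[OF G] by (intro card_mono) auto
  then show False using x 0(6)[OF x(1)] 0(7) by simp
next
  case (Suc j A N C \<kappa>)
  note fin = finite_subgroup_ofD(1)[OF G]
  define V where "V = {t \<in> Y. wide G c r j (A \<inter> (+) t ` A)}"
  have Vd: "definable V" unfolding V_def using definable_wide[OF Suc.prems(1) G] .
  have syn: "syndetic_in Y V"
  proof (rule syndetic_if_no_separated_list)
    fix ts :: "'a list" assume ts: "length ts = r" "set ts \<subseteq> Y"
    then obtain i l where il: "i < l" "l < r" "wide G c r j (A \<inter> (+) (ts ! l - ts ! i) ` A)"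
      using Suc.prems(8) by auto
    then have "ts ! l \<in> Y" "ts ! i \<in> Y" using ts by auto
    then show "\<exists>i l. i < l \<and> l < r \<and> ts ! l - ts ! i \<in> V"
      using il add_subgroup_diff[OF subgroup] unfolding V_def by blast
  qed
  define S where "S = {t \<in> Y. (+) t ` C = C}"
  have CY: "C \<subseteq> Y" using Suc.prems(3) L(2) by blast
  have k0: "0 \<le> \<kappa>" using Suc.prems(6)[OF add_subgroup_zero[OF subgroup]] by linarith
  show False
  proof (cases "V \<subseteq> S")
    case True
    have "add_subgroup S"
      unfolding add_subgroup_def
    proof (intro conjI ballI)
      show "0 \<in> S" using add_subgroup_zero[OF subgroup] by (simp add: S_def)
      fix x y assume "x \<in> S" "y \<in> S"
      then have xy: "x \<in> Y" "y \<in> Y" "(+) x ` C = C" "(+) y ` C = C" by (auto simp: S_def)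
      have "(+) (x - y) ` C = (+) (x - y) ` ((+) y ` C)" using xy(4) by simp
      also have "\<dots> = (+) x ` C" by (simp add: image_image)
      finally show "x - y \<in> S" using xy add_subgroup_diff[OF subgroup] by (simp add: S_def)
    qed
    moreover have "definable S"
      by (rule definable_supergroup[OF \<open>add_subgroup S\<close> _ Vd True syn]) (auto simp: S_def)
    moreover have "H \<subseteq> S"
    proof
      fix h assume h: "h \<in> H"
      have "(+) h ` C \<subseteq> C" "(+) (- h) ` C \<subseteq> C"
        using Suc.prems(4) h add_subgroup_minus[OF H(1) h]
        by (metis add.commute image_subsetI invariant_under_def)+
      then have "(+) h ` C \<subseteq> C" "(+) h ` ((+) (- h) ` C) \<subseteq> (+) h ` C" by auto
      then show "h \<in> S" using h H(2) by (auto simp: S_def image_image)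
    qed
    ultimately have LS: "L \<subseteq> S" using L(3) by blast
    have "C = {}"
    proof (rule ccontr)
      assume "C \<noteq> {}"
      then obtain c0 where c0: "c0 \<in> C" by blast
      have "l \<in> C" if "l \<in> L" for l
      proof -
        have "l - c0 \<in> S" using LS add_subgroup_diff[OF L(1) that] c0 Suc.prems(3) by blast
        then have "(l - c0) + c0 \<in> C" using c0 by (auto simp: S_def)
        then show ?thesis by simp
      qed
      then show False using Suc.prems(3) by blast
    qed
    then have AN: "A \<subseteq> N" using Suc.prems(2) by simp
    obtain x where x: "x \<in> Y" "c \<le> card (A \<inter> (+) x ` G)"
      using wide_imp_wide_0[OF fin Suc.prems(8)] by auto
    have "card (A \<inter> (+) x ` G) \<le> card (N \<inter> (+) x ` G)" using AN fin by (intro card_mono) auto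
    then have "c \<le> \<kappa>" using x Suc.prems(6)[OF x(1)] by linarith
    moreover have "\<kappa> \<le> 2 ^ Suc j * \<kappa>" using k0 mult_right_mono[of 1 "2 ^ Suc j" \<kappa>] one_le_power[of "2::real" "Suc j"] by simp
    ultimately show False using Suc.prems(7) by linarith
  next
    case False
    then obtain t where t: "t \<in> V" "t \<notin> S" by blast
    then have tY: "t \<in> Y" by (simp add: V_def)
    have tCY: "(+) t ` C \<subseteq> Y" using CY add_subgroup_add[OF subgroup tY] by blast
    have sub: "C \<inter> (+) t ` C \<subset> C"
    proof (rule ccontr)
      assume "\<not> ?thesis"
      then have "C \<subset> (+) t ` C" using t(2) tY by (auto simp: S_def)
      from coset_count_strict_mono[OF H(1,3) tCY this Suc.prems(4)] show False
        by (simp add: coset_count_translate)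
    qed
    have inv: "invariant_under H (C \<inter> (+) t ` C)"
      using Suc.prems(4) by (auto simp: invariant_under_def add.assoc)
    show False
    proof (rule Suc.IH[of "A \<inter> (+) t ` A" "N \<union> (+) t ` N" "C \<inter> (+) t ` C" "2 * \<kappa>"])
      show "definable (A \<inter> (+) t ` A)" using definable_Int definable_translate Suc.prems(1) tY by blast
      show "A \<inter> (+) t ` A \<subseteq> (N \<union> (+) t ` N) \<union> (C \<inter> (+) t ` C)" using Suc.prems(2) by blast
      show "C \<inter> (+) t ` C \<subset> L" using Suc.prems(3) by blast
      show "coset_count H (C \<inter> (+) t ` C) \<le> j"
        using coset_count_strict_mono[OF H(1,3) CY sub inv] Suc.prems(5) by simp
      show "wide G c r j (A \<inter> (+) t ` A)" using t(1) by (simp add: V_def)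
      show "2 ^ j * (2 * \<kappa>) < c" using Suc.prems(7) by (simp add: mult_ac)
      fix x assume x: "x \<in> Y"
      have "(+) t ` N \<inter> (+) x ` G = (+) t ` (N \<inter> (+) (x - t) ` G)"
        by (force simp: image_iff algebra_simps)
      then have "card ((+) t ` N \<inter> (+) x ` G) = card (N \<inter> (+) (x - t) ` G)" by (simp add: card_image)
      moreover have "card ((N \<union> (+) t ` N) \<inter> (+) x ` G) \<le> card (N \<inter> (+) x ` G) + card ((+) t ` N \<inter> (+) x ` G)"
        by (metis Int_Un_distrib2 card_Un_le)
      ultimately show "card ((N \<union> (+) t ` N) \<inter> (+) x ` G) \<le> 2 * \<kappa>"
        using Suc.prems(6)[OF x] Suc.prems(6)[OF add_subgroup_diff[OF subgroup x tY]] by linarith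
    qed (use inv in auto)
  qed
qed

lemma card_le_index_times_card:
  assumes L: "add_subgroup L" and T: "finite T" "\<forall>y\<in>Y. \<exists>t\<in>T. y - t \<in> L" and G: "fin_subgroup G"
  shows "card G \<le> card T * card (L \<inter> G)"
proof -
  note fin = finite_subgroup_ofD(1)[OF G] and sg = finite_subgroup_ofD(2)[OF G]
  have "card {y \<in> G. y - t \<in> L} \<le> card (L \<inter> G)" for t
  proof (cases "{y \<in> G. y - t \<in> L} = {}")
    case False
    then obtain g where g: "g \<in> G" "g - t \<in> L" by blast
    have "y - g \<in> L \<inter> G" if "y \<in> G" "y - t \<in> L" for y
      using add_subgroup_diff[OF sg that(1) g(1)] add_subgroup_diff[OF L that(2) g(2)] by simp
    then show ?thesis
      using fin by (intro card_inj_on_le[of "\<lambda>y. y - g"]) (auto simp: inj_on_def)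
  qed (metis card.empty le0)
  then have "(\<Sum>t\<in>T. card {y \<in> G. y - t \<in> L}) \<le> card T * card (L \<inter> G)"
    using sum_bounded_above[of T "\<lambda>t. card {y \<in> G. y - t \<in> L}" "card (L \<inter> G)"] by simp
  moreover have "G \<subseteq> (\<Union>t\<in>T. {y \<in> G. y - t \<in> L})" using T(2) finite_subgroup_ofD(3)[OF G] by blast
  then have "card G \<le> card (\<Union>t\<in>T. {y \<in> G. y - t \<in> L})" using T(1) fin by (intro card_mono) auto
  moreover have "card (\<Union>t\<in>T. {y \<in> G. y - t \<in> L}) \<le> (\<Sum>t\<in>T. card {y \<in> G. y - t \<in> L})"
    using T(1) by (rule card_UN_le)
  ultimately show ?thesis by linarith
qed

text \<open>The hull \<open>L\<close> of the subgroup provided by Folner's theorem has \<open>L - D\<close> of Banach density 0. For \<open>t \<in> L\<close>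
the sets \<open>L - D\<close> and \<open>t + (L - D)\<close> are then too small to cover \<open>L\<close>, so \<open>D\<close> meets \<open>t + D\<close>.\<close>
theorem definable_subgroup_in_fourfold_sum:
  assumes E: "fin_subgroup E" and cover: "\<And>y. y \<in> Y \<Longrightarrow> \<exists>e\<in>E. y - e \<in> X"
    and D: "definable D" "D = {x - y | x y. x \<in> X \<and> y \<in> X}"
  obtains L where "definable L" "add_subgroup L" "syndetic_in Y L" "L \<subseteq> {d - d' | d d'. d \<in> D \<and> d' \<in> D}"
proof -
  obtain H where H: "add_subgroup H" "H \<subseteq> Y" "syndetic_in Y H"
    "\<And>\<delta>::real. \<delta> > 0 \<Longrightarrow> \<exists>G. fin_subgroup G \<and>
       (\<forall>x\<in>Y. card {s \<in> (+) x ` G. s \<in> H \<and> s \<notin> D} \<le> \<delta> * card G)"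
    by (rule difference_set_contains_almost_subgroup[OF E cover, folded D(2)]) (assumption, rule that)
  obtain L where "definable L \<and> add_subgroup L \<and> H \<subseteq> L \<and>
      (\<forall>L'. definable L' \<longrightarrow> add_subgroup L' \<longrightarrow> H \<subseteq> L' \<longrightarrow> L \<subseteq> L')"
    using definable_hull[OF H(1-3)] ..
  then have L: "definable L" "add_subgroup L" "H \<subseteq> L"
    "\<And>L'. definable L' \<Longrightarrow> add_subgroup L' \<Longrightarrow> H \<subseteq> L' \<Longrightarrow> L \<subseteq> L'"
    by simp_all
  have LY: "L \<subseteq> Y" using definable_subset[OF L(1)] .
  have synL: "syndetic_in Y L" by (rule syndetic_mono[OF H(3) L(3)])
  define B where "B = L - D"
  have not_dense: "\<not> dense e B" if e: "e > 0" for e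
  proof
    assume "dense e B"
    define e1 where "e1 = min e 1"
    have e1: "dense e1 B" "0 < e1" "e1 \<le> 1"
      using dense_antimono[OF \<open>dense e B\<close>, of e1] e by (auto simp: e1_def)
    \<comment> \<open>\<open>J\<close> bounds the number of times that \<open>C = L - H\<close> can shrink.\<close>
    define J where "J = coset_count H (L - H)"
    define e0 where "e0 = ((\<lambda>e. e\<^sup>2 / 2) ^^ J) e1"
    have "((\<lambda>e. e\<^sup>2 / 2) ^^ j) e1 > 0" for j using e1(2) by (induction j) auto
    then have e0: "e0 > 0" by (simp add: e0_def)
    obtain r :: nat where "2 / e0\<^sup>2 < r" using reals_Archimedean2 by blast
    then have r: "r * e0\<^sup>2 > 2" using e0 by (simp add: field_simps)
    obtain G where G: "fin_subgroup G"
      "\<forall>x\<in>Y. card {s \<in> (+) x ` G. s \<in> H \<and> s \<notin> D} \<le> e0 / 2 ^ Suc J * card G"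
      using H(4)[of "e0 / 2 ^ Suc J"] e0 by auto
    show False
    proof (rule hull_no_wide_set[OF H(1-3) L(2) LY L(4) G(1), where A = B and N = "H - D" and C = "L - H"
          and j = J and \<kappa> = "e0 / 2 ^ Suc J * card G" and c = "e0 * card G" and r = r])
      show "definable B" unfolding B_def using definable_Diff L(1) D(1) .
      show "B \<subseteq> (H - D) \<union> (L - H)" by (auto simp: B_def)
      show "L - H \<subset> L" using add_subgroup_zero H(1) L(3) by blast
      show "invariant_under H (L - H)"
        unfolding invariant_under_def
      proof (intro ballI)
        fix c h assume "c \<in> L - H" "h \<in> H"
        moreover have "c = (c + h) - h" by simp
        ultimately show "c + h \<in> L - H"
          using add_subgroup_add[OF L(2)] add_subgroup_diff[OF H(1)] L(3) by (metis Diff_iff subsetD)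
      qed
      show "coset_count H (L - H) \<le> J" by (simp add: J_def)
      show "wide G (e0 * card G) r J B"
        by (rule dense_imp_wide[OF e1 _ e0 r G(1)]) (simp add: e0_def)
      show "2 ^ J * (e0 / 2 ^ Suc J * card G) < e0 * card G"
        using e0 finite_subgroup_card_pos[OF G(1)] by (simp add: field_simps)
      fix x assume "x \<in> Y"
      moreover have "(H - D) \<inter> (+) x ` G = {s \<in> (+) x ` G. s \<in> H \<and> s \<notin> D}" by auto
      ultimately show "card ((H - D) \<inter> (+) x ` G) \<le> e0 / 2 ^ Suc J * card G" using G(2) by simp
    qed
  qed
  have "L \<subseteq> {d - d' | d d'. d \<in> D \<and> d' \<in> D}"
  proof (rule subsetI, rule ccontr)
    fix t assume t: "t \<in> L" and tD: "t \<notin> {d - d' | d d'. d \<in> D \<and> d' \<in> D}"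
    obtain T where T: "finite T" "T \<subseteq> Y" "\<forall>y\<in>Y. \<exists>t\<in>T. y - t \<in> L"
      using synL by (auto simp: syndetic_in_def)
    have "card T > 0" using T add_subgroup_zero[OF subgroup] by (auto simp: card_gt_0_iff)
    then have m: "real (card T) > 0" by simp
    then have "\<not> dense (1 / (2 * card T)) B" by (intro not_dense) simp
    then obtain G where G: "fin_subgroup G"
      "\<And>x. x \<in> Y \<Longrightarrow> card (B \<inter> (+) x ` G) < 1 / (2 * card T) * real (card G)"
      unfolding dense_def by (meson not_le)
    note fin = finite_subgroup_ofD(1)[OF G(1)]
    have tY: "t \<in> Y" "- t \<in> Y" using t LY add_subgroup_minus[OF subgroup] by auto
    have "L \<inter> G \<subseteq> (B \<inter> (+) 0 ` G) \<union> (+) t ` (B \<inter> (+) (- t) ` G)"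
    proof
      fix l assume l: "l \<in> L \<inter> G"
      show "l \<in> (B \<inter> (+) 0 ` G) \<union> (+) t ` (B \<inter> (+) (- t) ` G)"
      proof (cases "l \<in> D")
        case True
        have "l - t \<notin> D"
        proof
          assume "l - t \<in> D"
          then have "l - (l - t) \<in> {d - d' | d d'. d \<in> D \<and> d' \<in> D}" using True by blast
          then show False using tD by simp
        qed
        then have "l - t \<in> B" using l t add_subgroup_diff[OF L(2)] by (simp add: B_def)
        moreover have "- t + l \<in> (+) (- t) ` G" using l by blast
        ultimately have "t + (l - t) \<in> (+) t ` (B \<inter> (+) (- t) ` G)" by (intro imageI) simp
        then show ?thesis by simp
      next
        case False
        then show ?thesis using l by (simp add: B_def)
      qed
    qed
    then have "card (L \<inter> G) \<le> card ((B \<inter> (+) 0 ` G) \<union> (+) t ` (B \<inter> (+) (- t) ` G))"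
      using fin by (intro card_mono) auto
    also have "\<dots> \<le> card (B \<inter> (+) 0 ` G) + card ((+) t ` (B \<inter> (+) (- t) ` G))" by (rule card_Un_le)
    also have "card ((+) t ` (B \<inter> (+) (- t) ` G)) = card (B \<inter> (+) (- t) ` G)" by (simp add: card_image)
    finally have "real (card (L \<inter> G)) \<le> card (B \<inter> (+) 0 ` G) + card (B \<inter> (+) (- t) ` G)" by linarith
    also have "\<dots> < 1 / (2 * card T) * real (card G) + 1 / (2 * card T) * real (card G)"
      using G(2)[OF tY(2)] G(2)[OF add_subgroup_zero[OF subgroup]] by linarith
    also have "\<dots> = card G / card T" using m by (simp add: field_simps)
    finally have "card T * real (card (L \<inter> G)) < card G" using m by (simp add: field_simps)
    then show False
      using card_le_index_times_card[OF L(2) T(1,3) G(1)] by (metis not_le of_nat_less_iff of_nat_mult)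
  qed
  then show ?thesis using that L(1,2) synL by blast
qed

end

section \<open>Predicates definable with parameters\<close>
lemma eval_term_cong:
  "(\<And>i. i \<in> vars_term t \<Longrightarrow> e i = e' i) \<Longrightarrow> eval_term M e t = eval_term M e' t"
proof (induction t)
  case (Fun f ts)
  have "eval_term M e t = eval_term M e' t" if "t \<in> set ts" for t
    by (rule Fun.IH[OF that]) (use Fun.prems that in auto)
  then have "map (eval_term M e) ts = map (eval_term M e') ts" by simp
  then show ?case by (simp only: eval_term.simps)
qed simp

lemma map_eval_term_cong:
  assumes "\<And>i. i \<in> (\<Union>t\<in>set ts. vars_term t) \<Longrightarrow> e i = e' i"
  shows "map (eval_term M e) ts = map (eval_term M e') ts"
proof (rule map_cong[OF refl])
  fix t assume "t \<in> set ts"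
  then show "eval_term M e t = eval_term M e' t" by (intro eval_term_cong assms) auto
qed

lemma sat_cong:
  "(\<And>i. i \<in> free_vars \<phi> \<Longrightarrow> e i = e' i) \<Longrightarrow> sat M e \<phi> = sat M e' \<phi>"
proof (induction \<phi> arbitrary: e e')
  case (Eq s t)
  then show ?case using eval_term_cong[of s e e' M] eval_term_cong[of t e e' M] by simp
next
  case (Rel p ts)
  then have "map (eval_term M e) ts = map (eval_term M e') ts" by (intro map_eval_term_cong) simp
  then show ?case by (simp only: sat.simps)
next
  case (Neg \<phi>)
  have "sat M e \<phi> = sat M e' \<phi>" by (rule Neg.IH, rule Neg.prems) simp
  then show ?case by simp
next
  case (Conj \<phi> \<psi>)
  have "sat M e \<phi> = sat M e' \<phi>" by (rule Conj.IH(1), rule Conj.prems) simp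
  moreover have "sat M e \<psi> = sat M e' \<psi>" by (rule Conj.IH(2), rule Conj.prems) simp
  ultimately show ?case by simp
next
  case (Exists i \<phi>)
  have "sat M (e(i := a)) \<phi> = sat M (e'(i := a)) \<phi>" for a
    by (rule Exists.IH) (use Exists.prems in auto)
  then show ?case by simp
qed

lemma finite_vars_term: "finite (vars_term t)"
  by (induction t) auto

lemma finite_free_vars: "finite (free_vars \<phi>)"
  by (induction \<phi>) (auto simp: finite_vars_term)

fun rename_term :: "(nat \<Rightarrow> nat) \<Rightarrow> 'f fo_term \<Rightarrow> 'f fo_term" where
  "rename_term \<rho> (Var i) = Var (\<rho> i)"
| "rename_term \<rho> (Fun f ts) = Fun f (map (rename_term \<rho>) ts)"

lemma eval_rename_term: "eval_term M e (rename_term \<rho> t) = eval_term M (e \<circ> \<rho>) t"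
  by (induction t) (auto intro!: arg_cong[of _ _ "fun_interp M _"])

lemma wf_rename_term: "wf_term M t \<Longrightarrow> wf_term M (rename_term \<rho> t)"
  by (induction t) auto

lemma vars_rename_term: "vars_term (rename_term \<rho> t) = \<rho> ` vars_term t"
  by (induction t) auto

text \<open>The bound variables of the result are chosen outside the new names of the free variables, so that
nothing is captured.\<close>
lemma rename_formula:
  "wf_formula M \<phi> \<Longrightarrow> \<exists>\<psi>. wf_formula M \<psi> \<and> free_vars \<psi> \<subseteq> \<rho> ` free_vars \<phi> \<and> (\<forall>e. sat M e \<psi> = sat M (e \<circ> \<rho>) \<phi>)"
proof (induction \<phi> arbitrary: \<rho>)
  case (Eq s t)
  then show ?case
    by (intro exI[of _ "Eq (rename_term \<rho> s) (rename_term \<rho> t)"])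
      (auto simp: eval_rename_term wf_rename_term vars_rename_term o_def)
next
  case (Rel p ts)
  have "map (eval_term M e) (map (rename_term \<rho>) ts) = map (eval_term M (e \<circ> \<rho>)) ts" for e
    by (simp add: eval_rename_term)
  then show ?case using Rel
    by (intro exI[of _ "Rel p (map (rename_term \<rho>) ts)"])
      (auto simp del: map_map simp: wf_rename_term vars_rename_term o_def)
next
  case (Neg \<phi>)
  then obtain \<psi> where "wf_formula M \<psi> \<and> free_vars \<psi> \<subseteq> \<rho> ` free_vars \<phi> \<and> (\<forall>e. sat M e \<psi> = sat M (e \<circ> \<rho>) \<phi>)"
    by (metis wf_formula.simps(3))
  then show ?case by (intro exI[of _ "Neg \<psi>"]) (auto simp: o_def)
next
  case (Conj \<phi>1 \<phi>2)
  then obtain \<psi>1 \<psi>2 where "wf_formula M \<psi>1 \<and> free_vars \<psi>1 \<subseteq> \<rho> ` free_vars \<phi>1 \<and> (\<forall>e. sat M e \<psi>1 = sat M (e \<circ> \<rho>) \<phi>1)"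
    "wf_formula M \<psi>2 \<and> free_vars \<psi>2 \<subseteq> \<rho> ` free_vars \<phi>2 \<and> (\<forall>e. sat M e \<psi>2 = sat M (e \<circ> \<rho>) \<phi>2)"
    by (metis wf_formula.simps(4))
  then show ?case by (intro exI[of _ "Conj \<psi>1 \<psi>2"]) (auto simp: o_def)
next
  case (Exists i \<phi>)
  obtain i' where i': "i' \<notin> \<rho> ` free_vars \<phi>"
    using ex_new_if_finite[OF infinite_UNIV_nat] finite_free_vars by (metis finite_imageI)
  obtain \<psi> where \<psi>: "wf_formula M \<psi>" "free_vars \<psi> \<subseteq> (\<rho>(i := i')) ` free_vars \<phi>"
    "\<And>e. sat M e \<psi> = sat M (e \<circ> \<rho>(i := i')) \<phi>"
    using Exists.IH[of "\<rho>(i := i')"] Exists.prems unfolding wf_formula.simps by metis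
  have "sat M ((e(i' := a)) \<circ> \<rho>(i := i')) \<phi> = sat M ((e \<circ> \<rho>)(i := a)) \<phi>" for e a
    by (rule sat_cong) (use i' in auto)
  then have "sat M e (Exists i' \<psi>) = sat M (e \<circ> \<rho>) (Exists i \<phi>)" for e using \<psi>(3) by simp
  moreover have "free_vars (Exists i' \<psi>) \<subseteq> \<rho> ` free_vars (Exists i \<phi>)"
    using \<psi>(2) by (auto split: if_splits)
  ultimately show ?case using \<psi>(1) by (intro exI[of _ "Exists i' \<psi>"]) (auto simp: o_def)
qed

text \<open>Even variables are the arguments and odd ones the parameters. In this way definable predicates need
neither a bound on the number of their arguments nor on that of their parameters.\<close>
definition with_parameters :: "(nat \<Rightarrow> 'm) \<Rightarrow> (nat \<Rightarrow> 'm) \<Rightarrow> nat \<Rightarrow> 'm" where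
  "with_parameters p v i = (if even i then v (i div 2) else p (i div 2))"

definition fo_definable :: "('f, 'p, 'm) fo_structure \<Rightarrow> ((nat \<Rightarrow> 'm) \<Rightarrow> bool) \<Rightarrow> bool" where
  "fo_definable M Q \<longleftrightarrow> (\<exists>\<phi> p. wf_formula M \<phi> \<and> range p \<subseteq> univ M \<and>
     (\<forall>v. range v \<subseteq> univ M \<longrightarrow> sat M (with_parameters p v) \<phi> = Q v))"

lemma fo_definable_cong:
  assumes "fo_definable M Q" "\<And>v. range v \<subseteq> univ M \<Longrightarrow> Q v = Q' v"
  shows "fo_definable M Q'"
  using assms unfolding fo_definable_def by metis

lemma fo_definable_not:
  assumes "fo_definable M Q" shows "fo_definable M (\<lambda>v. \<not> Q v)"
proof -
  obtain \<phi> p where "wf_formula M \<phi>" "range p \<subseteq> univ M"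
    "\<forall>v. range v \<subseteq> univ M \<longrightarrow> sat M (with_parameters p v) \<phi> = Q v"
    using assms unfolding fo_definable_def by blast
  then show ?thesis unfolding fo_definable_def by (intro exI[of _ "Neg \<phi>"] exI[of _ p]) auto
qed

lemma fo_definable_conj:
  assumes "fo_definable M Q1" "fo_definable M Q2"
  shows "fo_definable M (\<lambda>v. Q1 v \<and> Q2 v)"
proof -
  obtain \<phi>1 p1 where 1: "wf_formula M \<phi>1" "range p1 \<subseteq> univ M"
    "\<And>v. range v \<subseteq> univ M \<Longrightarrow> sat M (with_parameters p1 v) \<phi>1 = Q1 v"
    using assms unfolding fo_definable_def by blast
  obtain \<phi>2 p2 where 2: "wf_formula M \<phi>2" "range p2 \<subseteq> univ M"
    "\<And>v. range v \<subseteq> univ M \<Longrightarrow> sat M (with_parameters p2 v) \<phi>2 = Q2 v"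
    using assms unfolding fo_definable_def by blast
  \<comment> \<open>The two parameter sequences are interleaved; \<open>\<rho>1\<close> and \<open>\<rho>2\<close> direct the formulas to their halves.\<close>
  define p where "p = with_parameters p2 p1"
  define \<rho>1 where "\<rho>1 i = (if even i then i else 2 * (i - 1) + 1)" for i :: nat
  define \<rho>2 where "\<rho>2 i = (if even i then i else 2 * i + 1)" for i :: nat
  obtain \<psi>1 where \<psi>1: "wf_formula M \<psi>1" "\<forall>e. sat M e \<psi>1 = sat M (e \<circ> \<rho>1) \<phi>1"
    using rename_formula[OF 1(1)] by blast
  obtain \<psi>2 where \<psi>2: "wf_formula M \<psi>2" "\<forall>e. sat M e \<psi>2 = sat M (e \<circ> \<rho>2) \<phi>2"
    using rename_formula[OF 2(1)] by blast
  have "with_parameters p v \<circ> \<rho>1 = with_parameters p1 v" "with_parameters p v \<circ> \<rho>2 = with_parameters p2 v" for v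
    unfolding p_def \<rho>1_def \<rho>2_def with_parameters_def by (auto simp: fun_eq_iff elim!: oddE)
  moreover have "range p \<subseteq> univ M" using 1(2) 2(2) unfolding p_def with_parameters_def by auto
  ultimately show ?thesis
    unfolding fo_definable_def using \<psi>1 \<psi>2 1(3) 2(3)
    by (intro exI[of _ "Conj \<psi>1 \<psi>2"] exI[of _ p]) auto
qed

lemma fo_definable_rename:
  assumes "fo_definable M Q"
  shows "fo_definable M (\<lambda>v. Q (v \<circ> \<rho>))"
proof -
  obtain \<phi> p where 1: "wf_formula M \<phi>" "range p \<subseteq> univ M"
    "\<And>v. range v \<subseteq> univ M \<Longrightarrow> sat M (with_parameters p v) \<phi> = Q v"
    using assms unfolding fo_definable_def by blast
  define \<rho>' where "\<rho>' i = (if even i then 2 * \<rho> (i div 2) else i)" for i :: nat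
  obtain \<psi> where \<psi>: "wf_formula M \<psi>" "\<forall>e. sat M e \<psi> = sat M (e \<circ> \<rho>') \<phi>"
    using rename_formula[OF 1(1)] by blast
  have "with_parameters p v \<circ> \<rho>' = with_parameters p (v \<circ> \<rho>)" for v
    unfolding \<rho>'_def with_parameters_def by (auto simp: fun_eq_iff)
  moreover have "range (v \<circ> \<rho>) \<subseteq> univ M" if "range v \<subseteq> univ M" for v using that by auto
  ultimately have "sat M (with_parameters p v) \<psi> = Q (v \<circ> \<rho>)" if "range v \<subseteq> univ M" for v
    using \<psi>(2) 1(3) that by simp
  then show ?thesis unfolding fo_definable_def using \<psi>(1) 1(2) by blast
qed

lemma fo_definable_ex:
  assumes "fo_definable M Q"
  shows "fo_definable M (\<lambda>v. \<exists>a\<in>univ M. Q (v(i := a)))"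
proof -
  obtain \<phi> p where 1: "wf_formula M \<phi>" "range p \<subseteq> univ M"
    "\<And>v. range v \<subseteq> univ M \<Longrightarrow> sat M (with_parameters p v) \<phi> = Q v"
    using assms unfolding fo_definable_def by blast
  have "(with_parameters p v)(2 * i := a) = with_parameters p (v(i := a))" for v a
    unfolding with_parameters_def by (auto simp: fun_eq_iff)
  moreover have "range (v(i := a)) \<subseteq> univ M" if "range v \<subseteq> univ M" "a \<in> univ M" for v a
    using that by auto
  ultimately have "sat M (with_parameters p v) (Exists (2 * i) \<phi>) = (\<exists>a\<in>univ M. Q (v(i := a)))"
    if "range v \<subseteq> univ M" for v
    using 1(3) that by simp
  then show ?thesis unfolding fo_definable_def using 1(1,2)
    by (intro exI[of _ "Exists (2 * i) \<phi>"] exI[of _ p]) auto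
qed

lemma fo_definable_ex_block:
  assumes "fo_definable M Q"
  shows "fo_definable M (\<lambda>v. \<exists>f. f ` {..<m} \<subseteq> univ M \<and> Q (\<lambda>i. if i < m then f i else v i))"
proof (induction m)
  case 0
  then show ?case using assms by simp
next
  case (Suc m)
  have "fo_definable M (\<lambda>v. \<exists>a\<in>univ M. \<exists>f. f ` {..<m} \<subseteq> univ M \<and> Q (\<lambda>i. if i < m then f i else (v(m := a)) i))"
    using fo_definable_ex[OF Suc, of m] .
  moreover have "(\<exists>a\<in>univ M. \<exists>f. f ` {..<m} \<subseteq> univ M \<and> Q (\<lambda>i. if i < m then f i else (v(m := a)) i)) \<longleftrightarrow>
      (\<exists>f. f ` {..<Suc m} \<subseteq> univ M \<and> Q (\<lambda>i. if i < Suc m then f i else v i))" for v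
  proof
    assume "\<exists>a\<in>univ M. \<exists>f. f ` {..<m} \<subseteq> univ M \<and> Q (\<lambda>i. if i < m then f i else (v(m := a)) i)"
    then obtain a f where *: "a \<in> univ M" "f ` {..<m} \<subseteq> univ M" "Q (\<lambda>i. if i < m then f i else (v(m := a)) i)"
      by blast
    have "(\<lambda>i. if i < m then f i else (v(m := a)) i) = (\<lambda>i. if i < Suc m then (f(m := a)) i else v i)"
      by (auto simp: fun_eq_iff less_Suc_eq)
    then show "\<exists>f. f ` {..<Suc m} \<subseteq> univ M \<and> Q (\<lambda>i. if i < Suc m then f i else v i)"
      using * by (intro exI[of _ "f(m := a)"]) (auto simp: less_Suc_eq)
  next
    assume "\<exists>f. f ` {..<Suc m} \<subseteq> univ M \<and> Q (\<lambda>i. if i < Suc m then f i else v i)"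
    then obtain f where *: "f ` {..<Suc m} \<subseteq> univ M" "Q (\<lambda>i. if i < Suc m then f i else v i)" by blast
    have "(\<lambda>i. if i < m then f i else (v(m := f m)) i) = (\<lambda>i. if i < Suc m then f i else v i)"
      by (auto simp: fun_eq_iff less_Suc_eq)
    then show "\<exists>a\<in>univ M. \<exists>f. f ` {..<m} \<subseteq> univ M \<and> Q (\<lambda>i. if i < m then f i else (v(m := a)) i)"
      using * by (intro bexI[of _ "f m"] exI[of _ f]) auto
  qed
  ultimately show ?case by simp
qed

lemma fo_definable_all_less:
  assumes "\<And>i. i < m \<Longrightarrow> fo_definable M (Q i)" "fo_definable M (\<lambda>v. True)"
  shows "fo_definable M (\<lambda>v. \<forall>i<m::nat. Q i v)"
  using assms
proof (induction m)
  case (Suc m)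
  then have "fo_definable M (\<lambda>v. (\<forall>i<m. Q i v) \<and> Q m v)" by (intro fo_definable_conj) auto
  then show ?case by (rule fo_definable_cong) (auto simp: less_Suc_eq)
qed simp

lemma fo_definable_const:
  assumes "a \<in> univ M"
  shows "fo_definable M (\<lambda>v. v i = a)"
  unfolding fo_definable_def using assms
  by (intro exI[of _ "Eq (Var (2 * i)) (Var 1)"] exI[of _ "\<lambda>_. a"]) (auto simp: with_parameters_def)

lemma definable_over_mono:
  assumes "definable_over M A m D" "A \<subseteq> B"
  shows "definable_over M B m D"
proof -
  obtain \<phi> ps where "wf_formula M \<phi>" "set ps \<subseteq> A" "free_vars \<phi> \<subseteq> {..<m + length ps}"
    "D = {xs \<in> tuples (univ M) m. sat M (\<lambda>i. (xs @ ps) ! i) \<phi>}"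
    using assms(1) unfolding definable_over_def by blast
  then show ?thesis
    unfolding definable_over_def using assms(2) by (intro exI[of _ \<phi>] exI[of _ ps]) auto
qed

lemma fo_definable_of_definable_over:
  assumes D: "definable_over M (univ M) m D" and ne: "univ M \<noteq> {}"
  shows "fo_definable M (\<lambda>v. map v [0..<m] \<in> D)"
proof -
  obtain \<phi> ps where 1: "wf_formula M \<phi>" "set ps \<subseteq> univ M" "free_vars \<phi> \<subseteq> {..<m + length ps}"
    "D = {xs \<in> tuples (univ M) m. sat M (\<lambda>i. (xs @ ps) ! i) \<phi>}"
    using D unfolding definable_over_def by blast
  obtain a where a: "a \<in> univ M" using ne by blast
  define p where "p j = (if j < length ps then ps ! j else a)" for j
  define \<rho> where "\<rho> i = (if i < m then 2 * i else 2 * (i - m) + 1)" for i :: nat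
  obtain \<psi> where \<psi>: "wf_formula M \<psi>" "\<forall>e. sat M e \<psi> = sat M (e \<circ> \<rho>) \<phi>"
    using rename_formula[OF 1(1)] by blast
  have "sat M (with_parameters p v) \<psi> = (map v [0..<m] \<in> D)" if v: "range v \<subseteq> univ M" for v
  proof -
    have "sat M (with_parameters p v \<circ> \<rho>) \<phi> = sat M (\<lambda>i. (map v [0..<m] @ ps) ! i) \<phi>"
    proof (rule sat_cong)
      fix i assume "i \<in> free_vars \<phi>"
      then have "i < m + length ps" using 1(3) by auto
      then show "(with_parameters p v \<circ> \<rho>) i = (map v [0..<m] @ ps) ! i"
        by (auto simp: with_parameters_def \<rho>_def p_def nth_append)
    qed
    moreover have "map v [0..<m] \<in> tuples (univ M) m" using v by (auto simp: tuples_def)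
    ultimately show ?thesis using \<psi>(2) 1(4) by simp
  qed
  moreover have "range p \<subseteq> univ M" using 1(2) a by (auto simp: p_def)
  ultimately show ?thesis unfolding fo_definable_def using \<psi>(1) by blast
qed

text \<open>Only the arguments below \<open>m\<close> matter; all others are redirected to argument 0, and the parameters are
moved behind the \<open>m\<close> coordinates.\<close>
lemma definable_over_of_fo_definable:
  assumes "fo_definable M Q" "m > 0" and cong: "\<And>v v'. (\<And>i. i < m \<Longrightarrow> v i = v' i) \<Longrightarrow> Q v = Q v'"
  shows "definable_over M (univ M) m {xs \<in> tuples (univ M) m. Q ((!) xs)}"
proof -
  obtain \<phi> p where 1: "wf_formula M \<phi>" "range p \<subseteq> univ M"
    "\<And>v. range v \<subseteq> univ M \<Longrightarrow> sat M (with_parameters p v) \<phi> = Q v"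
    using assms unfolding fo_definable_def by blast
  obtain B where B: "\<And>i. i \<in> free_vars \<phi> \<Longrightarrow> i < B"
    using finite_nat_set_iff_bounded finite_free_vars by metis
  define \<rho> where "\<rho> i = (if even i then (if i div 2 < m then i div 2 else 0) else m + i div 2)" for i :: nat
  obtain \<psi> where \<psi>: "wf_formula M \<psi>" "free_vars \<psi> \<subseteq> \<rho> ` free_vars \<phi>" "\<forall>e. sat M e \<psi> = sat M (e \<circ> \<rho>) \<phi>"
    using rename_formula[OF 1(1), of \<rho>] by blast
  define ps where "ps = map p [0..<B]"
  have "sat M (\<lambda>i. (xs @ ps) ! i) \<psi> = Q ((!) xs)" if xs: "xs \<in> tuples (univ M) m" for xs
  proof -
    define v where "v i = (if i < m then xs ! i else xs ! 0)" for i
    have len: "length xs = m" "set xs \<subseteq> univ M" using xs by (auto simp: tuples_def)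
    have "sat M ((\<lambda>i. (xs @ ps) ! i) \<circ> \<rho>) \<phi> = sat M (with_parameters p v) \<phi>"
    proof (rule sat_cong)
      fix i assume "i \<in> free_vars \<phi>"
      then have "i div 2 < B" using B by (meson div_le_dividend le_less_trans)
      then show "((\<lambda>i. (xs @ ps) ! i) \<circ> \<rho>) i = with_parameters p v i"
        using len(1) assms(2) by (auto simp: \<rho>_def with_parameters_def v_def ps_def nth_append)
    qed
    also have "\<dots> = Q v" using len assms(2) by (intro 1(3)) (auto simp: v_def)
    also have "Q v = Q ((!) xs)" by (rule cong) (simp add: v_def)
    finally show ?thesis using \<psi>(3) by simp
  qed
  moreover have "free_vars \<psi> \<subseteq> {..<m + length ps}"
  proof
    fix i assume "i \<in> free_vars \<psi>"
    then obtain j where j: "j \<in> free_vars \<phi>" "i = \<rho> j" using \<psi>(2) by blast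
    have "j div 2 < B" using B[OF j(1)] by (meson div_le_dividend le_less_trans)
    then show "i \<in> {..<m + length ps}" using j(2) assms(2) by (auto simp: \<rho>_def ps_def)
  qed
  moreover have "set ps \<subseteq> univ M" using 1(2) by (auto simp: ps_def)
  ultimately show ?thesis unfolding definable_over_def using \<psi>(1)
    by (intro exI[of _ \<psi>] exI[of _ ps]) auto
qed

lemma fo_definable_true:
  assumes "univ M \<noteq> {}" shows "fo_definable M (\<lambda>v. True)"
proof -
  obtain a where "a \<in> univ M" using assms by blast
  then show ?thesis
    unfolding fo_definable_def by (intro exI[of _ "Eq (Var 0) (Var 0)"] exI[of _ "\<lambda>_. a"]) auto
qed

lemma definable_over_subset: "definable_over M A m D \<Longrightarrow> D \<subseteq> tuples (univ M) m"
  by (auto simp: definable_over_def)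

section \<open>Definable subsets of the ring\<close>
lemma is_subring_add_subgroup: "is_subring S \<Longrightarrow> add_subgroup S"
  by (auto simp: is_subring_def add_subgroup_def)

lemma generated_subring_is_subring: "is_subring (generated_subring X)"
  by (auto simp: is_subring_def generated_subring_def)

lemma generated_subring_superset: "X \<subseteq> generated_subring X"
  by (auto simp: generated_subring_def)

lemma generated_subring_least: "is_subring S \<Longrightarrow> X \<subseteq> S \<Longrightarrow> generated_subring X \<subseteq> S"
  by (auto simp: generated_subring_def)

lemma iter_set_SucI: "x \<in> iter_set X n \<Longrightarrow> y \<in> iter_set X n \<Longrightarrow> u \<in> iter_set X n \<Longrightarrow> v \<in> iter_set X n
    \<Longrightarrow> x * y + (u + v) \<in> iter_set X (Suc n)"
  by (simp only: iter_set.simps) (intro set_plus_intro set_times_intro)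

lemma zero_mem_iter_set: "0 \<in> X \<Longrightarrow> 0 \<in> iter_set X n"
proof (induction n)
  case (Suc n)
  then show ?case using iter_set_SucI[of 0 X n 0 0 0] by simp
qed simp

lemma iter_set_add: "0 \<in> X \<Longrightarrow> x \<in> iter_set X n \<Longrightarrow> y \<in> iter_set X n \<Longrightarrow> x + y \<in> iter_set X (Suc n)"
  using iter_set_SucI[of 0 X n 0 x y] zero_mem_iter_set[of X n] by simp

lemma iter_set_mult: "0 \<in> X \<Longrightarrow> x \<in> iter_set X n \<Longrightarrow> y \<in> iter_set X n \<Longrightarrow> x * y \<in> iter_set X (Suc n)"
  using iter_set_SucI[of x X n y 0 0] zero_mem_iter_set[of X n] by simp

lemma iter_set_mono: "0 \<in> X \<Longrightarrow> m \<le> n \<Longrightarrow> iter_set X m \<subseteq> iter_set X n"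
proof (rule lift_Suc_mono_le[of "iter_set X"])
  fix n assume "0 \<in> X"
  then show "iter_set X n \<subseteq> iter_set X (Suc n)"
    using iter_set_add[of X _ n 0] zero_mem_iter_set[of X n] by auto
qed

lemma iter_set_minus:
  assumes "additively_symmetric X"
  shows "x \<in> iter_set X n \<Longrightarrow> - x \<in> iter_set X n"
proof (induction n arbitrary: x)
  case 0
  then show ?case using assms by (auto simp: additively_symmetric_def)
next
  case (Suc n)
  then obtain a b u v where "a \<in> iter_set X n" "b \<in> iter_set X n" "u \<in> iter_set X n" "v \<in> iter_set X n"
    "x = a * b + (u + v)" by (auto elim!: set_plus_elim set_times_elim)
  then show ?case using iter_set_SucI[of "- a" X n b "- u" "- v"] Suc.IH by simp
qed

text \<open>The sets \<open>X\<^sub>n\<close> increase because \<open>0 \<in> X\<close>, and sums and products of elements of \<open>X\<^sub>n\<close> lie in the next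
one.\<close>
lemma generated_subring_eq_Union:
  assumes "additively_symmetric X"
  shows "generated_subring X = (\<Union>n. iter_set X n)"
proof
  have z: "0 \<in> X" using assms by (simp add: additively_symmetric_def)
  have "is_subring (\<Union>n. iter_set X n)"
    unfolding is_subring_def
  proof (intro conjI ballI)
    show "0 \<in> (\<Union>n. iter_set X n)" using zero_mem_iter_set[OF z] by blast
    fix x y assume "x \<in> (\<Union>n. iter_set X n)" "y \<in> (\<Union>n. iter_set X n)"
    then obtain m l where "x \<in> iter_set X m" "y \<in> iter_set X l" by blast
    then have "x \<in> iter_set X (max m l)" "y \<in> iter_set X (max m l)"
      using iter_set_mono[OF z] by (meson max.cobounded1 max.cobounded2 subsetD)+
    then have "x - y \<in> iter_set X (Suc (max m l))" "x * y \<in> iter_set X (Suc (max m l))"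
      using iter_set_add[OF z, of x _ "- y"] iter_set_mult[OF z] iter_set_minus[OF assms] by auto
    then show "x - y \<in> (\<Union>n. iter_set X n)" "x * y \<in> (\<Union>n. iter_set X n)" by blast+
  qed
  then show "generated_subring X \<subseteq> (\<Union>n. iter_set X n)"
    using generated_subring_least[of "\<Union>n. iter_set X n" X] by (metis UN_upper UNIV_I iter_set.simps(1))
  have "iter_set X n \<subseteq> generated_subring X" for n
  proof (induction n)
    case 0
    then show ?case by (simp add: generated_subring_superset)
  next
    case (Suc n)
    note R = generated_subring_is_subring[of X] is_subring_add_subgroup[OF generated_subring_is_subring[of X]]
    show ?case
    proof
      fix x assume "x \<in> iter_set X (Suc n)"
      then obtain a b u v where "a \<in> iter_set X n" "b \<in> iter_set X n" "u \<in> iter_set X n" "v \<in> iter_set X n"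
        "x = a * b + (u + v)" by (auto elim!: set_plus_elim set_times_elim)
      then show "x \<in> generated_subring X"
        using Suc R add_subgroup_add[OF R(2)] by (auto simp: is_subring_def subset_iff)
    qed
  qed
  then show "(\<Union>n. iter_set X n) \<subseteq> generated_subring X" by blast
qed

text \<open>From here on only the closure properties of the sets \<open>X\<^sub>n\<close> are used.\<close>
declare iter_set.simps(2) [simp del]

locale coded_ring =
  fixes M :: "('f, 'p, 'm) fo_structure" and k :: nat and c :: "'a::ring \<Rightarrow> 'm list" and X :: "'a set"
  assumes fo_structure: "is_fo_structure M"
    and code: "zero_definable M k c X"
    and symmetric: "additively_symmetric X"
    and k_pos: "k > 0"
begin

abbreviation R where "R \<equiv> generated_subring X"

lemma zero_in_X: "0 \<in> X" using symmetric by (simp add: additively_symmetric_def)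

lemma c_inj: "inj_on c R" using code by (simp add: zero_definable_def)

lemma iter_set_subset: "iter_set X n \<subseteq> R"
  using generated_subring_eq_Union[OF symmetric] by blast

lemma c_tuple:
  assumes "x \<in> R" shows "c x \<in> tuples (univ M) k"
proof -
  obtain n where "x \<in> iter_set X n" using assms generated_subring_eq_Union[OF symmetric] by blast
  moreover have "definable_over M {} k (c ` iter_set X n)" using code by (simp add: zero_definable_def)
  ultimately show ?thesis using definable_over_subset by blast
qed

lemma c_eq_iff: "x \<in> R \<Longrightarrow> y \<in> R \<Longrightarrow> c x = c y \<longleftrightarrow> x = y"
  using c_inj by (auto simp: inj_on_def)

lemma length_c: "x \<in> R \<Longrightarrow> length (c x) = k"
  and set_c: "x \<in> R \<Longrightarrow> set (c x) \<subseteq> univ M"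
  using c_tuple by (auto simp: tuples_def)

lemma univ_nonempty: "univ M \<noteq> {}" using fo_structure by (simp add: is_fo_structure_def)

definition def_set :: "'a set \<Rightarrow> bool" where
  "def_set A \<longleftrightarrow> A \<subseteq> R \<and> fo_definable M (\<lambda>v. map v [0..<k] \<in> c ` A)"

text \<open>An assignment \<open>e\<close> of ring elements is coded by an assignment of elements of \<open>M\<close>, in which the variable
\<open>i\<close> occupies the block from \<open>k * i\<close> to \<open>k * i + k - 1\<close>. A predicate is definable on \<open>Z\<close> if it agrees with
a definable predicate of the codes as long as all variables range over \<open>Z\<close>.\<close>
definition flatten :: "(nat \<Rightarrow> 'a) \<Rightarrow> nat \<Rightarrow> 'm" where
  "flatten e i = c (e (i div k)) ! (i mod k)"

definition def_pred :: "'a set \<Rightarrow> ((nat \<Rightarrow> 'a) \<Rightarrow> bool) \<Rightarrow> bool" where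
  "def_pred Z P \<longleftrightarrow> (\<exists>Q. fo_definable M Q \<and> (\<forall>e. range e \<subseteq> Z \<longrightarrow> Q (flatten e) = P e))"

lemma def_set_subset: "def_set A \<Longrightarrow> A \<subseteq> R" by (simp add: def_set_def)

lemma flatten_block: "e i \<in> R \<Longrightarrow> map (\<lambda>o'. flatten e (k * i + o')) [0..<k] = c (e i)"
  using length_c k_pos by (intro nth_equalityI) (auto simp: flatten_def)

lemma def_set_iff_definable_over:
  assumes "A \<subseteq> R"
  shows "def_set A \<longleftrightarrow> definable_over M (univ M) k (c ` A)"
proof
  assume "def_set A"
  then have fd: "fo_definable M (\<lambda>v. map v [0..<k] \<in> c ` A)" by (simp add: def_set_def)
  have "definable_over M (univ M) k {xs \<in> tuples (univ M) k. map ((!) xs) [0..<k] \<in> c ` A}"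
  proof (rule definable_over_of_fo_definable[OF fd k_pos])
    fix v v' :: "nat \<Rightarrow> 'm" assume "\<And>i. i < k \<Longrightarrow> v i = v' i"
    then have "map v [0..<k] = map v' [0..<k]" by (intro map_cong) auto
    then show "(map v [0..<k] \<in> c ` A) = (map v' [0..<k] \<in> c ` A)" by (simp only:)
  qed
  moreover have "{xs \<in> tuples (univ M) k. map ((!) xs) [0..<k] \<in> c ` A} = c ` A"
  proof -
    have "map ((!) xs) [0..<k] = xs" if "xs \<in> tuples (univ M) k" for xs
      using that map_nth[of xs] by (simp add: tuples_def)
    then have "{xs \<in> tuples (univ M) k. map ((!) xs) [0..<k] \<in> c ` A} = tuples (univ M) k \<inter> c ` A"
      by (auto simp del: image_iff)
    moreover have "c ` A \<subseteq> tuples (univ M) k" using c_tuple assms by blast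
    ultimately show ?thesis by blast
  qed
  ultimately show "definable_over M (univ M) k (c ` A)" by simp
next
  assume "definable_over M (univ M) k (c ` A)"
  then show "def_set A" using assms fo_definable_of_definable_over[OF _ univ_nonempty] by (simp add: def_set_def)
qed

lemma def_set_iter_set: "def_set (iter_set X n)"
  using code iter_set_subset definable_over_mono[of M "{}"]
  by (subst def_set_iff_definable_over) (auto simp: zero_definable_def)

lemma def_set_Diff:
  assumes "def_set A" "def_set B" shows "def_set (A - B)"
proof -
  have "fo_definable M (\<lambda>v. map v [0..<k] \<in> c ` A \<and> \<not> map v [0..<k] \<in> c ` B)"
    using assms by (intro fo_definable_conj fo_definable_not) (auto simp: def_set_def)
  moreover have "c ` (A - B) = c ` A - c ` B"
    using inj_on_image_set_diff[OF c_inj, of A B] assms def_set_subset by blast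
  ultimately show ?thesis using assms by (auto simp: def_set_def)
qed

lemma def_set_Int: "def_set A \<Longrightarrow> def_set B \<Longrightarrow> def_set (A \<inter> B)"
  using def_set_Diff[of A "A - B"] def_set_Diff[of A B] by (simp add: Diff_Diff_Int)

lemma def_set_Un:
  assumes "def_set A" "def_set B" shows "def_set (A \<union> B)"
proof -
  have "fo_definable M (\<lambda>v. \<not> (\<not> map v [0..<k] \<in> c ` A \<and> \<not> map v [0..<k] \<in> c ` B))"
    using assms by (intro fo_definable_conj fo_definable_not) (auto simp: def_set_def)
  then show ?thesis using assms by (auto simp: def_set_def image_Un)
qed

lemma def_set_singleton:
  assumes "r \<in> R" shows "def_set {r}"
proof -
  have len: "length (c r) = k" "set (c r) \<subseteq> univ M" using length_c set_c assms by auto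
  have "fo_definable M (\<lambda>v. \<forall>i<k. v i = c r ! i)"
    by (intro fo_definable_all_less fo_definable_const fo_definable_true univ_nonempty) (use len in auto)
  then have "fo_definable M (\<lambda>v. map v [0..<k] \<in> c ` {r})"
    by (rule fo_definable_cong) (use len in \<open>auto simp: list_eq_iff_nth_eq\<close>)
  then show ?thesis using assms by (simp add: def_set_def)
qed

lemma def_pred_cong: "def_pred Z P \<Longrightarrow> (\<And>e. range e \<subseteq> Z \<Longrightarrow> P e = P' e) \<Longrightarrow> def_pred Z P'"
  unfolding def_pred_def by metis

lemma def_pred_not: "def_pred Z P \<Longrightarrow> def_pred Z (\<lambda>e. \<not> P e)"
  unfolding def_pred_def using fo_definable_not by (metis (no_types, lifting))

lemma def_pred_conj:
  assumes "def_pred Z P" "def_pred Z P'" shows "def_pred Z (\<lambda>e. P e \<and> P' e)"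
proof -
  obtain Q Q' where "fo_definable M Q" "\<forall>e. range e \<subseteq> Z \<longrightarrow> Q (flatten e) = P e"
    "fo_definable M Q'" "\<forall>e. range e \<subseteq> Z \<longrightarrow> Q' (flatten e) = P' e"
    using assms unfolding def_pred_def by blast
  then show ?thesis unfolding def_pred_def
    by (intro exI[of _ "\<lambda>v. Q v \<and> Q' v"] conjI fo_definable_conj) auto
qed

lemma def_pred_disj: "def_pred Z P \<Longrightarrow> def_pred Z P' \<Longrightarrow> def_pred Z (\<lambda>e. P e \<or> P' e)"
  by (rule def_pred_cong[OF def_pred_not[OF def_pred_conj[OF def_pred_not def_pred_not]]]) auto

lemma def_pred_rename:
  assumes "def_pred Z P" shows "def_pred Z (\<lambda>e. P (e \<circ> \<sigma>))"
proof -
  obtain Q where Q: "fo_definable M Q" "\<And>e. range e \<subseteq> Z \<Longrightarrow> Q (flatten e) = P e"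
    using assms unfolding def_pred_def by blast
  define \<rho> where "\<rho> i = k * \<sigma> (i div k) + i mod k" for i
  have "flatten e \<circ> \<rho> = flatten (e \<circ> \<sigma>)" for e
    using k_pos by (auto simp: fun_eq_iff flatten_def \<rho>_def)
  moreover have "Q (flatten (e \<circ> \<sigma>)) = P (e \<circ> \<sigma>)" if "range e \<subseteq> Z" for e
    using Q(2)[of "e \<circ> \<sigma>"] that by (auto simp: image_subset_iff)
  ultimately show ?thesis unfolding def_pred_def
    by (intro exI[of _ "\<lambda>v. Q (v \<circ> \<rho>)"]) (simp add: fo_definable_rename[OF Q(1)])
qed

lemma def_pred_mem:
  assumes "def_set A" "Z \<subseteq> R" shows "def_pred Z (\<lambda>e. e i \<in> A)"
proof -
  have "fo_definable M (\<lambda>v. map (v \<circ> (\<lambda>o'. k * i + o')) [0..<k] \<in> c ` A)"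
    using fo_definable_rename assms(1) unfolding def_set_def by blast
  moreover have "map (flatten e \<circ> (\<lambda>o'. k * i + o')) [0..<k] \<in> c ` A \<longleftrightarrow> e i \<in> A" if "range e \<subseteq> Z" for e
  proof -
    have eR: "e i \<in> R" using that assms(2) by blast
    have "map (flatten e \<circ> (\<lambda>o'. k * i + o')) [0..<k] = c (e i)"
      using flatten_block[of e i, OF eR] by (simp add: o_def)
    then show ?thesis using inj_on_image_mem_iff[OF c_inj eR def_set_subset[OF assms(1)]] by simp
  qed
  ultimately show ?thesis unfolding def_pred_def by blast
qed

lemma def_pred_graph:
  assumes "definable_over M (univ M) (3 * k) {c x @ c y @ c (f x y) | x y. x \<in> Z' \<and> y \<in> Z'}"
    and Z: "Z \<subseteq> Z'" "Z' \<subseteq> R" "\<And>x y. x \<in> R \<Longrightarrow> y \<in> R \<Longrightarrow> f x y \<in> R"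
  shows "def_pred Z (\<lambda>e. f (e i) (e j) = e l)"
proof -
  let ?D = "{c x @ c y @ c (f x y) | x y. x \<in> Z' \<and> y \<in> Z'}"
  define \<rho> where "\<rho> w = (if w < k then k * i + w else if w < 2 * k then k * j + (w - k) else k * l + (w - 2 * k))" for w
  have "fo_definable M (\<lambda>v. map (v \<circ> \<rho>) [0..<3 * k] \<in> ?D)"
    using fo_definable_rename[OF fo_definable_of_definable_over[OF assms(1) univ_nonempty]] .
  moreover have "map (flatten e \<circ> \<rho>) [0..<3 * k] \<in> ?D \<longleftrightarrow> f (e i) (e j) = e l" if "range e \<subseteq> Z" for e
  proof -
    have e: "e w \<in> Z'" "e w \<in> R" for w using that Z by auto
    have flat: "flatten e (k * b + w) = c (e b) ! w" if "w < k" for b w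
      using that by (simp add: flatten_def)
    have len: "length (c (e b)) = k" for b using length_c e(2) by blast
    have nth: "flatten e (\<rho> w) = (c (e i) @ c (e j) @ c (e l)) ! w" if "w < 3 * k" for w
    proof -
      consider "w < k" | "k \<le> w" "w < 2 * k" | "2 * k \<le> w" by linarith
      then show ?thesis
      proof cases
        case 1
        then show ?thesis using flat[of w i] by (simp add: \<rho>_def len nth_append)
      next
        case 2
        then have "flatten e (\<rho> w) = c (e j) ! (w - k)" using flat[of "w - k" j] by (simp add: \<rho>_def)
        moreover have "w - k < k" using 2 by linarith
        ultimately show ?thesis using 2 by (simp add: len nth_append)
      next
        case 3
        then have "flatten e (\<rho> w) = c (e l) ! (w - 2 * k)"
          using flat[of "w - 2 * k" l] that by (simp add: \<rho>_def)
        moreover have "w - k - k = w - 2 * k" "\<not> w - k < k" using 3 k_pos by linarith+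
        ultimately show ?thesis using 3 by (simp add: len nth_append)
      qed
    qed
    have "map (flatten e \<circ> \<rho>) [0..<3 * k] = c (e i) @ c (e j) @ c (e l)"
      using nth by (intro nth_equalityI) (auto simp: len)
    moreover have "c (e i) @ c (e j) @ c (e l) \<in> ?D \<longleftrightarrow> f (e i) (e j) = e l"
    proof
      assume "c (e i) @ c (e j) @ c (e l) \<in> ?D"
      then obtain x y where xy: "x \<in> Z'" "y \<in> Z'" "c (e i) @ c (e j) @ c (e l) = c x @ c y @ c (f x y)" by blast
      have xyR: "x \<in> R" "y \<in> R" "f x y \<in> R" using xy(1,2) Z(2,3) by auto
      have "c (e i) = c x" "c (e j) = c y" "c (e l) = c (f x y)"
        using xy(3) length_c[OF xyR(1)] length_c[OF xyR(2)] length_c[OF e(2)] by auto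
      then show "f (e i) (e j) = e l" using c_eq_iff xyR e(2) by metis
    next
      assume "f (e i) (e j) = e l"
      then show "c (e i) @ c (e j) @ c (e l) \<in> ?D"
        using e(1)[of i] e(1)[of j] by (intro CollectI exI[of _ "e i"] exI[of _ "e j"]) simp
    qed
    ultimately show ?thesis by simp
  qed
  ultimately show ?thesis unfolding def_pred_def by blast
qed

lemma R_closed: "x \<in> R \<Longrightarrow> y \<in> R \<Longrightarrow> x + y \<in> R" "x \<in> R \<Longrightarrow> y \<in> R \<Longrightarrow> x * y \<in> R"
    "x \<in> R \<Longrightarrow> y \<in> R \<Longrightarrow> x - y \<in> R" "0 \<in> R"
  using generated_subring_is_subring[of X] add_subgroup_add[OF is_subring_add_subgroup[OF generated_subring_is_subring[of X]]]
  by (auto simp: is_subring_def)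

lemma def_pred_add:
  assumes "Z \<subseteq> iter_set X n" shows "def_pred Z (\<lambda>e. e i + e j = e l)"
proof (rule def_pred_graph[OF _ assms iter_set_subset])
  show "definable_over M (univ M) (3 * k) {c x @ c y @ c (x + y) | x y. x \<in> iter_set X n \<and> y \<in> iter_set X n}"
    using code definable_over_mono[of M "{}"] by (auto simp: zero_definable_def)
qed (rule R_closed)

lemma def_pred_mult:
  assumes "Z \<subseteq> iter_set X n" shows "def_pred Z (\<lambda>e. e i * e j = e l)"
proof (rule def_pred_graph[OF _ assms iter_set_subset])
  show "definable_over M (univ M) (3 * k) {c x @ c y @ c (x * y) | x y. x \<in> iter_set X n \<and> y \<in> iter_set X n}"
    using code definable_over_mono[of M "{}"] by (auto simp: zero_definable_def)
qed (rule R_closed)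

text \<open>Quantifying over \<open>Z\<close> means quantifying over the first block and requiring that it codes an element of
\<open>Z\<close>. The quantified element becomes variable 0, and the others move up by one.\<close>
lemma def_pred_ex:
  assumes Z: "def_set Z" and P: "def_pred Z P"
  shows "def_pred Z (\<lambda>e. \<exists>x\<in>Z. P (case_nat x e))"
proof -
  obtain Q where Q: "fo_definable M Q" "\<And>e. range e \<subseteq> Z \<Longrightarrow> Q (flatten e) = P e"
    using P unfolding def_pred_def by blast
  have ZR: "Z \<subseteq> R" using def_set_subset[OF Z] .
  define Q' where "Q' v \<longleftrightarrow> map v [0..<k] \<in> c ` Z \<and> Q v" for v
  have Q': "fo_definable M Q'" unfolding Q'_def using Z Q(1) by (intro fo_definable_conj) (auto simp: def_set_def)
  define Q'' where "Q'' v \<longleftrightarrow> (\<exists>f. f ` {..<k} \<subseteq> univ M \<and> Q' (\<lambda>i. if i < k then f i else v i))" for v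
  have Q'': "fo_definable M Q''" unfolding Q''_def by (rule fo_definable_ex_block[OF Q'])
  have main: "Q'' (flatten e) = (\<exists>x\<in>Z. P (case_nat x (e \<circ> Suc)))" if e: "range e \<subseteq> Z" for e
  proof -
    have upd: "(\<lambda>i. if i < k then c x ! i else flatten e i) = flatten (case_nat x (e \<circ> Suc))" for x
    proof
      fix i
      show "(if i < k then c x ! i else flatten e i) = flatten (case_nat x (e \<circ> Suc)) i"
        using k_pos by (auto simp: flatten_def div_eq_0_iff split: nat.split)
    qed
    have rng: "range (case_nat x (e \<circ> Suc)) \<subseteq> Z" if "x \<in> Z" for x
      using e that by (auto split: nat.split)
    have mapc: "map (\<lambda>i. if i < k then c x ! i else flatten e i) [0..<k] = c x" if "x \<in> Z" for x
      using that ZR length_c by (intro nth_equalityI) auto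
    show ?thesis
    proof
      assume "Q'' (flatten e)"
      then obtain f where f: "f ` {..<k} \<subseteq> univ M" "Q' (\<lambda>i. if i < k then f i else flatten e i)"
        unfolding Q''_def by blast
      then obtain x where x: "x \<in> Z" "map (\<lambda>i. if i < k then f i else flatten e i) [0..<k] = c x"
        unfolding Q'_def by auto
      have "f i = c x ! i" if "i < k" for i
        using arg_cong[OF x(2), of "\<lambda>xs. xs ! i"] that by simp
      then have "(\<lambda>i. if i < k then f i else flatten e i) = (\<lambda>i. if i < k then c x ! i else flatten e i)"
        by auto
      then have "Q (flatten (case_nat x (e \<circ> Suc)))" using f(2) upd unfolding Q'_def by simp
      then show "\<exists>x\<in>Z. P (case_nat x (e \<circ> Suc))" using Q(2)[OF rng[OF x(1)]] x(1) by blast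
    next
      assume "\<exists>x\<in>Z. P (case_nat x (e \<circ> Suc))"
      then obtain x where x: "x \<in> Z" "P (case_nat x (e \<circ> Suc))" by blast
      have "Q (\<lambda>i. if i < k then c x ! i else flatten e i)" using Q(2)[OF rng[OF x(1)]] x(2) upd by simp
      then have "Q' (\<lambda>i. if i < k then c x ! i else flatten e i)"
        unfolding Q'_def using mapc[OF x(1)] x(1) by auto
      moreover have "(\<lambda>i. c x ! i) ` {..<k} \<subseteq> univ M" using x(1) ZR length_c set_c by fastforce
      ultimately show "Q'' (flatten e)" unfolding Q''_def by (intro exI[of _ "\<lambda>i. c x ! i"]) auto
    qed
  qed
  then have "def_pred Z (\<lambda>e. \<exists>x\<in>Z. P (case_nat x (e \<circ> Suc)))" unfolding def_pred_def using Q'' by blast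
  \<comment> \<open>The variable 0 of \<open>e\<close> is overwritten above; the renaming makes the remaining ones start at 0.\<close>
  from def_pred_rename[OF this, of "\<lambda>i. i - 1"] show ?thesis by (simp add: o_def)
qed

lemma def_pred_all:
  assumes Z: "def_set Z" and P: "def_pred Z P"
  shows "def_pred Z (\<lambda>e. \<forall>x\<in>Z. P (case_nat x e))"
  by (rule def_pred_cong[OF def_pred_not[OF def_pred_ex[OF Z def_pred_not[OF P]]]]) auto

lemma def_pred_true: "Z \<subseteq> R \<Longrightarrow> def_pred Z (\<lambda>e. True)"
  by (rule def_pred_cong[OF def_pred_disj[OF def_pred_mem[OF def_set_iter_set] def_pred_not[OF def_pred_mem[OF def_set_iter_set]]]]) auto

lemma def_pred_all_finite:
  assumes "finite I" "\<And>i. i \<in> I \<Longrightarrow> def_pred Z (P i)" "Z \<subseteq> R"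
  shows "def_pred Z (\<lambda>e. \<forall>i\<in>I. P i e)"
  using assms(1,2)
proof (induction I rule: finite_induct)
  case empty
  then show ?case using def_pred_true[OF assms(3)] by simp
next
  case (insert i I)
  then have "def_pred Z (\<lambda>e. P i e \<and> (\<forall>i\<in>I. P i e))" by (intro def_pred_conj) auto
  then show ?case by simp
qed

lemma def_pred_ex_finite:
  assumes "finite I" "\<And>i. i \<in> I \<Longrightarrow> def_pred Z (P i)" "Z \<subseteq> R"
  shows "def_pred Z (\<lambda>e. \<exists>i\<in>I. P i e)"
  by (rule def_pred_cong[OF def_pred_not[OF def_pred_all_finite[OF assms(1) def_pred_not[OF assms(2)] assms(3)]]]) auto

lemma def_pred_subst:
  assumes "def_set Z" "z \<in> Z" "def_pred Z P"
  shows "def_pred Z (\<lambda>e. P (case_nat z e))"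
proof -
  have "def_pred Z (\<lambda>e. \<exists>x\<in>Z. case_nat x e 0 \<in> {z} \<and> P (case_nat x e))"
    by (intro def_pred_ex def_pred_conj def_pred_mem def_set_singleton assms) (use assms def_set_subset in auto)
  then show ?thesis by (rule def_pred_cong) (use assms(2) in auto)
qed

text \<open>All variables are given the same value, whichever of them \<open>P\<close> refers to.\<close>
lemma def_set_of_def_pred:
  assumes Z: "def_set Z" and P: "def_pred Z P"
  shows "def_set {x \<in> Z. P (\<lambda>_. x)}"
proof -
  obtain Q where Q: "fo_definable M Q" "\<And>e. range e \<subseteq> Z \<Longrightarrow> Q (flatten e) = P e"
    using P unfolding def_pred_def by blast
  have ZR: "Z \<subseteq> R" using def_set_subset[OF Z] .
  have "fo_definable M (\<lambda>v. map v [0..<k] \<in> c ` Z \<and> Q (v \<circ> (\<lambda>i. i mod k)))"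
    using Z fo_definable_rename[OF Q(1)] by (intro fo_definable_conj) (auto simp: def_set_def)
  moreover have "(map v [0..<k] \<in> c ` Z \<and> Q (v \<circ> (\<lambda>i. i mod k))) = (map v [0..<k] \<in> c ` {x \<in> Z. P (\<lambda>_. x)})" for v
  proof -
    have "Q (v \<circ> (\<lambda>i. i mod k)) = P (\<lambda>_. x)" if "x \<in> Z" "map v [0..<k] = c x" for x
    proof -
      have "v i = c x ! i" if "i < k" for i
        using arg_cong[OF \<open>map v [0..<k] = c x\<close>, of "\<lambda>xs. xs ! i"] that by simp
      then have "v \<circ> (\<lambda>i. i mod k) = flatten (\<lambda>_. x)" using k_pos by (auto simp: fun_eq_iff flatten_def)
      then show ?thesis using Q(2)[of "\<lambda>_. x"] that(1) by simp
    qed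
    then show ?thesis by blast
  qed
  ultimately have "fo_definable M (\<lambda>v. map v [0..<k] \<in> c ` {x \<in> Z. P (\<lambda>_. x)})" by simp
  then show ?thesis using ZR by (auto simp: def_set_def)
qed

lemma def_set_bounded:
  assumes "finite F" "F \<subseteq> R"
  obtains n where "F \<subseteq> iter_set X n"
proof -
  have "\<exists>n. F \<subseteq> iter_set X n"
    using assms
  proof (induction F rule: finite_induct)
    case (insert x F)
    then obtain n where n: "F \<subseteq> iter_set X n" by auto
    obtain m where "x \<in> iter_set X m" using insert.prems generated_subring_eq_Union[OF symmetric] by auto
    then have "insert x F \<subseteq> iter_set X (max m n)"
      using n iter_set_mono[OF zero_in_X, of m "max m n"] iter_set_mono[OF zero_in_X, of n "max m n"] by auto
    then show ?case by blast
  qed simp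
  then show ?thesis using that by blast
qed

text \<open>Addition is definable on each \<open>X\<^sub>n\<close> only, so \<open>A\<close> must be contained in one of them; the quantifiers
range over a later one that contains the translate as well.\<close>
lemma def_set_translate:
  assumes A: "def_set A" "A \<subseteq> iter_set X n" and r: "r \<in> R"
  shows "def_set ((+) r ` A)"
proof -
  obtain m where m: "{r} \<subseteq> iter_set X m" using def_set_bounded[of "{r}"] r by auto
  define Z where "Z = iter_set X (Suc (max m n))"
  have sub: "iter_set X m \<subseteq> iter_set X (max m n)" "iter_set X n \<subseteq> iter_set X (max m n)"
      "iter_set X (max m n) \<subseteq> Z"
    unfolding Z_def by (rule iter_set_mono[OF zero_in_X], arith)+
  have mem: "r \<in> iter_set X (max m n)" "A \<subseteq> iter_set X (max m n)" using m A(2) sub by auto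
  have rZ: "r \<in> Z" "A \<subseteq> Z" "(+) r ` A \<subseteq> Z"
    using mem sub(3) iter_set_add[OF zero_in_X mem(1) subsetD[OF mem(2)]] unfolding Z_def by auto
  have Z: "def_set Z" "Z \<subseteq> R" unfolding Z_def using def_set_iter_set iter_set_subset by auto
  have "def_pred Z (\<lambda>e. \<exists>a\<in>Z. case_nat r (case_nat a e) 1 \<in> A \<and> case_nat r (case_nat a e) 0 + case_nat r (case_nat a e) 1 = case_nat r (case_nat a e) 2)"
    by (intro def_pred_ex[OF Z(1)] def_pred_subst[OF Z(1) rZ(1), where P = "\<lambda>e. e 1 \<in> A \<and> e 0 + e 1 = e 2"]
        def_pred_conj def_pred_mem[OF A(1) Z(2)] def_pred_add[of Z "Suc (max m n)"]) (simp add: Z_def)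
  from def_set_of_def_pred[OF Z(1) this]
  have "def_set {x \<in> Z. \<exists>a\<in>Z. a \<in> A \<and> r + a = x}" by (simp add: numeral_2_eq_2)
  also have "{x \<in> Z. \<exists>a\<in>Z. a \<in> A \<and> r + a = x} = (+) r ` A" using rZ by auto
  finally show ?thesis .
qed

lemma def_set_left_mult_preimage:
  assumes A: "def_set A" "A \<subseteq> iter_set X n" and B: "def_set B" and r: "r \<in> R"
  shows "def_set {u \<in> A. r * u \<in> B}"
proof -
  obtain m where m: "{r} \<subseteq> iter_set X m" using def_set_bounded[of "{r}"] r by auto
  define Z where "Z = iter_set X (Suc (max m n))"
  have sub: "iter_set X m \<subseteq> iter_set X (max m n)" "iter_set X n \<subseteq> iter_set X (max m n)"
      "iter_set X (max m n) \<subseteq> Z"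
    unfolding Z_def by (rule iter_set_mono[OF zero_in_X], arith)+
  have mem: "r \<in> iter_set X (max m n)" "A \<subseteq> iter_set X (max m n)" using m A(2) sub by auto
  have rZ: "r \<in> Z" "A \<subseteq> Z" "\<And>u. u \<in> A \<Longrightarrow> r * u \<in> Z"
    using mem sub(3) iter_set_mult[OF zero_in_X mem(1) subsetD[OF mem(2)]] unfolding Z_def by auto
  have Z: "def_set Z" "Z \<subseteq> R" unfolding Z_def using def_set_iter_set iter_set_subset by auto
  have "def_pred Z (\<lambda>e. \<exists>b\<in>Z. case_nat r (case_nat b e) 1 \<in> B \<and> case_nat r (case_nat b e) 0 * case_nat r (case_nat b e) 2 = case_nat r (case_nat b e) 1)"
    by (intro def_pred_ex[OF Z(1)] def_pred_subst[OF Z(1) rZ(1), where P = "\<lambda>e. e 1 \<in> B \<and> e 0 * e 2 = e 1"]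
        def_pred_conj def_pred_mem[OF B Z(2)] def_pred_mult[of Z "Suc (max m n)"]) (simp add: Z_def)
  from def_set_of_def_pred[OF Z(1) this]
  have "def_set {x \<in> Z. \<exists>b\<in>Z. b \<in> B \<and> r * x = b}" by (simp add: numeral_2_eq_2)
  from def_set_Int[OF A(1) this] have "def_set (A \<inter> {x \<in> Z. \<exists>b\<in>Z. b \<in> B \<and> r * x = b})" .
  also have "A \<inter> {x \<in> Z. \<exists>b\<in>Z. b \<in> B \<and> r * x = b} = {u \<in> A. r * u \<in> B}" using rZ by auto
  finally show ?thesis .
qed

lemma def_set_sumset:
  assumes A: "def_set A" "A \<subseteq> iter_set X n" and B: "def_set B" "B \<subseteq> iter_set X n"
  shows "def_set (A + B)"
proof -
  define Z where "Z = iter_set X (Suc n)"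
  have "iter_set X n \<subseteq> Z" unfolding Z_def by (simp add: iter_set_mono[OF zero_in_X])
  then have sub: "A \<subseteq> Z" "B \<subseteq> Z" using A(2) B(2) by auto
  have sum: "a + b \<in> Z" if "a \<in> A" "b \<in> B" for a b
    using iter_set_add[OF zero_in_X, of a n b] A(2) B(2) that unfolding Z_def by blast
  have Z: "def_set Z" "Z \<subseteq> R" unfolding Z_def using def_set_iter_set iter_set_subset by auto
  have "def_pred Z (\<lambda>e. \<exists>a\<in>Z. \<exists>b\<in>Z. case_nat b (case_nat a e) 1 \<in> A \<and> case_nat b (case_nat a e) 0 \<in> B \<and>
      case_nat b (case_nat a e) 1 + case_nat b (case_nat a e) 0 = case_nat b (case_nat a e) 2)"
    by (intro def_pred_ex[OF Z(1), where P = "\<lambda>e. \<exists>b\<in>Z. case_nat b e 1 \<in> A \<and> case_nat b e 0 \<in> B \<and> case_nat b e 1 + case_nat b e 0 = case_nat b e 2"]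
        def_pred_ex[OF Z(1), where P = "\<lambda>e. e 1 \<in> A \<and> e 0 \<in> B \<and> e 1 + e 0 = e 2"]
        def_pred_conj def_pred_mem[OF A(1) Z(2)] def_pred_mem[OF B(1) Z(2)] def_pred_add[of Z "Suc n"]) (simp add: Z_def)
  from def_set_of_def_pred[OF Z(1) this]
  have "def_set {x \<in> Z. \<exists>a\<in>Z. \<exists>b\<in>Z. a \<in> A \<and> b \<in> B \<and> a + b = x}" by (simp add: numeral_2_eq_2)
  also have "{x \<in> Z. \<exists>a\<in>Z. \<exists>b\<in>Z. a \<in> A \<and> b \<in> B \<and> a + b = x} = A + B"
    using sub sum by (auto simp: set_plus_def)
  finally show ?thesis .
qed

end

section \<open>Definable subgroups in fourfold sums\<close>
locale coded_group = coded_ring M k c X + bounded_exponent_group Y n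
  for M :: "('f, 'p, 'm) fo_structure" and k :: nat and c :: "'a::ring \<Rightarrow> 'm list" and X :: "'a set"
    and Y :: "'a set" and n :: nat +
  fixes m :: nat
  assumes group_definable: "def_set Y"
    and group_bounded: "Y \<subseteq> iter_set X m"
begin

lemma group_in_ring: "Y \<subseteq> R" using def_set_subset[OF group_definable] .

text \<open>Sets depending on ring elements in a definable way: variable 0 is the potential member, the others
are the arguments.\<close>
definition definable_family :: "((nat \<Rightarrow> 'a) \<Rightarrow> 'a set) \<Rightarrow> bool" where
  "definable_family \<A> \<longleftrightarrow> (\<forall>e. range e \<subseteq> Y \<longrightarrow> \<A> e \<subseteq> Y) \<and> def_pred Y (\<lambda>e. e 0 \<in> \<A> (e \<circ> Suc))"

lemma definable_family_mem:
  assumes "definable_family \<A>"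
  shows "def_pred Y (\<lambda>e. e i \<in> \<A> (e \<circ> \<tau>))"
proof -
  have "def_pred Y (\<lambda>e. (e \<circ> case_nat i \<tau>) 0 \<in> \<A> ((e \<circ> case_nat i \<tau>) \<circ> Suc))"
    using assms def_pred_rename[of Y "\<lambda>e. e 0 \<in> \<A> (e \<circ> Suc)" "case_nat i \<tau>"]
    by (simp add: definable_family_def)
  then show ?thesis by (simp add: o_def)
qed

text \<open>A list of \<open>r\<close> elements becomes the variables below \<open>r\<close>, which takes \<open>r\<close> successive quantifiers.\<close>
lemma def_pred_all_lists:
  assumes "def_pred Y Q"
  shows "def_pred Y (\<lambda>e. \<forall>ts. length ts = r \<and> set ts \<subseteq> Y \<longrightarrow> Q (\<lambda>i. if i < r then ts ! i else e (i - r)))"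
  using assms
proof (induction r arbitrary: Q)
  case 0
  then show ?case by simp
next
  case (Suc r)
  have shift: "(\<lambda>i. if i < Suc r then (t # ts) ! i else e (i - Suc r))
      = case_nat t (\<lambda>i. if i < r then ts ! i else e (i - r))" for t ts e
    by (auto simp: fun_eq_iff split: nat.split)
  have "def_pred Y (\<lambda>e. \<forall>ts. length ts = r \<and> set ts \<subseteq> Y \<longrightarrow>
      (\<forall>t\<in>Y. Q (case_nat t (\<lambda>i. if i < r then ts ! i else e (i - r)))))"
    by (rule Suc.IH[OF def_pred_all[OF group_definable Suc.prems]])
  moreover have "(\<forall>ts. length ts = r \<and> set ts \<subseteq> Y \<longrightarrow>
      (\<forall>t\<in>Y. Q (case_nat t (\<lambda>i. if i < r then ts ! i else e (i - r))))) \<longleftrightarrow>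
    (\<forall>ts. length ts = Suc r \<and> set ts \<subseteq> Y \<longrightarrow> Q (\<lambda>i. if i < Suc r then ts ! i else e (i - Suc r)))"
    (is "?l \<longleftrightarrow> ?r") for e
  proof
    assume l: ?l
    show ?r
    proof (intro allI impI)
      fix ts assume ts: "length ts = Suc r \<and> set ts \<subseteq> Y"
      then obtain t ts' where "ts = t # ts'" by (cases ts) auto
      then show "Q (\<lambda>i. if i < Suc r then ts ! i else e (i - Suc r))" using l ts by (simp only: shift) auto
    qed
  next
    assume r: ?r
    show ?l
    proof (intro allI impI ballI)
      fix ts t assume "length ts = r \<and> set ts \<subseteq> Y" "t \<in> Y"
      then show "Q (case_nat t (\<lambda>i. if i < r then ts ! i else e (i - r)))"
        using r[rule_format, of "t # ts"] by (simp only: shift) auto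
    qed
  qed
  ultimately show ?case by simp
qed

text \<open>Unfold the recursion of \<open>wide\<close>. At level 0 the cardinality condition says that one of finitely many
subsets of \<open>G\<close>, translated by some \<open>x\<close>, is contained in the set. At level \<open>Suc j\<close> the list \<open>ts\<close> occupies
the first \<open>r\<close> variables, and the intersections of the set with its translates form definable
families again.\<close>
lemma def_pred_wide:
  assumes G: "fin_subgroup G"
  shows "definable_family \<A> \<Longrightarrow> def_pred Y (\<lambda>e. wide G q r j (\<A> e))"
proof (induction j arbitrary: \<A>)
  case 0
  note fin = finite_subgroup_ofD(1)[OF G] and GY = finite_subgroup_ofD(3)[OF G]
  have shift: "def_pred Y (\<lambda>e. e 0 + g \<in> \<A> (e \<circ> Suc))" if g: "g \<in> G" for g
  proof -
    have "def_pred Y (\<lambda>e. \<exists>y\<in>Y. case_nat y e 0 \<in> \<A> (case_nat y e \<circ> (\<lambda>i. Suc (Suc i))) \<and>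
        case_nat g (case_nat y e) 2 + case_nat g (case_nat y e) 0 = case_nat g (case_nat y e) 1)"
      by (intro def_pred_ex[OF group_definable, where P = "\<lambda>e. e 0 \<in> \<A> (e \<circ> (\<lambda>i. Suc (Suc i))) \<and>
            case_nat g e 2 + case_nat g e 0 = case_nat g e 1"] def_pred_conj
          definable_family_mem 0 def_pred_subst[OF group_definable, where P = "\<lambda>e. e 2 + e 0 = e 1"]
          def_pred_add[OF group_bounded]) (use g GY in auto)
    then show ?thesis
      by (rule def_pred_cong) (use 0 in \<open>auto simp: o_def numeral_2_eq_2 definable_family_def image_subset_iff\<close>)
  qed
  have "def_pred Y (\<lambda>e. \<exists>S\<in>{S. S \<subseteq> G \<and> q \<le> card S}. \<forall>g\<in>S. e 0 + g \<in> \<A> (e \<circ> Suc))"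
    by (intro def_pred_ex_finite def_pred_all_finite shift group_in_ring) (use fin in \<open>auto intro: finite_subset\<close>)
  from def_pred_ex[OF group_definable this]
  have "def_pred Y (\<lambda>e. \<exists>x\<in>Y. \<exists>S\<in>{S. S \<subseteq> G \<and> q \<le> card S}. \<forall>g\<in>S. x + g \<in> \<A> e)" by (simp add: o_def)
  moreover have "(\<exists>S\<in>{S. S \<subseteq> G \<and> q \<le> card S}. \<forall>g\<in>S. x + g \<in> A) \<longleftrightarrow> q \<le> card (A \<inter> (+) x ` G)" for x A
  proof -
    have eq: "card (A \<inter> (+) x ` G) = card {g \<in> G. x + g \<in> A}"
    proof -
      have "A \<inter> (+) x ` G = (+) x ` {g \<in> G. x + g \<in> A}" by auto
      then show ?thesis by (simp add: card_image)
    qed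
    have "card S \<le> card {g \<in> G. x + g \<in> A}" if "S \<subseteq> G" "\<forall>g\<in>S. x + g \<in> A" for S
      using that fin by (intro card_mono) auto
    then show ?thesis unfolding eq by (force intro: exI[of _ "{g \<in> G. x + g \<in> A}"])
  qed
  ultimately show ?case by simp
next
  case (Suc j)
  define \<B> where "\<B> i l e = (let A = \<A> (\<lambda>w. e (w + r)) in A \<inter> (+) (e l - e i) ` A)" for i l :: nat and e
  have "definable_family (\<B> i l)" for i l
    unfolding definable_family_def
  proof (intro conjI allI impI)
    fix e :: "nat \<Rightarrow> 'a" assume "range e \<subseteq> Y"
    then have "range (\<lambda>w. e (w + r)) \<subseteq> Y" by auto
    then show "\<B> i l e \<subseteq> Y" using Suc.prems by (auto simp: \<B>_def Let_def definable_family_def)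
  next
    \<comment> \<open>The variables are \<open>u\<close>, \<open>z\<close>, the potential member, \<open>ts\<close> and the arguments of \<open>\<A>\<close>, in this order.\<close>
    let ?P = "\<lambda>e. e 1 \<in> \<A> (e \<circ> (\<lambda>w. w + r + 3)) \<and> e 1 + e (l + 3) = e 0 \<and> e 2 + e (i + 3) = e (0::nat)"
    have "def_pred Y (\<lambda>e. e 0 \<in> \<A> (e \<circ> (\<lambda>w. w + r + 1)) \<and> (\<exists>z\<in>Y. \<exists>u\<in>Y. ?P (case_nat u (case_nat z e))))"
      by (intro def_pred_conj def_pred_ex[OF group_definable, where P = "\<lambda>e. \<exists>u\<in>Y. ?P (case_nat u e)"]
          def_pred_ex[OF group_definable, where P = ?P] definable_family_mem Suc.prems def_pred_add[OF group_bounded])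
    then show "def_pred Y (\<lambda>e. e 0 \<in> \<B> i l (e \<circ> Suc))"
    proof (rule def_pred_cong)
      fix e :: "nat \<Rightarrow> 'a" assume e: "range e \<subseteq> Y"
      define A where "A = \<A> (\<lambda>w. e (w + r + 1))"
      have "range (\<lambda>w. e (w + r + 1)) \<subseteq> Y" using e by auto
      then have AY: "A \<subseteq> Y" using Suc.prems unfolding A_def definable_family_def by blast
      have "(\<exists>z\<in>Y. \<exists>u\<in>Y. ?P (case_nat u (case_nat z e))) \<longleftrightarrow>
          (\<exists>z\<in>Y. \<exists>u\<in>Y. z \<in> A \<and> z + e (Suc l) = u \<and> e 0 + e (Suc i) = u)"
        by (simp add: A_def o_def numeral_2_eq_2 numeral_3_eq_3)
      also have "\<dots> \<longleftrightarrow> (\<exists>z\<in>A. z + e (Suc l) = e 0 + e (Suc i))"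
        using AY add_subgroup_add[OF subgroup] e by (auto simp: image_subset_iff)
      also have "\<dots> \<longleftrightarrow> e 0 \<in> (+) (e (Suc l) - e (Suc i)) ` A"
      proof -
        have "z + e (Suc l) = e 0 + e (Suc i) \<longleftrightarrow> e 0 = (e (Suc l) - e (Suc i)) + z" for z
          by (auto simp: algebra_simps)
        then show ?thesis by (simp only: image_iff)
      qed
      finally show "(e 0 \<in> \<A> (e \<circ> (\<lambda>w. w + r + 1)) \<and> (\<exists>z\<in>Y. \<exists>u\<in>Y. ?P (case_nat u (case_nat z e))))
          = (e 0 \<in> \<B> i l (e \<circ> Suc))"
        by (simp add: \<B>_def Let_def A_def o_def)
    qed
  qed
  then have "def_pred Y (\<lambda>e. wide G q r j (\<B> (fst il) (snd il) e))" for il by (rule Suc.IH)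
  then have "def_pred Y (\<lambda>e. \<exists>il\<in>{il. fst il < snd il \<and> snd il < r}. wide G q r j (\<B> (fst il) (snd il) e))"
    by (intro def_pred_ex_finite group_in_ring)
      (auto intro: finite_subset[of _ "{..<r} \<times> {..<r}"])
  from def_pred_all_lists[OF this, of r]
  show ?case
  proof (rule def_pred_cong)
    fix e :: "nat \<Rightarrow> 'a" assume "range e \<subseteq> Y"
    have B: "\<B> i l (\<lambda>i. if i < r then ts ! i else e (i - r)) = \<A> e \<inter> (+) (ts ! l - ts ! i) ` \<A> e"
      if "i < r" "l < r" for i l ts
      using that by (simp add: \<B>_def Let_def)
    have "(\<exists>il\<in>{il. fst il < snd il \<and> snd il < r}. wide G q r j (\<B> (fst il) (snd il) (\<lambda>i. if i < r then ts ! i else e (i - r))))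
      \<longleftrightarrow> (\<exists>i l. i < l \<and> l < r \<and> wide G q r j (\<A> e \<inter> (+) (ts ! l - ts ! i) ` \<A> e))" for ts
      using B by (auto simp del: One_nat_def intro!: exI)
    then show "(\<forall>ts. length ts = r \<and> set ts \<subseteq> Y \<longrightarrow>
        (\<exists>il\<in>{il. fst il < snd il \<and> snd il < r}. wide G q r j (\<B> (fst il) (snd il) (\<lambda>i. if i < r then ts ! i else e (i - r)))))
      = wide G q r (Suc j) (\<A> e)" by simp
  qed
qed

lemma def_set_wide:
  assumes "def_set A" "A \<subseteq> Y" "fin_subgroup G"
  shows "def_set {t \<in> Y. wide G q r j (A \<inter> (+) t ` A)}"
proof -
  have "definable_family (\<lambda>e. A \<inter> (+) (e 0) ` A)"
    unfolding definable_family_def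
  proof (intro conjI allI impI)
    have "def_pred Y (\<lambda>e. e 0 \<in> A \<and> (\<exists>z\<in>Y. case_nat z e 0 \<in> A \<and> case_nat z e 2 + case_nat z e 0 = case_nat z e 1))"
      by (intro def_pred_conj def_pred_ex[OF group_definable, where P = "\<lambda>e. e 0 \<in> A \<and> e 2 + e 0 = e 1"]
          def_pred_mem[OF assms(1) group_in_ring] def_pred_add[OF group_bounded])
    then show "def_pred Y (\<lambda>e. e 0 \<in> A \<inter> (+) ((e \<circ> Suc) 0) ` A)"
    proof (rule def_pred_cong)
      fix e :: "nat \<Rightarrow> 'a"
      have "(\<exists>z\<in>Y. z \<in> A \<and> e 1 + z = e 0) \<longleftrightarrow> e 0 \<in> (+) (e 1) ` A"
        using assms(2) by (auto simp: image_iff) metis+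
      then show "(e 0 \<in> A \<and> (\<exists>z\<in>Y. case_nat z e 0 \<in> A \<and> case_nat z e 2 + case_nat z e 0 = case_nat z e 1))
          = (e 0 \<in> A \<inter> (+) ((e \<circ> Suc) 0) ` A)" by (simp add: numeral_2_eq_2)
    qed
  qed (use assms(2) in auto)
  from def_set_of_def_pred[OF group_definable def_pred_wide[OF assms(3) this]] show ?thesis by simp
qed

sublocale definable_group Y n "\<lambda>A. def_set A \<and> A \<subseteq> Y"
proof
  show "def_set ((+) t ` A) \<and> (+) t ` A \<subseteq> Y" if "def_set A \<and> A \<subseteq> Y" "t \<in> Y" for A t
    using that group_in_ring group_bounded def_set_translate[of A m t] add_subgroup_add[OF subgroup] by auto
  show "def_set {t \<in> Y. wide G q r j (A \<inter> (+) t ` A)} \<and> {t \<in> Y. wide G q r j (A \<inter> (+) t ` A)} \<subseteq> Y"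
    if "def_set A \<and> A \<subseteq> Y" "fin_subgroup G" for A G q r j
    using def_set_wide that by auto
qed (use group_definable def_set_Int def_set_Diff def_set_Un in auto)

end

context coded_ring
begin

lemma R_subgroup: "add_subgroup R"
  by (rule is_subring_add_subgroup[OF generated_subring_is_subring])

lemma def_set_finite_Union:
  assumes "finite I" "\<And>i. i \<in> I \<Longrightarrow> def_set (A i)" "I \<noteq> {}"
  shows "def_set (\<Union>i\<in>I. A i)"
  using assms(1,3,2) by (induction I rule: finite_ne_induct) (auto intro: def_set_Un)

text \<open>Bounded exponent makes the finite set of translations generate a finite group \<open>E\<close>, so that \<open>X + E\<close> is
a group to which \<open>definable_subgroup_in_fourfold_sum\<close> applies.\<close>
lemma definable_subgroup_in_fourfold:
  assumes approx: "approximate_subring X" and char: "positive_characteristic R"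
  obtains L T where "def_set L" "add_subgroup L" "L \<subseteq> X + X + X + X" "finite T" "X \<subseteq> T + L"
proof -
  obtain F where F: "finite F" "F \<subseteq> R" "X * X \<union> (X + X) \<subseteq> F + X"
    using approx by (auto simp: approximate_subring_def)
  obtain n where n: "n > 0" "\<And>r. r \<in> R \<Longrightarrow> n \<cdot> r = 0"
    using char by (auto simp: positive_characteristic_def)
  interpret ring: bounded_exponent_group R n using R_subgroup n by unfold_locales auto
  obtain E where E: "finite_subgroup_of R E" "F \<subseteq> E"
    using ring.extend[OF ring.trivial_fin_subgroup F(1,2)] by metis
  note Efin = finite_subgroup_ofD(1)[OF E(1)] and Esg = finite_subgroup_ofD(2)[OF E(1)] and ER = finite_subgroup_ofD(3)[OF E(1)]
  define Y where "Y = X + E"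
  have neg: "- x \<in> X" if "x \<in> X" for x using symmetric that by (auto simp: additively_symmetric_def)
  have Ysg: "add_subgroup Y"
    unfolding add_subgroup_def
  proof (intro conjI ballI)
    have "0 + 0 \<in> Y" unfolding Y_def using zero_in_X add_subgroup_zero[OF Esg] by (intro set_plus_intro)
    then show "0 \<in> Y" by simp
    fix u v assume "u \<in> Y" "v \<in> Y"
    then obtain x e x' e' where *: "x \<in> X" "e \<in> E" "u = x + e" "x' \<in> X" "e' \<in> E" "v = x' + e'"
      unfolding Y_def by (auto elim!: set_plus_elim)
    have "x + - x' \<in> X + X" using *(1,4) neg by (intro set_plus_intro) auto
    then \<comment> \<open>\<open>X + X \<subseteq> F + X\<close> and \<open>F \<subseteq> E\<close> bring a difference back into \<open>X + E\<close>.\<close>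
    obtain f x'' where f: "f \<in> F" "x'' \<in> X" "x + - x' = f + x''" using F(3) by (auto elim!: set_plus_elim)
    have "u - v = (x + - x') + (e - e')" using * by simp
    also have "\<dots> = x'' + (f + (e - e'))" using f by simp
    finally show "u - v \<in> Y"
      unfolding Y_def using f E(2) *(2,5) Esg
      by (metis add_subgroup_add add_subgroup_diff set_plus_intro subsetD)
  qed
  obtain m where m: "E \<subseteq> iter_set X m" using def_set_bounded[OF Efin ER] .
  have Ym: "Y \<subseteq> iter_set X (Suc m)"
  proof
    fix y assume "y \<in> Y"
    then obtain x e where "x \<in> X" "e \<in> E" "y = x + e" unfolding Y_def by (auto elim!: set_plus_elim)
    moreover have "X \<subseteq> iter_set X m" using iter_set_mono[OF zero_in_X, of 0 m] by simp
    ultimately show "y \<in> iter_set X (Suc m)" using m iter_set_add[OF zero_in_X] by blast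
  qed
  have ddefX: "def_set X" using def_set_iter_set[of 0] by simp
  have Yeq: "Y = (\<Union>e\<in>E. (+) e ` X)"
    unfolding Y_def by (auto simp: set_plus_def add.commute) (metis add.commute)+
  have "def_set Y" unfolding Yeq
  proof (rule def_set_finite_Union[OF Efin])
    show "E \<noteq> {}" using add_subgroup_zero[OF Esg] by blast
    show "def_set ((+) e ` X)" if "e \<in> E" for e
      using def_set_translate[of X 0 e] ddefX ER that by auto
  qed
  then interpret group: coded_group M k c X Y n "Suc m"
    using Ysg Ym n def_set_subset by unfold_locales auto
  have EY: "E \<subseteq> Y" and XY: "X \<subseteq> Y"
    unfolding Y_def using zero_in_X add_subgroup_zero[OF Esg] by (metis add_0 add.right_neutral set_plus_intro subsetI)+
  have EY': "finite_subgroup_of Y E" using Efin Esg EY by (simp add: finite_subgroup_of_def)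
  define D where "D = {x - y | x y. x \<in> X \<and> y \<in> X}"
  have DX: "D = X + X"
  proof
    show "D \<subseteq> X + X" unfolding D_def using neg by (auto simp: set_plus_def) (metis uminus_add_conv_diff add.commute)
    show "X + X \<subseteq> D"
    proof
      fix z assume "z \<in> X + X"
      then obtain x y where "x \<in> X" "y \<in> X" "z = x - (- y)" by (auto elim!: set_plus_elim)
      then show "z \<in> D" unfolding D_def using neg by blast
    qed
  qed
  have Dd: "def_set D \<and> D \<subseteq> Y"
    using def_set_sumset[of X 0 X] ddefX add_subgroup_diff[OF Ysg] XY by (auto simp: DX[symmetric] D_def)
  have cover: "\<exists>e\<in>E. y - e \<in> X" if y: "y \<in> Y" for y
  proof -
    obtain x e where "x \<in> X" "e \<in> E" "y = x + e" using y unfolding Y_def by (auto elim!: set_plus_elim)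
    then show ?thesis by (intro bexI[of _ e]) auto
  qed
  obtain L where L: "def_set L \<and> L \<subseteq> Y" "add_subgroup L" "syndetic_in Y L" "L \<subseteq> {d - d' | d d'. d \<in> D \<and> d' \<in> D}"
    by (rule group.definable_subgroup_in_fourfold_sum[OF EY' cover Dd D_def]) (assumption, rule that)
  have "L \<subseteq> X + X + X + X"
  proof
    fix l assume "l \<in> L"
    then obtain d d' where d: "d \<in> D" "d' \<in> D" "l = d - d'" using L(4) by blast
    then obtain x y x' y' where "x \<in> X" "y \<in> X" "x' \<in> X" "y' \<in> X" "d = x - y" "d' = x' - y'"
      unfolding D_def by blast
    then have "((x + - y) + - x') + y' \<in> X + X + X + X" using neg by (intro set_plus_intro) auto
    moreover have "l = ((x + - y) + - x') + y'" using \<open>d = x - y\<close> \<open>d' = x' - y'\<close> d(3) by simp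
    ultimately show "l \<in> X + X + X + X" by simp
  qed
  moreover obtain T where "finite T" "X \<subseteq> T + L"
  proof -
    obtain T where T: "finite T" "\<forall>y\<in>Y. \<exists>t\<in>T. y - t \<in> L" using L(3) by (auto simp: syndetic_in_def)
    have "X \<subseteq> T + L"
    proof
      fix x assume "x \<in> X"
      then obtain t where "t \<in> T" "x - t \<in> L" using T(2) XY by blast
      then have "t + (x - t) \<in> T + L" by (rule set_plus_intro)
      then show "x \<in> T + L" by simp
    qed
    then show ?thesis using that T(1) by blast
  qed
  ultimately show ?thesis using that L(1,2) by blast
qed

end

section \<open>From subgroups to subrings\<close>
locale coded_approximate_ring = coded_ring M k c X
  for M :: "('f, 'p, 'm) fo_structure" and k :: nat and c :: "'a::ring \<Rightarrow> 'm list" and X :: "'a set" +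
  assumes approx: "approximate_subring X"
begin

definition covered :: "'a set \<Rightarrow> bool" where
  "covered A \<longleftrightarrow> (\<exists>F. finite F \<and> F \<subseteq> R \<and> A \<subseteq> F + X)"

lemma covered_subset: "A \<subseteq> B \<Longrightarrow> covered B \<Longrightarrow> covered A"
  unfolding covered_def by (meson order_trans)

lemma coveredE:
  assumes "covered A"
  obtains F where "finite F" "F \<subseteq> R" "\<forall>a\<in>A. \<exists>f\<in>F. \<exists>x\<in>X. a = f + x"
proof -
  obtain F where F: "finite F" "F \<subseteq> R" "A \<subseteq> F + X" using assms by (auto simp: covered_def)
  have "\<exists>f\<in>F. \<exists>x\<in>X. a = f + x" if a: "a \<in> A" for a
  proof -
    obtain f x where "a = f + x" "f \<in> F" "x \<in> X" by (rule set_plus_elim[OF subsetD[OF F(3) a]])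
    then show ?thesis by blast
  qed
  then show ?thesis using that F(1,2) by blast
qed

lemma covered_finite: "finite F \<Longrightarrow> F \<subseteq> R \<Longrightarrow> covered F"
  unfolding covered_def by (rule exI[of _ F]) (use zero_in_X set_plus_intro[of _ F 0 X] in force)

lemma covered_X: "covered X"
  unfolding covered_def by (rule exI[of _ "{0}"]) (use R_closed(4) in \<open>auto simp: set_plus_def\<close>)

lemma covered_product_sum: "covered (X * X \<union> (X + X))"
  using approx unfolding approximate_subring_def covered_def by blast

lemma R_sumset: "F \<subseteq> R \<Longrightarrow> F' \<subseteq> R \<Longrightarrow> F + F' \<subseteq> R"
  by (auto elim!: set_plus_elim intro: R_closed(1))

lemma covered_plus:
  assumes "covered A" "covered B" shows "covered (A + B)"
proof -
  obtain F where F: "finite F" "F \<subseteq> R" "A \<subseteq> F + X" using assms(1) by (auto simp: covered_def)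
  obtain F' where F': "finite F'" "F' \<subseteq> R" "B \<subseteq> F' + X" using assms(2) by (auto simp: covered_def)
  obtain F0 where F0: "finite F0" "F0 \<subseteq> R" "X + X \<subseteq> F0 + X"
  proof -
    obtain F0 where "finite F0" "F0 \<subseteq> R" "X * X \<union> (X + X) \<subseteq> F0 + X"
      using covered_product_sum unfolding covered_def by blast
    then show ?thesis using that by (meson Un_subset_iff)
  qed
  have "A + B \<subseteq> (F + X) + (F' + X)" using F(3) F'(3) by (rule set_plus_mono2)
  also have "\<dots> = (F + F') + (X + X)" by (simp add: ac_simps)
  also have "\<dots> \<subseteq> (F + F') + (F0 + X)" by (rule set_plus_mono2[OF order_refl F0(3)])
  also have "\<dots> = ((F + F') + F0) + X" by (simp add: ac_simps)
  finally have "A + B \<subseteq> ((F + F') + F0) + X" .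
  moreover have "finite ((F + F') + F0)" by (intro finite_set_plus F(1) F'(1) F0(1))
  moreover have "(F + F') + F0 \<subseteq> R" by (intro R_sumset F(2) F'(2) F0(2))
  ultimately show ?thesis unfolding covered_def by (intro exI[of _ "(F + F') + F0"]) simp
qed

lemma covered_UN: "finite I \<Longrightarrow> (\<And>i. i \<in> I \<Longrightarrow> covered (A i)) \<Longrightarrow> covered (\<Union>i\<in>I. A i)"
proof (induction I rule: finite_induct)
  case empty
  then show ?case using covered_finite[of "{}"] by simp
next
  case (insert i I)
  have "covered (A i)" "covered (\<Union>i\<in>I. A i)" using insert.IH insert.prems by simp_all
  then obtain F F' where F: "finite F" "F \<subseteq> R" "A i \<subseteq> F + X"
    and F': "finite F'" "F' \<subseteq> R" "(\<Union>i\<in>I. A i) \<subseteq> F' + X"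
    unfolding covered_def by blast
  have "F + X \<subseteq> (F \<union> F') + X" "F' + X \<subseteq> (F \<union> F') + X" by (intro set_plus_mono2; simp)+
  then show ?case unfolding covered_def using F F'
    by (intro exI[of _ "F \<union> F'"]) auto
qed

text \<open>The elements with this property form a subring, which contains \<open>X\<close> by the definition of an
approximate subring.\<close>
lemma covered_multiples_of_X:
  assumes "f \<in> R"
  shows "covered ((*) f ` X) \<and> covered ((\<lambda>x. x * f) ` X)"
proof -
  define S where "S = {f \<in> R. covered ((*) f ` X) \<and> covered ((\<lambda>x. x * f) ` X)}"
  have neg: "- x \<in> X" if "x \<in> X" for x using symmetric that by (auto simp: additively_symmetric_def)
  have "is_subring S"
    unfolding is_subring_def
  proof (intro conjI ballI)
    have "(*) 0 ` X \<subseteq> {0}" "(\<lambda>x. x * 0) ` X \<subseteq> {0}" by auto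
    then show "0 \<in> S"
      unfolding S_def using R_closed(4) covered_subset[OF _ covered_finite[of "{0}"]] by simp
    fix f g assume "f \<in> S" "g \<in> S"
    then have fg: "f \<in> R" "g \<in> R" "covered ((*) f ` X)" "covered ((\<lambda>x. x * f) ` X)"
      "covered ((*) g ` X)" "covered ((\<lambda>x. x * g) ` X)" by (auto simp: S_def)
    have l: "(*) (f - g) ` X \<subseteq> (*) f ` X + (*) g ` X"
    proof (rule image_subsetI)
      fix x assume x: "x \<in> X"
      have "f * x + g * (- x) \<in> (*) f ` X + (*) g ` X" using x neg by (intro set_plus_intro imageI) auto
      then show "(f - g) * x \<in> (*) f ` X + (*) g ` X" by (simp add: algebra_simps)
    qed
    have r: "(\<lambda>x. x * (f - g)) ` X \<subseteq> (\<lambda>x. x * f) ` X + (\<lambda>x. x * g) ` X"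
    proof (rule image_subsetI)
      fix x assume x: "x \<in> X"
      have "x * f + (- x) * g \<in> (\<lambda>x. x * f) ` X + (\<lambda>x. x * g) ` X"
        using x neg by (intro set_plus_intro imageI) auto
      then show "x * (f - g) \<in> (\<lambda>x. x * f) ` X + (\<lambda>x. x * g) ` X" by (simp add: algebra_simps)
    qed
    show "f - g \<in> S"
      using R_closed(3)[OF fg(1,2)] covered_subset[OF l covered_plus[OF fg(3,5)]]
        covered_subset[OF r covered_plus[OF fg(4,6)]] by (simp add: S_def)
    obtain F where F: "finite F" "F \<subseteq> R" "\<forall>a\<in>(*) g ` X. \<exists>f\<in>F. \<exists>x\<in>X. a = f + x"
      using coveredE[OF fg(5)] .
    obtain F' where F': "finite F'" "F' \<subseteq> R" "\<forall>a\<in>(\<lambda>x. x * f) ` X. \<exists>f\<in>F'. \<exists>x\<in>X. a = f + x"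
      using coveredE[OF fg(4)] .
    have l': "(*) (f * g) ` X \<subseteq> (*) f ` F + (*) f ` X"
    proof (rule image_subsetI)
      fix x assume "x \<in> X"
      then obtain e x' where "e \<in> F" "x' \<in> X" "g * x = e + x'" using F(3) by blast
      moreover have "f * e + f * x' \<in> (*) f ` F + (*) f ` X"
        using calculation by (intro set_plus_intro imageI)
      ultimately show "f * g * x \<in> (*) f ` F + (*) f ` X" by (simp add: mult.assoc distrib_left)
    qed
    have r': "(\<lambda>x. x * (f * g)) ` X \<subseteq> (\<lambda>x. x * g) ` F' + (\<lambda>x. x * g) ` X"
    proof (rule image_subsetI)
      fix x assume "x \<in> X"
      then obtain e x' where "e \<in> F'" "x' \<in> X" "x * f = e + x'" using F'(3) by blast
      moreover have "e * g + x' * g \<in> (\<lambda>x. x * g) ` F' + (\<lambda>x. x * g) ` X"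
        using calculation by (intro set_plus_intro imageI)
      ultimately show "x * (f * g) \<in> (\<lambda>x. x * g) ` F' + (\<lambda>x. x * g) ` X"
        by (simp add: mult.assoc[symmetric] distrib_right)
    qed
    have cF: "covered ((*) f ` F)" "covered ((\<lambda>x. x * g) ` F')"
      using F(1,2) F'(1,2) fg(1,2) R_closed(2) by (auto intro!: covered_finite)
    show "f * g \<in> S"
      using R_closed(2)[OF fg(1,2)] covered_subset[OF l' covered_plus[OF cF(1) fg(3)]]
        covered_subset[OF r' covered_plus[OF cF(2) fg(6)]] by (simp add: S_def)
  qed
  moreover have "X \<subseteq> S"
  proof
    fix x assume x: "x \<in> X"
    have "(*) x ` X \<subseteq> X * X \<union> (X + X)" "(\<lambda>y. y * x) ` X \<subseteq> X * X \<union> (X + X)"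
      using x by (auto intro: set_times_intro)
    then show "x \<in> S"
      unfolding S_def using covered_subset[OF _ covered_product_sum] subsetD[OF generated_subring_superset x] by auto
  qed
  ultimately have "R \<subseteq> S" by (rule generated_subring_least)
  then show ?thesis using assms by (auto simp: S_def)
qed

lemma covered_left_multiple:
  assumes "f \<in> R" "covered A" shows "covered ((*) f ` A)"
proof -
  obtain F where F: "finite F" "F \<subseteq> R" "\<forall>a\<in>A. \<exists>f\<in>F. \<exists>x\<in>X. a = f + x"
    using coveredE[OF assms(2)] .
  have sub: "(*) f ` A \<subseteq> (*) f ` F + (*) f ` X"
  proof (rule image_subsetI)
    fix a assume "a \<in> A"
    then obtain e x where "e \<in> F" "x \<in> X" "a = e + x" using F(3) by blast
    moreover have "f * e + f * x \<in> (*) f ` F + (*) f ` X" using calculation by (intro set_plus_intro imageI)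
    ultimately show "f * a \<in> (*) f ` F + (*) f ` X" by (simp add: distrib_left)
  qed
  have "covered ((*) f ` F)" using F(1,2) assms(1) R_closed(2) by (auto intro!: covered_finite)
  then show ?thesis
    using covered_subset[OF sub covered_plus] covered_multiples_of_X[OF assms(1)] by simp
qed

lemma covered_X_times:
  assumes "covered A" shows "covered (X * A)"
proof -
  obtain F where F: "finite F" "F \<subseteq> R" "\<forall>a\<in>A. \<exists>f\<in>F. \<exists>x\<in>X. a = f + x"
    using coveredE[OF assms] .
  have sub: "X * A \<subseteq> (\<Union>f\<in>F. (\<lambda>x. x * f) ` X) + (X * X \<union> (X + X))"
  proof
    fix z assume "z \<in> X * A"
    then obtain x a where xa: "x \<in> X" "a \<in> A" "z = x * a" by (auto elim!: set_times_elim)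
    then obtain f x' where f: "f \<in> F" "x' \<in> X" "a = f + x'" using F(3) by blast
    have "x * f + x * x' \<in> (\<Union>f\<in>F. (\<lambda>x. x * f) ` X) + (X * X \<union> (X + X))"
      using xa f by (intro set_plus_intro) (auto intro: set_times_intro)
    then show "z \<in> (\<Union>f\<in>F. (\<lambda>x. x * f) ` X) + (X * X \<union> (X + X))" using xa f by (simp add: distrib_left)
  qed
  have "covered (\<Union>f\<in>F. (\<lambda>x. x * f) ` X)"
    using covered_multiples_of_X F(2) by (intro covered_UN F(1)) auto
  then show ?thesis using covered_subset[OF sub covered_plus] covered_product_sum by simp
qed

lemma covered_fourfold: "covered (X + X + X + X)"
  by (intro covered_plus covered_X)

text \<open>Definable additive subgroups of \<open>4X\<close> that are commensurable with \<open>X\<close>. A covered set meets only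
finitely many cosets of such a subgroup (\<open>covered_by_cosets\<close>).\<close>
definition big :: "'a set \<Rightarrow> bool" where
  "big H \<longleftrightarrow> def_set H \<and> add_subgroup H \<and> H \<subseteq> X + X + X + X \<and> (\<exists>T. finite T \<and> X \<subseteq> T + H)"

lemma big_subgroup: "big H \<Longrightarrow> add_subgroup H"
  and big_fourfold: "big H \<Longrightarrow> H \<subseteq> X + X + X + X"
  and big_def_set: "big H \<Longrightarrow> def_set H"
  by (auto simp: big_def)

lemma big_covered: "big H \<Longrightarrow> covered H"
  using big_fourfold covered_fourfold covered_subset by blast

lemma big_bounded: "big H \<Longrightarrow> H \<subseteq> iter_set X 3"
proof
  fix h assume "big H" "h \<in> H"
  then obtain a b d e where *: "a \<in> X" "b \<in> X" "d \<in> X" "e \<in> X" "h = a + b + d + e"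
    using big_fourfold by (fastforce elim!: set_plus_elim)
  have "a \<in> iter_set X 0" "b \<in> iter_set X 0" "d \<in> iter_set X 1" "e \<in> iter_set X 2"
    using * iter_set_mono[OF zero_in_X, of 0] by auto
  then have "a + b \<in> iter_set X (Suc 0)" "d \<in> iter_set X (Suc 0)" "e \<in> iter_set X (Suc (Suc 0))"
    using iter_set_add[OF zero_in_X] by (auto simp: numeral_2_eq_2)
  then have "a + b + d + e \<in> iter_set X (Suc (Suc (Suc 0)))"
    by (intro iter_set_add[OF zero_in_X, of _ "Suc (Suc 0)"] iter_set_add[OF zero_in_X, of _ "Suc 0"])
  then show "h \<in> iter_set X 3" using * by (simp add: numeral_3_eq_3)
qed

lemma covered_by_cosets:
  assumes "big H" "covered A"
  obtains T where "finite T" "\<forall>a\<in>A. \<exists>t\<in>T. a - t \<in> H"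
proof -
  obtain T where T: "finite T" "X \<subseteq> T + H" using assms(1) by (auto simp: big_def)
  obtain F where F: "finite F" "A \<subseteq> F + X" using assms(2) by (auto simp: covered_def)
  have "A \<subseteq> F + (T + H)" using F(2) T(2) by (meson order_refl order_trans set_plus_mono2)
  then have "A \<subseteq> (F + T) + H" by (simp add: add.assoc)
  then have sub: "\<And>a. a \<in> A \<Longrightarrow> a \<in> (F + T) + H" by blast
  have "\<exists>t\<in>F + T. a - t \<in> H" if a: "a \<in> A" for a
  proof -
    obtain t h where "t \<in> F + T" "h \<in> H" "a = t + h" using sub[OF a] by (rule set_plus_elim)
    then show ?thesis by (intro bexI[of _ t]) auto
  qed
  then show ?thesis using that F(1) T(1) finite_set_plus by blast
qed

lemma covered_finitely_many_cosets:
  assumes "big H" "covered A"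
  shows "finite ((\<lambda>a. (+) a ` H) ` A)"
proof -
  obtain T where T: "finite T" "\<forall>a\<in>A. \<exists>t\<in>T. a - t \<in> H" using covered_by_cosets[OF assms] .
  have "(\<lambda>a. (+) a ` H) ` A \<subseteq> (\<lambda>t. (+) t ` H) ` T"
  proof (rule image_subsetI)
    fix a assume "a \<in> A"
    then obtain t where t: "t \<in> T" "a - t \<in> H" using T(2) by blast
    then show "(+) a ` H \<in> (\<lambda>t. (+) t ` H) ` T"
      using coset_eq[OF big_subgroup[OF assms(1)] t(2)] imageI[of t T "\<lambda>t. (+) t ` H"] by simp
  qed
  then show ?thesis by (rule finite_subset) (use T(1) in simp)
qed

lemma coset_eqD:
  assumes "add_subgroup H" "(+) a ` H = (+) b ` H"
  shows "a - b \<in> H"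
proof -
  have "a + 0 \<in> (+) a ` H" using add_subgroup_zero[OF assms(1)] by blast
  then obtain h where "h \<in> H" "a = b + h" using assms(2) by auto
  then show ?thesis by simp
qed

lemma finite_representatives:
  assumes H: "big H" and cov: "covered (f ` A)"
  obtains U where "finite U" "U \<subseteq> A" "\<forall>a\<in>A. \<exists>u\<in>U. f a - f u \<in> H"
proof -
  let ?g = "\<lambda>a. (+) (f a) ` H"
  have "finite (?g ` A)" using covered_finitely_many_cosets[OF H cov] by (simp add: image_image)
  then obtain U where U: "U \<subseteq> A" "finite U" "?g ` A = ?g ` U"
    using finite_subset_image[of "?g ` A" ?g A] by blast
  have "\<exists>u\<in>U. f a - f u \<in> H" if "a \<in> A" for a
  proof -
    have "?g a \<in> ?g ` U" using that U(3) by blast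
    then obtain u where "u \<in> U" "?g a = ?g u" by blast
    then show ?thesis using coset_eqD[OF big_subgroup[OF H]] by blast
  qed
  then have "\<forall>a\<in>A. \<exists>u\<in>U. f a - f u \<in> H" ..
  from that[OF U(2,1) this] show ?thesis .
qed

text \<open>Modulo \<open>H0\<close>, left multiplication by \<open>f\<close> takes only finitely many values on \<open>H1\<close>, so its kernel has
finite index.\<close>
lemma big_left_preimage:
  assumes H1: "big H1" and H0: "big H0" and f: "f \<in> R"
  shows "big {u \<in> H1. f * u \<in> H0}"
proof -
  let ?K = "{u \<in> H1. f * u \<in> H0}"
  note s1 = big_subgroup[OF H1] and s0 = big_subgroup[OF H0]
  have "def_set ?K" by (rule def_set_left_mult_preimage[OF big_def_set[OF H1] big_bounded[OF H1] big_def_set[OF H0] f])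
  moreover have K: "add_subgroup ?K"
    using add_subgroup_zero[OF s1] add_subgroup_zero[OF s0] add_subgroup_diff[OF s1] add_subgroup_diff[OF s0]
    by (auto simp: add_subgroup_def right_diff_distrib)
  moreover have "?K \<subseteq> X + X + X + X" using big_fourfold[OF H1] by blast
  moreover obtain T' where "finite T'" "X \<subseteq> T' + ?K"
  proof -
    obtain U where U: "finite U" "U \<subseteq> H1" "\<forall>a\<in>H1. \<exists>u\<in>U. f * a - f * u \<in> H0"
      using finite_representatives[OF H0 covered_left_multiple[OF f big_covered[OF H1]]] .
    obtain T where T: "finite T" "\<forall>a\<in>X. \<exists>t\<in>T. a - t \<in> H1" using covered_by_cosets[OF H1 covered_X] .
    have "X \<subseteq> (T + U) + ?K"
    proof
      fix x assume "x \<in> X"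
      then obtain t where t: "t \<in> T" "x - t \<in> H1" using T(2) by blast
      then obtain u where u: "u \<in> U" "f * (x - t) - f * u \<in> H0" using U(3) by blast
      have "(x - t) - u \<in> ?K" using u U(2) t(2) add_subgroup_diff[OF s1] by (auto simp: right_diff_distrib)
      then have "(t + u) + ((x - t) - u) \<in> (T + U) + ?K" using t(1) u(1) by (intro set_plus_intro)
      then show "x \<in> (T + U) + ?K" by simp
    qed
    then show ?thesis using that T(1) U(1) finite_set_plus by blast
  qed
  ultimately show ?thesis unfolding big_def by blast
qed

lemma big_finite_left_preimage:
  assumes H1: "big H1" and H0: "big H0" and F: "finite F" "F \<subseteq> R"
  shows "big {u \<in> H1. \<forall>f\<in>F. f * u \<in> H0}"
  using F
proof (induction F rule: finite_induct)
  case empty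
  then show ?case using H1 by simp
next
  case (insert f F)
  then have "big {u \<in> {u \<in> H1. \<forall>f\<in>F. f * u \<in> H0}. f * u \<in> H0}"
    by (intro big_left_preimage H0) auto
  then show ?case by (rule back_subst[of big]) auto
qed

text \<open>Think of \<open>x * y\<close> modulo \<open>H0\<close> as a bilinear map with finitely many values. Let \<open>H1\<close> be such that the
set of values on \<open>X \<times> H1\<close> does not shrink when \<open>H1\<close> is replaced by a smaller big subgroup. To add
\<open>x * y\<close> and \<open>x' * y'\<close>, realise the second value as \<open>x1 * y1\<close> with \<open>y1\<close> annihilated by \<open>x\<close> and by
finitely many \<open>f\<close>, which are representatives of \<open>X\<close> modulo the annihilator of \<open>y\<close>. With \<open>f\<close> the one for
\<open>x1\<close>, all mixed terms vanish in \<open>(x + (x1 - f)) * (y + y1)\<close>. Its left factor lies in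
\<open>X + X + X \<subseteq> F3 + X\<close>, and \<open>H1\<close> was chosen to be annihilated by \<open>F3\<close>, so the value is attained on
\<open>X \<times> H1\<close>. It is essential that \<open>f \<in> X\<close>, as \<open>F3\<close> is fixed before \<open>y\<close> is known.\<close>
lemma additive_group_of_products:
  assumes H0: "big H0"
  obtains H1 where "big H1" "H1 \<subseteq> H0" "add_subgroup (H0 + X * H1)"
proof -
  have neg: "- x \<in> X" if "x \<in> X" for x using symmetric that by (auto simp: additively_symmetric_def)
  have XR: "X \<subseteq> R" by (rule generated_subring_superset)
  note s0 = big_subgroup[OF H0]
  obtain F3 where F3: "finite F3" "F3 \<subseteq> R" "\<forall>a\<in>X + X + X. \<exists>f\<in>F3. \<exists>x\<in>X. a = f + x"
    using coveredE[OF covered_plus[OF covered_plus[OF covered_X covered_X] covered_X]] .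
  define Ha where "Ha = {u \<in> H0. \<forall>f\<in>F3. f * u \<in> H0}"
  have Ha: "big Ha" unfolding Ha_def by (rule big_finite_left_preimage[OF H0 H0 F3(1,2)])
  define Z where "Z H = (\<lambda>z. (+) z ` H0) ` (X * H)" for H
  define P where "P H \<longleftrightarrow> big H \<and> H \<subseteq> Ha" for H
  have "P Ha" using Ha by (simp add: P_def)
  then obtain H1 where H1: "P H1" "\<And>H. P H \<Longrightarrow> card (Z H1) \<le> card (Z H)"
    using ex_has_least_nat[of P Ha "\<lambda>H. card (Z H)"] by blast
  have b1: "big H1" "H1 \<subseteq> Ha" "H1 \<subseteq> H0" using H1(1) by (auto simp: P_def Ha_def)
  note s1 = big_subgroup[OF b1(1)]
  have finZ: "finite (Z H1)"
    unfolding Z_def by (rule covered_finitely_many_cosets[OF H0 covered_X_times[OF big_covered[OF b1(1)]]])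
  have stable: "Z H2 = Z H1" if "big H2" "H2 \<subseteq> H1" for H2
  proof (rule card_subset_eq[OF finZ])
    have "X * H2 \<subseteq> X * H1" using that(2) by (intro set_times_mono2) auto
    then show sub: "Z H2 \<subseteq> Z H1" unfolding Z_def by blast
    have "P H2" using that b1(2) by (auto simp: P_def)
    from H1(2)[OF this] show "card (Z H2) = card (Z H1)" using card_mono[OF finZ sub] by simp
  qed
  have sum: "x * y + x' * y' \<in> H0 + X * H1" if xy: "x \<in> X" "y \<in> H1" "x' \<in> X" "y' \<in> H1" for x y x' y'
  proof -
    have "(\<lambda>x. x * y) ` X \<subseteq> X * H1" using xy(2) by (auto intro: set_times_intro)
    then have "covered ((\<lambda>x. x * y) ` X)" using covered_subset covered_X_times[OF big_covered[OF b1(1)]] by blast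
    then obtain Fy where Fy: "finite Fy" "Fy \<subseteq> X" "\<forall>a\<in>X. \<exists>f\<in>Fy. a * y - f * y \<in> H0"
      by (rule finite_representatives[OF H0])
    define H2 where "H2 = {u \<in> H1. \<forall>f\<in>insert x Fy. f * u \<in> H0}"
    have "big H2" unfolding H2_def
      by (rule big_finite_left_preimage[OF b1(1) H0]) (use Fy xy(1) XR in auto)
    then have "Z H2 = Z H1" by (rule stable) (simp add: H2_def)
    moreover have "(+) (x' * y') ` H0 \<in> Z H1" unfolding Z_def using xy(3,4) by (intro imageI set_times_intro)
    ultimately have "(+) (x' * y') ` H0 \<in> Z H2" by simp
    then obtain z where "z \<in> X * H2" "(+) (x' * y') ` H0 = (+) z ` H0" unfolding Z_def by blast
    then obtain x1 y1 where 1: "x1 \<in> X" "y1 \<in> H2" "(+) (x' * y') ` H0 = (+) (x1 * y1) ` H0"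
      by (auto elim!: set_times_elim)
    have d1: "x' * y' - x1 * y1 \<in> H0" using coset_eqD[OF s0 1(3)] .
    obtain f where f: "f \<in> Fy" "x1 * y - f * y \<in> H0" using Fy(3) 1(1) by blast
    have k: "x * y1 \<in> H0" "f * y1 \<in> H0" "y1 \<in> H1" using 1(2) f(1) by (auto simp: H2_def)
    have "(x + x1) + - f \<in> X + X + X" using xy(1) 1(1) f(1) Fy(2) neg by (intro set_plus_intro) auto
    then obtain f3 x3 where 3: "f3 \<in> F3" "x3 \<in> X" "(x + x1) + - f = f3 + x3" using F3(3) by blast
    have yy: "y + y1 \<in> H1" using add_subgroup_add[OF s1 xy(2) k(3)] .
    then have f3: "f3 * (y + y1) \<in> H0" using b1(2) 3(1) by (auto simp: Ha_def)
    have "x * y + x' * y' = (f3 + x3) * (y + y1)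
        - ((x1 * y - f * y) + x * y1 - f * y1) + (x' * y' - x1 * y1)"
      unfolding 3(3)[symmetric] by (simp add: algebra_simps)
    also have "\<dots> = (f3 * (y + y1) - ((x1 * y - f * y) + x * y1 - f * y1) + (x' * y' - x1 * y1)) + x3 * (y + y1)"
      by (simp add: distrib_right)
    also have "\<dots> \<in> H0 + X * H1"
      using add_subgroup_add[OF s0] add_subgroup_diff[OF s0] f3 f(2) k d1 3(2) yy
      by (intro set_plus_intro set_times_intro) auto
    finally show ?thesis .
  qed
  have "add_subgroup (H0 + X * H1)"
    unfolding add_subgroup_def
  proof (intro conjI ballI)
    have "0 + 0 * 0 \<in> H0 + X * H1"
      using add_subgroup_zero[OF s0] add_subgroup_zero[OF s1] zero_in_X by (intro set_plus_intro set_times_intro)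
    then show "0 \<in> H0 + X * H1" by simp
    fix u v assume "u \<in> H0 + X * H1" "v \<in> H0 + X * H1"
    then obtain h x y h' x' y' where *: "h \<in> H0" "x \<in> X" "y \<in> H1" "u = h + x * y"
      "h' \<in> H0" "x' \<in> X" "y' \<in> H1" "v = h' + x' * y'" by (auto elim!: set_plus_elim set_times_elim)
    obtain h'' z where z: "h'' \<in> H0" "z \<in> X * H1" "x * y + (- x') * y' = h'' + z"
      using sum[OF *(2,3) neg[OF *(6)] *(7)] by (rule set_plus_elim) blast
    have "(h - h' + h'') + z \<in> H0 + X * H1"
      using add_subgroup_add[OF s0 add_subgroup_diff[OF s0 *(1,5)] z(1)] z(2) by (rule set_plus_intro)
    moreover have "u - v = (h - h') + (x * y + (- x') * y')" using * by (simp add: algebra_simps)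
    then have "u - v = (h - h' + h'') + z" unfolding z(3) by (simp add: add.assoc)
    ultimately show "u - v \<in> H0 + X * H1" by simp
  qed
  then show ?thesis using that b1 by blast
qed

text \<open>The elements of an additive group \<open>T\<close> that left multiplication by \<open>T\<close> keeps in \<open>T\<close> form a subring.
It contains \<open>H2\<close>: if \<open>u \<in> H1\<close> and \<open>f * u \<in> H0\<close> for the finitely many \<open>f\<close> with \<open>T \<subseteq> F + X\<close>, then
\<open>(f + x) * u \<in> H0 + X * H1\<close>. Being a finite union of translates of \<open>H2\<close>, it is definable.\<close>
lemma definable_subring_of_big:
  assumes H0: "big H0"
  obtains S where "is_subring S" "S \<subseteq> R" "def_set S" "S \<subseteq> (X + X + X + X) + X * (X + X + X + X)"
    "additively_commensurable X S"
proof -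
  obtain H1 where H1: "big H1" "H1 \<subseteq> H0" "add_subgroup (H0 + X * H1)" using additive_group_of_products[OF H0] .
  define T where "T = H0 + X * H1"
  note s0 = big_subgroup[OF H0] and s1 = big_subgroup[OF H1(1)]
  have sT: "add_subgroup T" using H1(3) by (simp add: T_def)
  have covT: "covered T"
    unfolding T_def by (intro covered_plus covered_X_times big_covered H0 H1(1))
  obtain F where F: "finite F" "F \<subseteq> R" "\<forall>a\<in>T. \<exists>f\<in>F. \<exists>x\<in>X. a = f + x" using coveredE[OF covT] .
  have FX: "T \<subseteq> F + X" using F(3) by (auto simp: set_plus_def)
  define S where "S = {t \<in> T. \<forall>w\<in>T. w * t \<in> T}"
  have S: "is_subring S"
    unfolding is_subring_def
  proof (intro conjI ballI)
    show "0 \<in> S" using add_subgroup_zero[OF sT] by (simp add: S_def)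
    fix s t assume "s \<in> S" "t \<in> S"
    then show "s - t \<in> S" "s * t \<in> S"
      using add_subgroup_diff[OF sT] by (auto simp: S_def right_diff_distrib mult.assoc[symmetric])
  qed
  have ST: "S \<subseteq> T" by (auto simp: S_def)
  define H2 where "H2 = {u \<in> H1. \<forall>f\<in>F. f * u \<in> H0}"
  have H2: "big H2" unfolding H2_def by (rule big_finite_left_preimage[OF H1(1) H0 F(1,2)])
  have HS: "H2 \<subseteq> S"
  proof
    fix u assume u: "u \<in> H2"
    have "u + 0 * 0 \<in> T"
      unfolding T_def using u H1(2) zero_in_X add_subgroup_zero[OF s1]
      by (intro set_plus_intro set_times_intro) (auto simp: H2_def)
    moreover have "w * u \<in> T" if w: "w \<in> T" for w
    proof -
      obtain f x where fx: "f \<in> F" "x \<in> X" "w = f + x" using bspec[OF F(3) w] by blast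
      have "f * u + x * u \<in> T"
        unfolding T_def using u fx by (intro set_plus_intro set_times_intro) (auto simp: H2_def)
      then show ?thesis using fx by (simp add: distrib_right)
    qed
    ultimately show "u \<in> S" by (simp add: S_def)
  qed
  have "F + X \<subseteq> R" by (rule R_sumset[OF F(2) generated_subring_superset])
  then have SR: "S \<subseteq> R" using ST FX by blast
  have "def_set S"
  proof -
    have "covered S" using covered_subset[OF ST covT] .
    then obtain V where V: "finite V" "\<forall>a\<in>S. \<exists>t\<in>V. a - t \<in> H2" by (rule covered_by_cosets[OF H2])
    note sS = is_subring_add_subgroup[OF S]
    have mem: "t \<in> S" if "a \<in> S" "a - t \<in> H2" for a t
    proof -
      have "a - (a - t) \<in> S" using add_subgroup_diff[OF sS that(1)] HS that(2) by blast
      then show ?thesis by simp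
    qed
    have "S = (\<Union>t\<in>V \<inter> S. (+) t ` H2)"
    proof
      show "S \<subseteq> (\<Union>t\<in>V \<inter> S. (+) t ` H2)"
      proof
        fix s assume s: "s \<in> S"
        then obtain t where t: "t \<in> V" "s - t \<in> H2" using V(2) by blast
        have "t + (s - t) \<in> (+) t ` H2" using t(2) by blast
        then show "s \<in> (\<Union>t\<in>V \<inter> S. (+) t ` H2)" using t mem[OF s t(2)] by auto
      qed
      show "(\<Union>t\<in>V \<inter> S. (+) t ` H2) \<subseteq> S" using HS add_subgroup_add[OF sS] by blast
    qed
    moreover have "def_set (\<Union>t\<in>V \<inter> S. (+) t ` H2)"
    proof (rule def_set_finite_Union)
      show "finite (V \<inter> S)" using V(1) by simp
      show "V \<inter> S \<noteq> {}" using V(2) mem add_subgroup_zero[OF sS] by blast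
      show "def_set ((+) t ` H2)" if "t \<in> V \<inter> S" for t
        using def_set_translate[OF big_def_set[OF H2] big_bounded[OF H2]] that SR by blast
    qed
    ultimately show ?thesis by simp
  qed
  moreover have "S \<subseteq> (X + X + X + X) + X * (X + X + X + X)"
  proof -
    have "T \<subseteq> (X + X + X + X) + X * (X + X + X + X)"
      unfolding T_def using big_fourfold[OF H0] big_fourfold[OF H1(1)]
      by (intro set_plus_mono2 set_times_mono2) auto
    then show ?thesis using ST by blast
  qed
  moreover have "additively_commensurable X S"
  proof -
    obtain T2 where "finite T2" "X \<subseteq> T2 + H2" using H2 by (auto simp: big_def)
    moreover have "T2 + H2 \<subseteq> T2 + S" using HS by (intro set_plus_mono2) auto
    ultimately show ?thesis unfolding additively_commensurable_def using F(1) FX ST by blast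
  qed
  ultimately show ?thesis using that S SR by blast
qed

end

theorem theorem5p2:
  fixes M :: "('f, 'p, 'm) fo_structure"
    and k :: nat
    and c :: "'a::ring \<Rightarrow> 'm list"
    and X :: "'a set"
  assumes "is_fo_structure M"
    and "approximate_subring X"
    and "zero_definable M k c X"
    and "positive_characteristic (generated_subring X)"
  shows "\<exists>S. is_subring S \<and> S \<subseteq> generated_subring X \<and>
           definable_over M (univ M) k (c ` S) \<and>
           S \<subseteq> (X + X + X + X) + X * (X + X + X + X) \<and>
           additively_commensurable X S"
proof (cases "k = 0")
  case True
  have sym: "additively_symmetric X" using assms(2) by (simp add: approximate_subring_def)
  then have 0: "0 \<in> X" by (simp add: additively_symmetric_def)
  have def: "definable_over M {} k (c ` iter_set X n)" for n using assms(3) by (simp add: zero_definable_def)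
  \<comment> \<open>With \<open>k = 0\<close> there is a single code, so the ring is trivial.\<close>
  have "c x = []" if "x \<in> X" for x
    using definable_over_subset[OF def[of 0]] that True by (auto simp: tuples_def)
  moreover have "inj_on c X"
    using assms(3) generated_subring_superset by (auto simp: zero_definable_def intro: inj_on_subset)
  ultimately have X: "X = {0}" using 0 by (auto simp: inj_on_def)
  have "is_subring X" unfolding X by (simp add: is_subring_def)
  moreover have "definable_over M (univ M) k (c ` X)" using definable_over_mono[OF def[of 0], of "univ M"] by simp
  moreover have "X \<subseteq> (X + X + X + X) + X * (X + X + X + X)"
    unfolding X by (auto simp: set_plus_def set_times_def)
  moreover have "additively_commensurable X X"
    unfolding additively_commensurable_def X by (auto simp: set_plus_def)
  ultimately show ?thesis using generated_subring_superset by blast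
next
  case False
  interpret coded_approximate_ring M k c X
    using assms False by unfold_locales (auto simp: approximate_subring_def)
  obtain L T where "def_set L" "add_subgroup L" "L \<subseteq> X + X + X + X" "finite T" "X \<subseteq> T + L"
    using definable_subgroup_in_fourfold[OF assms(2,4)] .
  then have "big L" by (auto simp: big_def)
  then obtain S where "is_subring S" "S \<subseteq> R" "def_set S" "S \<subseteq> (X + X + X + X) + X * (X + X + X + X)"
    "additively_commensurable X S" by (rule definable_subring_of_big)
  then show ?thesis using def_set_iff_definable_over by blast
qed

end
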